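(* Assume $\alpha=2-2H$ with $H\in(1/2,1)$, $\sigma>0$, $\mathbb E|x_0|^2<\infty$, and $b(x)=Bx$ for a constant $d\times d$ matrix $B$. For a positive integer $N$ with $k=T/N<1$ set $t_n=nk$ and define \[ x_n=x_0+\frac{k^{\alpha}}{\Gamma(1+\alpha)}\sum_{j=1}^n Bx_{j-1}\big((n-j+1)^{\alpha}-(n-j)^{\alpha}\big)+G(t_n),\qquad 0\le n\le N. \] Then there is a constant $C(T,H)$ independent of $N$ such that \[ \sup_{0\le n\le N}\|x_n-x(t_n)\|\le \begin{cases} C(T,H)\,k^{3-3H}, & H\in(3/4,1),\\ C(T,H)\,\sqrt{|\ln k|}\,k^{3/4}, & H=3/4,\\ C(T,H)\,k^{3/2-H}, & H\in(1/2,3/4). \end{cases} \]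
   Context: Fix $T>0$, $d\ge1$. On a probability space let $x_0$ be an $\mathbb R^d$-valued random variable and $B_H$ a $d$-dimensional process with independent fractional Brownian motion components of Hurst index $H$ (centered Gaussian, $B_H^i(0)=0$, covariance $\tfrac12(t^{2H}+s^{2H}-|t-s|^{2H})$). Let $G(t)=\frac{\sigma}{\Gamma(\alpha)}\int_0^t (t-s)^{\alpha-1}\,dB_H(s)$ and let $x(t)$, $t\in[0,T]$, be the unique continuous strong solution of \[ x(t)=x_0+\frac{1}{\Gamma(\alpha)}\int_0^t (t-s)^{\alpha-1} Bx(s)\,ds+G(t). \] The scheme uses the same realization of $x_0$ and $G$. $\|v\|:=\sqrt{\mathbb E|v|^2}$. *)

theory Defs
  imports "HOL-Probability.Probability"
begin

definition gaussian_rv :: "'a measure \<Rightarrow> ('a \<Rightarrow> real) \<Rightarrow> bool" where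
  "gaussian_rv M Y \<longleftrightarrow> Y \<in> borel_measurable M \<and>
     ((\<exists>\<mu> s. s > 0 \<and> distributed M lborel Y (\<lambda>x. ennreal (normal_density \<mu> s x)))
      \<or> (\<exists>c. AE \<omega> in M. Y \<omega> = c))"

definition fbm :: "'a measure \<Rightarrow> real \<Rightarrow> (real \<Rightarrow> 'a \<Rightarrow> real) \<Rightarrow> bool" where
  "fbm M H W \<longleftrightarrow>
     (\<forall>t. W t \<in> borel_measurable M) \<and>
     (\<forall>\<omega>\<in>space M. W 0 \<omega> = 0) \<and>
     (\<forall>(n::nat) (c::nat \<Rightarrow> real) (ts::nat \<Rightarrow> real). (\<forall>i<n. 0 \<le> ts i) \<longrightarrow>
         gaussian_rv M (\<lambda>\<omega>. \<Sum>i<n. c i * W (ts i) \<omega>)) \<and>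
     (\<forall>t\<ge>0. integrable M (W t) \<and> prob_space.expectation M (W t) = 0) \<and>
     (\<forall>t\<ge>0. \<forall>s\<ge>0. prob_space.expectation M (\<lambda>\<omega>. W t \<omega> * W s \<omega>)
          = (t powr (2*H) + s powr (2*H) - \<bar>t - s\<bar> powr (2*H)) / 2)"

definition vec_fbm :: "'a measure \<Rightarrow> real \<Rightarrow> (real \<Rightarrow> 'a \<Rightarrow> real^'d::finite) \<Rightarrow> bool" where
  "vec_fbm M H BH \<longleftrightarrow>
     (\<forall>i. fbm M H (\<lambda>t \<omega>. BH t \<omega> $ i)) \<and>
     prob_space.indep_vars M (\<lambda>_. Pi\<^sub>M UNIV (\<lambda>_. borel)) (\<lambda>i \<omega>. (\<lambda>t. BH t \<omega> $ i)) UNIV"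

text \<open>Left-point Riemann--Stieltjes sum for the Wiener integral
  (\<sigma>/\<Gamma>(\<alpha>)) \<integral>_0^t (t-s)^(\<alpha>-1) dB_H(s) on the uniform grid with m cells.\<close>
definition G_sum :: "real \<Rightarrow> real \<Rightarrow> (real \<Rightarrow> 'a \<Rightarrow> real^'d::finite) \<Rightarrow> nat \<Rightarrow> real \<Rightarrow> 'a \<Rightarrow> real^'d" where
  "G_sum \<sigma> \<alpha> BH m t \<omega> = (\<sigma> / Gamma \<alpha>) *\<^sub>R
     (\<Sum>i<m. (t - real i * t / real m) powr (\<alpha> - 1) *\<^sub>R
        (BH (real (Suc i) * t / real m) \<omega> - BH (real i * t / real m) \<omega>))"

text \<open>G t is the Wiener integral: the L^2(M)-limit of the Riemann--Stieltjes sums.\<close>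
definition is_frac_noise :: "'a measure \<Rightarrow> real \<Rightarrow> real \<Rightarrow> (real \<Rightarrow> 'a \<Rightarrow> real^'d::finite)
     \<Rightarrow> (real \<Rightarrow> 'a \<Rightarrow> real^'d) \<Rightarrow> real \<Rightarrow> bool" where
  "is_frac_noise M \<sigma> \<alpha> BH G t \<longleftrightarrow>
     G t \<in> borel_measurable M \<and>
     (\<forall>m. integrable M (\<lambda>\<omega>. (norm (G t \<omega> - G_sum \<sigma> \<alpha> BH m t \<omega>))\<^sup>2)) \<and>
     ((\<lambda>m. prob_space.expectation M (\<lambda>\<omega>. (norm (G t \<omega> - G_sum \<sigma> \<alpha> BH m t \<omega>))\<^sup>2))
        \<longlonglongrightarrow> 0)"

definition L2norm :: "'a measure \<Rightarrow> ('a \<Rightarrow> 'b::real_normed_vector) \<Rightarrow> real" where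
  "L2norm M v = sqrt (prob_space.expectation M (\<lambda>\<omega>. (norm (v \<omega>))\<^sup>2))"

end

theory Submission
  imports Defs
begin

text \<open>
  With \<open>\<alpha> = 2 - 2 H\<close> the exponents in the covariance integral of the noise balance: splitting the
  square along the diagonal, each inner integral is the scale invariant Beta integral
  \<open>B(\<alpha>, 1 - \<alpha>)\<close>, so \<open>G\<close> has the covariance of a fractional Brownian motion of Hurst index
  \<open>1 - H < 1/2\<close>, up to a constant. Its increments over disjoint intervals are negatively correlated, so
  in the mean square of the local error \<open>\<integral> (t - s)^(\<alpha> - 1) (G(s) - G(s_)) ds\<close>, with \<open>s_\<close> the grid point
  below \<open>s\<close>, only the diagonal cells contribute. They give
  \<open>k^(3 \<alpha>) \<Sum> j^(2 \<alpha> - 2)\<close>, whose three regimes are those of the theorem. The drift part of the local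
  error is controlled by the Hoelder regularity of a fractional integral of a mean-square Hoelder
  process, and the errors are accumulated by a Gronwall inequality with exponential weights.
\<close>

subsection \<open>Singular kernels\<close>

lemma nn_integral_Icc_has_integral:
  fixes f :: "real \<Rightarrow> real"
  assumes [measurable]: "f \<in> borel_measurable borel"
    and nonneg: "\<And>x. x \<in> {a..b} \<Longrightarrow> 0 \<le> f x"
    and I: "(f has_integral I) {a..b}"
  shows "(\<integral>\<^sup>+x. ennreal (indicator {a..b} x * f x) \<partial>lborel) = ennreal I"
proof (rule nn_integral_has_integral_lborel)
  have "((\<lambda>x. if x \<in> {a..b} then f x else 0) has_integral I) UNIV"
    using I by (simp only: has_integral_restrict_UNIV)
  moreover have "(\<lambda>x. if x \<in> {a..b} then f x else 0) = (\<lambda>x. indicator {a..b} x * f x)"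
    by (auto simp: indicator_def)
  ultimately show "((\<lambda>x. indicator {a..b} x * f x) has_integral I) UNIV" by simp
qed (use nonneg in \<open>auto simp: indicator_def\<close>)

lemma nn_integral_powr_reflected:
  fixes p :: real
  assumes "a \<le> b" "b \<le> t" and p: "p \<noteq> 0" "0 < p \<or> b < t"
  shows "(\<integral>\<^sup>+s. ennreal (indicator {a..b} s * (t - s) powr (p - 1)) \<partial>lborel)
         = ennreal (((t - a) powr p - (t - b) powr p) / p)"
proof (rule nn_integral_Icc_has_integral)
  have "((\<lambda>s. (t - s) powr (p - 1)) has_integral
          (- ((t - b) powr p / p) - - ((t - a) powr p / p))) {a..b}"
  proof (rule fundamental_theorem_of_calculus_interior[OF \<open>a \<le> b\<close>])
    show "continuous_on {a..b} (\<lambda>s. - ((t - s) powr p / p))"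
      using assms by (intro continuous_intros continuous_on_powr') auto
    fix s assume s: "s \<in> {a<..<b}"
    have "((\<lambda>s. - ((t - s) powr p / p)) has_real_derivative (t - s) powr (p - 1)) (at s)"
      using s assms by (auto intro!: derivative_eq_intros simp: powr_diff field_simps)
    then show "((\<lambda>s. - ((t - s) powr p / p)) has_vector_derivative (t - s) powr (p - 1)) (at s)"
      by (simp add: has_real_derivative_iff_has_vector_derivative)
  qed
  then show "((\<lambda>s. (t - s) powr (p - 1)) has_integral ((t - a) powr p - (t - b) powr p) / p) {a..b}"
    by (simp add: diff_divide_distrib)
qed auto

lemma nn_integral_Beta:
  fixes p q :: real
  assumes "a < b" "0 < p" "0 < q"
  shows "(\<integral>\<^sup>+u. ennreal (indicator {a..b} u * ((b - u) powr (p - 1) * (u - a) powr (q - 1))) \<partial>lborel)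
         = ennreal ((b - a) powr (p + q - 1) * Beta p q)"
proof -
  define l where "l = b - a"
  have l: "l > 0" using assms by (simp add: l_def)
  have "(\<integral>\<^sup>+u. ennreal (indicator {a..b} u * ((b - u) powr (p - 1) * (u - a) powr (q - 1))) \<partial>lborel)
      = ennreal \<bar>l\<bar> * (\<integral>\<^sup>+v. ennreal (indicator {a..b} (a + l * v) *
          ((b - (a + l * v)) powr (p - 1) * (a + l * v - a) powr (q - 1))) \<partial>lborel)"
    using l by (intro nn_integral_real_affine) auto
  also have "\<dots> = ennreal l * (\<integral>\<^sup>+v. ennreal (l powr (p + q - 2)) *
      ennreal (indicator {0..1} v * (v powr (q - 1) * (1 - v) powr (p - 1))) \<partial>lborel)"
  proof (intro arg_cong2[where f="(*)"] nn_integral_cong)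
    fix v :: real
    show "ennreal (indicator {a..b} (a + l * v) *
          ((b - (a + l * v)) powr (p - 1) * (a + l * v - a) powr (q - 1)))
        = ennreal (l powr (p + q - 2)) * ennreal (indicator {0..1} v * (v powr (q - 1) * (1 - v) powr (p - 1)))"
    proof (cases "v \<in> {0..1}")
      case True
      have m: "a + l * v \<in> {a..b}"
      proof -
        have "b = a + l" by (simp add: l_def)
        moreover have "0 \<le> l * v" "l * v \<le> l * 1"
          using True l by (auto intro!: mult_left_mono)
        ultimately show ?thesis by simp
      qed
      have "b - (a + l * v) = l * (1 - v)" by (simp add: l_def algebra_simps)
      moreover have "l powr (p + q - 2) = l powr (p - 1) * l powr (q - 1)"
        by (simp add: powr_add[symmetric])
      ultimately show ?thesis
        using True l m by (simp add: powr_mult ennreal_mult[symmetric] mult_ac)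
    next
      case False
      have "a + l * v \<notin> {a..b}"
      proof
        assume "a + l * v \<in> {a..b}"
        then have "0 \<le> l * v" "l * v \<le> l * 1" by (auto simp: l_def)
        then show False using False l by (auto simp: zero_le_mult_iff)
      qed
      then show ?thesis using False by simp
    qed
  qed (use l in simp)
  also have "\<dots> = ennreal l * (ennreal (l powr (p + q - 2)) * ennreal (Beta q p))"
    using has_integral_Beta_real[of q p] assms
    by (subst nn_integral_cmult) (auto simp: nn_integral_Icc_has_integral[where f="\<lambda>v. v powr (q - 1) * (1 - v) powr (p - 1)"])
  also have "\<dots> = ennreal (l powr (p + q - 1) * Beta p q)"
  proof -
    have "l powr (p + q - 1) = l * l powr (p + q - 2)"
      using l powr_add[of l 1 "p + q - 2"] by simp
    moreover have "Beta q p \<ge> 0"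
      using assms by (simp add: Beta_def Gamma_real_pos less_imp_le)
    ultimately show ?thesis
      using l by (simp add: ennreal_mult[symmetric] Beta_commute mult_ac)
  qed
  finally show ?thesis by (simp add: l_def)
qed

definition frac_kernel :: "real \<Rightarrow> real \<Rightarrow> real \<Rightarrow> real" where
  "frac_kernel \<alpha> t s = indicator {0..t} s * (t - s) powr (\<alpha> - 1)"

lemma frac_kernel_nonneg [simp]: "0 \<le> frac_kernel \<alpha> t s"
  by (simp add: frac_kernel_def)

lemma frac_kernel_nonzeroD: "frac_kernel \<alpha> t s \<noteq> 0 \<Longrightarrow> 0 \<le> s \<and> s < t"
  by (auto simp: frac_kernel_def indicator_def split: if_splits)

lemma frac_kernel_measurable [measurable (raw)]:
  assumes [measurable]: "f \<in> borel_measurable N" "g \<in> borel_measurable N"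
  shows "(\<lambda>x. frac_kernel \<alpha> (f x) (g x)) \<in> borel_measurable N"
proof -
  have eq: "frac_kernel \<alpha> t s = (if 0 \<le> s \<and> s \<le> t then (t - s) powr (\<alpha> - 1) else 0)" for t s
    by (simp add: frac_kernel_def indicator_def)
  show ?thesis unfolding eq by measurable
qed

lemma nn_integral_frac_kernel:
  assumes "0 < \<alpha>" "0 \<le> t"
  shows "(\<integral>\<^sup>+s. ennreal (frac_kernel \<alpha> t s) \<partial>lborel) = ennreal (t powr \<alpha> / \<alpha>)"
  using nn_integral_powr_reflected[of 0 t t \<alpha>] assms by (simp add: frac_kernel_def)

lemma integrable_frac_kernel:
  assumes "0 < \<alpha>" "0 \<le> t"
  shows "integrable lborel (frac_kernel \<alpha> t)"
  using nn_integral_frac_kernel[OF assms]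
  by (intro integrableI_bounded) auto

lemma integral_frac_kernel:
  assumes "0 < \<alpha>" "0 \<le> t"
  shows "(\<integral>s. frac_kernel \<alpha> t s \<partial>lborel) = t powr \<alpha> / \<alpha>"
  using nn_integral_frac_kernel[OF assms] assms
  by (simp add: integral_eq_nn_integral)

lemma nn_integral_frac_kernel_Icc:
  assumes "0 < \<alpha>" "0 \<le> a" "a \<le> b" "b \<le> t"
  shows "(\<integral>\<^sup>+s. ennreal (indicator {a..b} s * frac_kernel \<alpha> t s) \<partial>lborel)
         = ennreal (((t - a) powr \<alpha> - (t - b) powr \<alpha>) / \<alpha>)"
proof -
  have "(\<integral>\<^sup>+s. ennreal (indicator {a..b} s * frac_kernel \<alpha> t s) \<partial>lborel)
      = (\<integral>\<^sup>+s. ennreal (indicator {a..b} s * (t - s) powr (\<alpha> - 1)) \<partial>lborel)"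
    using assms by (intro nn_integral_cong) (auto simp: frac_kernel_def indicator_def)
  with nn_integral_powr_reflected[of a b t \<alpha>] assms show ?thesis by simp
qed

lemma powr_increment_antimono:
  fixes x g h :: real
  assumes "0 \<le> x" "0 \<le> g" "0 \<le> h" "0 < \<alpha>" "\<alpha> \<le> 1"
  shows "(x + h + g) powr \<alpha> - (x + h) powr \<alpha> \<le> (x + g) powr \<alpha> - x powr \<alpha>"
proof -
  have "(\<lambda>y. (y + g) powr \<alpha> - y powr \<alpha>) (x + h) \<le> (\<lambda>y. (y + g) powr \<alpha> - y powr \<alpha>) x"
  proof (rule DERIV_nonpos_imp_decreasing_open[where f="\<lambda>y. (y + g) powr \<alpha> - y powr \<alpha>"])
    fix y assume "x < y" "y < x + h"
    then have y: "y > 0" using assms by simp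
    have "((\<lambda>y. (y + g) powr \<alpha> - y powr \<alpha>) has_real_derivative
        (\<alpha> * (y + g) powr (\<alpha> - 1) - \<alpha> * y powr (\<alpha> - 1))) (at y)"
      using y assms by (auto intro!: derivative_eq_intros)
    moreover have "(y + g) powr (\<alpha> - 1) \<le> y powr (\<alpha> - 1)"
      using y assms by (intro powr_mono2') auto
    ultimately show "\<exists>d. ((\<lambda>y. (y + g) powr \<alpha> - y powr \<alpha>) has_real_derivative d) (at y) \<and> d \<le> 0"
      using assms by (intro exI[of _ "\<alpha> * (y + g) powr (\<alpha> - 1) - \<alpha> * y powr (\<alpha> - 1)"]) auto
  qed (use assms in \<open>auto intro!: continuous_intros continuous_on_powr'\<close>)
  then show ?thesis by (simp add: algebra_simps)
qed

lemma powr_diff_le: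
  fixes a s :: real
  assumes "0 \<le> a" "a \<le> s" "0 < \<alpha>" "\<alpha> \<le> 1"
  shows "s powr \<alpha> - a powr \<alpha> \<le> s powr (\<alpha> - 1) * (s - a)"
proof (cases "a = 0")
  case False
  then have "a > 0" "s > 0" using assms by auto
  then have "s powr \<alpha> = s powr (\<alpha> - 1) * s" "a powr \<alpha> = a powr (\<alpha> - 1) * a"
    by (simp_all add: powr_diff)
  moreover have "s powr (\<alpha> - 1) \<le> a powr (\<alpha> - 1)"
    using \<open>a > 0\<close> assms by (intro powr_mono2') auto
  then have "s powr (\<alpha> - 1) * a \<le> a powr (\<alpha> - 1) * a" using \<open>a > 0\<close> by simp
  ultimately show ?thesis by (simp add: algebra_simps)
next
  case True
  then show ?thesis using assms by (cases "s = 0") (auto simp: powr_diff)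
qed

lemma powr_diff_interpolate:
  fixes a s :: real
  assumes "0 \<le> a" "a \<le> s" "0 < s" "0 < \<alpha>" "\<alpha> \<le> 1" "0 < \<gamma>" "\<gamma> \<le> 1"
  shows "s powr \<alpha> - a powr \<alpha> \<le> (s - a) powr \<gamma> * s powr (\<alpha> - \<gamma>)"
proof (cases "a = s")
  case False
  have "s - a = (s - a) powr \<gamma> * (s - a) powr (1 - \<gamma>)"
    using False assms by (simp add: powr_add[symmetric])
  also have "\<dots> \<le> (s - a) powr \<gamma> * s powr (1 - \<gamma>)"
    using assms by (intro mult_left_mono powr_mono2) auto
  finally have "s powr (\<alpha> - 1) * (s - a) \<le> s powr (\<alpha> - 1) * ((s - a) powr \<gamma> * s powr (1 - \<gamma>))"
    by (intro mult_left_mono) auto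
  also have "\<dots> = (s - a) powr \<gamma> * (s powr (\<alpha> - 1) * s powr (1 - \<gamma>))" by simp
  also have "s powr (\<alpha> - 1) * s powr (1 - \<gamma>) = s powr (\<alpha> - \<gamma>)"
    by (simp add: powr_add[symmetric])
  finally show ?thesis using powr_diff_le[of a s \<alpha>] assms by linarith
qed simp

lemma nn_integral_frac_kernel_diff:
  assumes "0 < \<alpha>" "\<alpha> \<le> 1" "0 \<le> a" "a \<le> s"
  shows "(\<integral>\<^sup>+r. ennreal \<bar>frac_kernel \<alpha> s r - frac_kernel \<alpha> a r\<bar> \<partial>lborel)
         \<le> ennreal (2 * (s - a) powr \<alpha> / \<alpha>)"
proof -
  have "(\<integral>\<^sup>+r. ennreal \<bar>frac_kernel \<alpha> s r - frac_kernel \<alpha> a r\<bar> \<partial>lborel)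
        + ennreal (s powr \<alpha> / \<alpha>)
      = (\<integral>\<^sup>+r. ennreal \<bar>frac_kernel \<alpha> s r - frac_kernel \<alpha> a r\<bar> + ennreal (frac_kernel \<alpha> s r) \<partial>lborel)"
    using assms by (simp add: nn_integral_add nn_integral_frac_kernel)
  also have "\<dots> \<le> (\<integral>\<^sup>+r. ennreal (frac_kernel \<alpha> a r)
         + 2 * ennreal (indicator {a..s} r * frac_kernel \<alpha> s r) \<partial>lborel)"
  proof (rule nn_integral_mono_AE)
    have "AE r in lborel. r \<noteq> a" by (rule AE_lborel_singleton)
    then show "AE r in lborel. ennreal \<bar>frac_kernel \<alpha> s r - frac_kernel \<alpha> a r\<bar> + ennreal (frac_kernel \<alpha> s r)
        \<le> ennreal (frac_kernel \<alpha> a r) + 2 * ennreal (indicator {a..s} r * frac_kernel \<alpha> s r)"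
    proof eventually_elim
      fix r :: real assume ra: "r \<noteq> a"
      have "\<bar>frac_kernel \<alpha> s r - frac_kernel \<alpha> a r\<bar> + frac_kernel \<alpha> s r
          \<le> frac_kernel \<alpha> a r + 2 * (indicator {a..s} r * frac_kernel \<alpha> s r)"
      proof (cases "0 \<le> r \<and> r < a")
        case True
        then have "(s - r) powr (\<alpha> - 1) \<le> (a - r) powr (\<alpha> - 1)"
          using assms by (intro powr_mono2') auto
        then show ?thesis using True assms by (auto simp: frac_kernel_def indicator_def)
      next
        case False
        then show ?thesis using ra assms by (auto simp: frac_kernel_def indicator_def)
      qed
      then show "ennreal \<bar>frac_kernel \<alpha> s r - frac_kernel \<alpha> a r\<bar> + ennreal (frac_kernel \<alpha> s r)
        \<le> ennreal (frac_kernel \<alpha> a r) + 2 * ennreal (indicator {a..s} r * frac_kernel \<alpha> s r)"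
        by (simp add: ennreal_plus[symmetric] ennreal_mult'[symmetric] ennreal_leI
              ennreal_numeral[symmetric] del: ennreal_plus ennreal_numeral)
    qed
  qed
  also have "\<dots> = ennreal (a powr \<alpha> / \<alpha>) + 2 * ennreal ((s - a) powr \<alpha> / \<alpha>)"
    using assms nn_integral_frac_kernel_Icc[of \<alpha> a s s]
    by (simp add: nn_integral_add nn_integral_frac_kernel nn_integral_cmult)
  also have "\<dots> \<le> ennreal (s powr \<alpha> / \<alpha>) + ennreal (2 * (s - a) powr \<alpha> / \<alpha>)"
    using assms by (intro add_mono ennreal_leI divide_right_mono powr_mono2)
      (auto simp: ennreal_mult'[symmetric] ennreal_numeral[symmetric] simp del: ennreal_numeral)
  finally have "ennreal (s powr \<alpha> / \<alpha>) + (\<integral>\<^sup>+r. ennreal \<bar>frac_kernel \<alpha> s r - frac_kernel \<alpha> a r\<bar> \<partial>lborel)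
      \<le> ennreal (s powr \<alpha> / \<alpha>) + ennreal (2 * (s - a) powr \<alpha> / \<alpha>)"
    by (simp add: add.commute)
  then show ?thesis using ennreal_add_left_cancel_le by simp
qed

lemma kernel_increment_weighted_le:
  fixes \<rho> h :: real
  assumes "0 < \<rho>" "0 \<le> h" "0 \<le> \<beta>" "\<beta> \<le> 1"
  shows "(\<rho> powr (\<alpha> - 1) - (\<rho> + h) powr (\<alpha> - 1)) * \<rho> powr \<beta>
       \<le> \<rho> powr (\<alpha> + \<beta> - 1) - (\<rho> + h) powr (\<alpha> + \<beta> - 1) + h * (\<rho> + h) powr (\<alpha> + \<beta> - 2)"
proof -
  define y where "y = \<rho> / (\<rho> + h)"
  have y: "0 < y" "y \<le> 1" using assms by (auto simp: y_def)
  have "y \<le> y powr \<beta>" using y assms powr_mono'[of \<beta> 1 y] by simp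
  moreover have "1 - y = h / (\<rho> + h)" using assms by (simp add: y_def field_simps)
  ultimately have 1: "1 - h / (\<rho> + h) \<le> y powr \<beta>" by simp
  have "\<rho> = (\<rho> + h) * y" using assms by (simp add: y_def)
  then have "\<rho> powr \<beta> = (\<rho> + h) powr \<beta> * y powr \<beta>"
    using assms y by (metis powr_mult add_nonneg_nonneg less_imp_le)
  then have "(\<rho> + h) powr (\<alpha> - 1) * \<rho> powr \<beta> = (\<rho> + h) powr (\<alpha> + \<beta> - 1) * y powr \<beta>"
    using assms by (simp add: powr_add[symmetric] algebra_simps)
  also have "\<dots> \<ge> (\<rho> + h) powr (\<alpha> + \<beta> - 1) * (1 - h / (\<rho> + h))"
    using 1 by (intro mult_left_mono) auto
  also have "(\<rho> + h) powr (\<alpha> + \<beta> - 1) * (1 - h / (\<rho> + h))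
      = (\<rho> + h) powr (\<alpha> + \<beta> - 1) - h * ((\<rho> + h) powr (\<alpha> + \<beta> - 1) / (\<rho> + h))"
    by (simp add: algebra_simps)
  also have "(\<rho> + h) powr (\<alpha> + \<beta> - 1) / (\<rho> + h) = (\<rho> + h) powr (\<alpha> + \<beta> - 2)"
    using assms powr_diff[of "\<rho> + h" "\<alpha> + \<beta> - 1" 1] by (simp add: algebra_simps)
  finally have "(\<rho> + h) powr (\<alpha> + \<beta> - 1) - h * (\<rho> + h) powr (\<alpha> + \<beta> - 2)
      \<le> (\<rho> + h) powr (\<alpha> - 1) * \<rho> powr \<beta>" .
  moreover have "\<rho> powr (\<alpha> - 1) * \<rho> powr \<beta> = \<rho> powr (\<alpha> + \<beta> - 1)"
    by (simp add: powr_add[symmetric] algebra_simps)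
  ultimately show ?thesis by (simp add: left_diff_distrib)
qed

lemma nn_integral_frac_kernel_diff_weighted:
  assumes "0 < \<alpha>" "\<alpha> \<le> \<gamma>" "\<gamma> < 1" "0 \<le> a" "a < s"
  shows "(\<integral>\<^sup>+r. ennreal (\<bar>frac_kernel \<alpha> s r - frac_kernel \<alpha> a r\<bar> * \<bar>r - a\<bar> powr (\<gamma> - \<alpha>)) \<partial>lborel)
         \<le> ennreal ((1 / \<gamma> + 1 / (1 - \<gamma>) + 1 / \<alpha>) * (s - a) powr \<gamma>)"
proof -
  define h where "h = s - a"
  have h: "h > 0" using assms by (simp add: h_def)
  have \<gamma>: "\<gamma> > 0" using assms by simp
  let ?D = "\<lambda>r. \<bar>frac_kernel \<alpha> s r - frac_kernel \<alpha> a r\<bar> * \<bar>r - a\<bar> powr (\<gamma> - \<alpha>)"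
  let ?A = "\<lambda>r. indicator {0..a} r * (a - r) powr (\<gamma> - 1)"
  let ?B = "\<lambda>r. indicator {0..a} r * (s - r) powr (\<gamma> - 1)"
  let ?C = "\<lambda>r. indicator {0..a} r * (s - r) powr (\<gamma> - 2)"
  let ?E = "\<lambda>r. indicator {a..s} r * (s - r) powr (\<alpha> - 1)"
  have IA: "(\<integral>\<^sup>+r. ennreal (?A r) \<partial>lborel) = ennreal (a powr \<gamma> / \<gamma>)"
    using nn_integral_powr_reflected[of 0 a a \<gamma>] assms \<gamma> by simp
  have IB: "(\<integral>\<^sup>+r. ennreal (?B r) \<partial>lborel) = ennreal ((s powr \<gamma> - h powr \<gamma>) / \<gamma>)"
    using nn_integral_powr_reflected[of 0 a s \<gamma>] assms \<gamma> by (simp add: h_def)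
  have IC: "(\<integral>\<^sup>+r. ennreal (?C r) \<partial>lborel) = ennreal ((s powr (\<gamma> - 1) - h powr (\<gamma> - 1)) / (\<gamma> - 1))"
    using nn_integral_powr_reflected[of 0 a s "\<gamma> - 1"] assms \<gamma> by (simp add: h_def)
  have IE: "(\<integral>\<^sup>+r. ennreal (?E r) \<partial>lborel) = ennreal (h powr \<alpha> / \<alpha>)"
    using nn_integral_powr_reflected[of a s s \<alpha>] assms by (simp add: h_def)
  have "(\<integral>\<^sup>+r. ennreal (?D r) \<partial>lborel) + ennreal ((s powr \<gamma> - h powr \<gamma>) / \<gamma>)
      = (\<integral>\<^sup>+r. ennreal (?D r) + ennreal (?B r) \<partial>lborel)"
    by (subst nn_integral_add) (auto simp: IB)
  also have "\<dots> \<le> (\<integral>\<^sup>+r. ennreal (?A r) + ennreal h * ennreal (?C r)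
        + ennreal (h powr (\<gamma> - \<alpha>)) * ennreal (?E r) \<partial>lborel)"
  proof (rule nn_integral_mono_AE)
    have "AE r in lborel. r \<noteq> a" by (rule AE_lborel_singleton)
    then show "AE r in lborel. ennreal (?D r) + ennreal (?B r)
        \<le> ennreal (?A r) + ennreal h * ennreal (?C r) + ennreal (h powr (\<gamma> - \<alpha>)) * ennreal (?E r)"
    proof eventually_elim
      fix r :: real assume ra: "r \<noteq> a"
      have "?D r + ?B r \<le> ?A r + h * ?C r + h powr (\<gamma> - \<alpha>) * ?E r"
      proof (cases "0 \<le> r \<and> r < a")
        case True
        have s: "s - r = (a - r) + h" by (simp add: h_def)
        have "(s - r) powr (\<alpha> - 1) \<le> (a - r) powr (\<alpha> - 1)"
          using assms True by (intro powr_mono2') auto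
        then have "\<bar>frac_kernel \<alpha> s r - frac_kernel \<alpha> a r\<bar> = (a - r) powr (\<alpha> - 1) - ((a - r) + h) powr (\<alpha> - 1)"
          using True assms by (simp add: frac_kernel_def s)
        moreover have "\<bar>r - a\<bar> = a - r" using True by simp
        ultimately show ?thesis
          using True assms kernel_increment_weighted_le[of "a - r" h "\<gamma> - \<alpha>" \<alpha>] h by (simp add: s)
      next
        case False
        show ?thesis
        proof (cases "r \<in> {a<..s}")
          case True
          then have "(s - r) powr (\<alpha> - 1) * \<bar>r - a\<bar> powr (\<gamma> - \<alpha>) \<le> (s - r) powr (\<alpha> - 1) * h powr (\<gamma> - \<alpha>)"
            using assms by (intro mult_left_mono powr_mono2) (auto simp: h_def)
          then show ?thesis using True assms by (auto simp: frac_kernel_def mult_ac)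
        next
          case F: False
          then show ?thesis using False ra assms by (auto simp: frac_kernel_def indicator_def)
        qed
      qed
      then show "ennreal (?D r) + ennreal (?B r)
        \<le> ennreal (?A r) + ennreal h * ennreal (?C r) + ennreal (h powr (\<gamma> - \<alpha>)) * ennreal (?E r)"
        using h by (simp add: ennreal_plus[symmetric] ennreal_mult[symmetric] ennreal_leI del: ennreal_plus)
    qed
  qed
  also have "\<dots> = ennreal (a powr \<gamma> / \<gamma>)
        + ennreal h * ennreal ((s powr (\<gamma> - 1) - h powr (\<gamma> - 1)) / (\<gamma> - 1))
        + ennreal (h powr (\<gamma> - \<alpha>)) * ennreal (h powr \<alpha> / \<alpha>)"
    by (simp add: nn_integral_add nn_integral_cmult IA IC IE)
  also have "\<dots> \<le> ennreal ((s powr \<gamma> - h powr \<gamma>) / \<gamma>) + ennreal ((1 / \<gamma> + 1 / (1 - \<gamma>) + 1 / \<alpha>) * h powr \<gamma>)"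
  proof -
    have eq: "(s powr (\<gamma> - 1) - h powr (\<gamma> - 1)) / (\<gamma> - 1) = (h powr (\<gamma> - 1) - s powr (\<gamma> - 1)) / (1 - \<gamma>)"
      using assms by (simp add: field_simps)
    have mono: "s powr (\<gamma> - 1) \<le> h powr (\<gamma> - 1)"
      using assms h by (intro powr_mono2') (auto simp: h_def)
    have "h * ((h powr (\<gamma> - 1) - s powr (\<gamma> - 1)) / (1 - \<gamma>)) \<le> h * (h powr (\<gamma> - 1) / (1 - \<gamma>))"
      using assms h by (intro mult_left_mono divide_right_mono) auto
    also have "\<dots> = h powr \<gamma> / (1 - \<gamma>)" using h by (simp add: powr_diff)
    finally have C: "h * ((h powr (\<gamma> - 1) - s powr (\<gamma> - 1)) / (1 - \<gamma>)) \<le> h powr \<gamma> / (1 - \<gamma>)" .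
    have E: "h powr (\<gamma> - \<alpha>) * (h powr \<alpha> / \<alpha>) = h powr \<gamma> / \<alpha>"
      by (simp add: powr_add[symmetric])
    have A: "a powr \<gamma> / \<gamma> \<le> s powr \<gamma> / \<gamma>"
      using assms \<gamma> by (intro divide_right_mono powr_mono2) auto
    have "h powr \<gamma> \<le> s powr \<gamma>" using h assms by (intro powr_mono2) (auto simp: h_def)
    with mono h assms A C E \<gamma> show ?thesis
      unfolding eq
      by (simp add: ennreal_plus[symmetric] ennreal_mult[symmetric] ennreal_leI del: ennreal_plus)
         (simp add: diff_divide_distrib distrib_right)
  qed
  finally have "ennreal ((s powr \<gamma> - h powr \<gamma>) / \<gamma>) + (\<integral>\<^sup>+r. ennreal (?D r) \<partial>lborel)
     \<le> ennreal ((s powr \<gamma> - h powr \<gamma>) / \<gamma>) + ennreal ((1 / \<gamma> + 1 / (1 - \<gamma>) + 1 / \<alpha>) * h powr \<gamma>)"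
    by (simp add: add.commute)
  then show ?thesis unfolding h_def using ennreal_add_left_cancel_le by simp
qed

lemma nn_integral_frac_kernel_powr:
  assumes "0 < \<alpha>" "0 < q" "0 < t"
  shows "(\<integral>\<^sup>+s. ennreal (frac_kernel \<alpha> t s * s powr (q - 1)) \<partial>lborel)
         = ennreal (t powr (\<alpha> + q - 1) * Beta \<alpha> q)"
  using nn_integral_Beta[of 0 t \<alpha> q] assms by (simp add: frac_kernel_def mult_ac)

lemma frac_kernel_exp_small:
  assumes "0 < \<alpha>" "0 \<le> T" "0 < \<delta>"
  obtains \<Lambda> where "0 \<le> \<Lambda>"
    "\<And>t. t \<in> {0..T} \<Longrightarrow> (\<integral>\<^sup>+s. ennreal (frac_kernel \<alpha> t s * exp (\<Lambda> * s)) \<partial>lborel) \<le> ennreal (\<delta> * exp (\<Lambda> * t))"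
proof -
  let ?f = "\<lambda>(n::nat) r. ennreal (frac_kernel \<alpha> T (T - r) * exp (- (real n * r)))"
  have refl: "(\<integral>\<^sup>+r. ennreal (frac_kernel \<alpha> t (t - r) * g r) \<partial>lborel)
      = (\<integral>\<^sup>+s. ennreal (frac_kernel \<alpha> t s * g (t - s)) \<partial>lborel)"
    if [measurable]: "g \<in> borel_measurable borel" for t g
    by (subst nn_integral_real_affine[where c="-1" and t=t]) auto
  have "(\<lambda>n. \<integral>\<^sup>+r. ?f n r \<partial>lborel) \<longlonglongrightarrow> (\<integral>\<^sup>+(r::real). 0 \<partial>lborel)"
  proof (rule nn_integral_dominated_convergence[where w="\<lambda>r. ennreal (frac_kernel \<alpha> T (T - r))"])
    show "(\<integral>\<^sup>+r. ennreal (frac_kernel \<alpha> T (T - r)) \<partial>lborel) < \<infinity>"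
      using refl[of "\<lambda>_. 1" T] nn_integral_frac_kernel[of \<alpha> T] assms by simp
    show "AE r in lborel. ?f n r \<le> ennreal (frac_kernel \<alpha> T (T - r))" for n
      by (auto simp: frac_kernel_def indicator_def intro!: AE_I2 ennreal_leI mult_left_le)
    have "AE r in lborel. r \<noteq> (0::real)" by (rule AE_lborel_singleton)
    then show "AE r in lborel. (\<lambda>n. ?f n r) \<longlonglongrightarrow> 0"
    proof eventually_elim
      fix r :: real assume "r \<noteq> 0"
      show "(\<lambda>n. ?f n r) \<longlonglongrightarrow> 0"
      proof (cases "r > 0")
        case True
        have "(\<lambda>n. exp (- r) ^ n) \<longlonglongrightarrow> 0"
          using True by (intro LIMSEQ_realpow_zero) auto
        then have "(\<lambda>n. exp (- (real n * r))) \<longlonglongrightarrow> 0"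
          by (simp add: exp_of_nat_mult[symmetric])
        then have "(\<lambda>n. frac_kernel \<alpha> T (T - r) * exp (- (real n * r))) \<longlonglongrightarrow> frac_kernel \<alpha> T (T - r) * 0"
          by (intro tendsto_intros)
        then show ?thesis using tendsto_ennrealI by fastforce
      next
        case False
        then have "frac_kernel \<alpha> T (T - r) = 0" using \<open>r \<noteq> 0\<close> by (simp add: frac_kernel_def indicator_def)
        then show ?thesis by simp
      qed
    qed
  qed auto
  then have "(\<lambda>n. \<integral>\<^sup>+r. ?f n r \<partial>lborel) \<longlonglongrightarrow> 0" by simp
  then have "eventually (\<lambda>n. (\<integral>\<^sup>+r. ?f n r \<partial>lborel) < ennreal \<delta>) sequentially"
    using assms by (intro order_tendstoD(2)[of _ 0]) auto
  then obtain n where n: "(\<integral>\<^sup>+r. ?f n r \<partial>lborel) < ennreal \<delta>"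
    by (auto simp: eventually_sequentially)
  show ?thesis
  proof (rule that[of "real n"])
    fix t assume t: "t \<in> {0..T}"
    have "(\<integral>\<^sup>+s. ennreal (frac_kernel \<alpha> t s * exp (real n * s)) \<partial>lborel)
        = (\<integral>\<^sup>+s. ennreal (frac_kernel \<alpha> t s * (exp (real n * t) * exp (- (real n * (t - s))))) \<partial>lborel)"
      by (intro nn_integral_cong) (simp add: exp_add[symmetric] algebra_simps)
    also have "\<dots> = (\<integral>\<^sup>+r. ennreal (frac_kernel \<alpha> t (t - r) * (exp (real n * t) * exp (- (real n * r)))) \<partial>lborel)"
      by (rule refl[symmetric]) simp
    also have "\<dots> = (\<integral>\<^sup>+r. ennreal (exp (real n * t)) * ennreal (frac_kernel \<alpha> t (t - r) * exp (- (real n * r))) \<partial>lborel)"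
      by (simp add: ennreal_mult[symmetric] mult_ac)
    also have "\<dots> = ennreal (exp (real n * t)) * (\<integral>\<^sup>+r. ennreal (frac_kernel \<alpha> t (t - r) * exp (- (real n * r))) \<partial>lborel)"
      by (rule nn_integral_cmult) simp
    also have "\<dots> \<le> ennreal (exp (real n * t)) * (\<integral>\<^sup>+r. ?f n r \<partial>lborel)"
      using t by (intro mult_left_mono nn_integral_mono ennreal_leI mult_right_mono)
        (auto simp: frac_kernel_def indicator_def)
    also have "\<dots> \<le> ennreal (exp (real n * t)) * ennreal \<delta>"
      using n by (intro mult_left_mono) auto
    finally show "(\<integral>\<^sup>+s. ennreal (frac_kernel \<alpha> t s * exp (real n * s)) \<partial>lborel) \<le> ennreal (\<delta> * exp (real n * t))"
      using assms by (simp add: ennreal_mult[symmetric] mult_ac)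
  qed simp
qed

subsection \<open>Covariance integrals\<close>

lemma Cauchy_Schwarz_integral:
  fixes P Q :: "'a \<Rightarrow> real"
  assumes [measurable]: "P \<in> borel_measurable M" "Q \<in> borel_measurable M"
    and P: "integrable M (\<lambda>\<omega>. (P \<omega>)\<^sup>2)" and Q: "integrable M (\<lambda>\<omega>. (Q \<omega>)\<^sup>2)"
  shows "integrable M (\<lambda>\<omega>. P \<omega> * Q \<omega>)"
    and "(\<integral>\<omega>. P \<omega> * Q \<omega> \<partial>M)\<^sup>2 \<le> (\<integral>\<omega>. (P \<omega>)\<^sup>2 \<partial>M) * (\<integral>\<omega>. (Q \<omega>)\<^sup>2 \<partial>M)"
proof -
  have sq: "(\<integral>\<^sup>+\<omega>. (ennreal \<bar>R \<omega>\<bar>)\<^sup>2 \<partial>M) = ennreal (\<integral>\<omega>. (R \<omega>)\<^sup>2 \<partial>M)"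
    if "integrable M (\<lambda>\<omega>. (R \<omega>)\<^sup>2)" for R
    using that by (simp add: ennreal_power nn_integral_eq_integral)
  have *: "(\<integral>\<^sup>+\<omega>. ennreal \<bar>P \<omega> * Q \<omega>\<bar> \<partial>M)\<^sup>2
      \<le> ennreal ((\<integral>\<omega>. (P \<omega>)\<^sup>2 \<partial>M) * (\<integral>\<omega>. (Q \<omega>)\<^sup>2 \<partial>M))"
    using Cauchy_Schwarz_nn_integral[of "\<lambda>\<omega>. ennreal \<bar>P \<omega>\<bar>" M "\<lambda>\<omega>. ennreal \<bar>Q \<omega>\<bar>"]
    by (simp add: sq[OF P] sq[OF Q] ennreal_mult[symmetric] abs_mult)
  then have "(\<integral>\<^sup>+\<omega>. ennreal \<bar>P \<omega> * Q \<omega>\<bar> \<partial>M)\<^sup>2 < \<top>"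
    using ennreal_less_top le_less_trans by blast
  then have "(\<integral>\<^sup>+\<omega>. ennreal \<bar>P \<omega> * Q \<omega>\<bar> \<partial>M) < \<infinity>"
    by (simp add: power_less_top_ennreal)
  then show int: "integrable M (\<lambda>\<omega>. P \<omega> * Q \<omega>)"
    by (intro integrableI_bounded) auto
  have "(\<integral>\<^sup>+\<omega>. ennreal \<bar>P \<omega> * Q \<omega>\<bar> \<partial>M) = ennreal (\<integral>\<omega>. \<bar>P \<omega> * Q \<omega>\<bar> \<partial>M)"
    using int by (intro nn_integral_eq_integral) auto
  with * have "(\<integral>\<omega>. \<bar>P \<omega> * Q \<omega>\<bar> \<partial>M)\<^sup>2 \<le> (\<integral>\<omega>. (P \<omega>)\<^sup>2 \<partial>M) * (\<integral>\<omega>. (Q \<omega>)\<^sup>2 \<partial>M)"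
    by (simp add: ennreal_power)
  moreover have "(\<integral>\<omega>. P \<omega> * Q \<omega> \<partial>M)\<^sup>2 \<le> (\<integral>\<omega>. \<bar>P \<omega> * Q \<omega>\<bar> \<partial>M)\<^sup>2"
    using integral_abs_bound[of M "\<lambda>\<omega>. P \<omega> * Q \<omega>"] by (simp add: abs_le_square_iff[symmetric])
  ultimately show "(\<integral>\<omega>. P \<omega> * Q \<omega> \<partial>M)\<^sup>2 \<le> (\<integral>\<omega>. (P \<omega>)\<^sup>2 \<partial>M) * (\<integral>\<omega>. (Q \<omega>)\<^sup>2 \<partial>M)"
    by simp
qed

lemma L2_inner_tendsto:
  fixes X Y :: "'a \<Rightarrow> real" and Xs Ys :: "nat \<Rightarrow> 'a \<Rightarrow> real"
  assumes [measurable]: "X \<in> borel_measurable M" "Y \<in> borel_measurable M"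
      "\<And>m. Xs m \<in> borel_measurable M" "\<And>m. Ys m \<in> borel_measurable M"
    and iX: "integrable M (\<lambda>\<omega>. (X \<omega>)\<^sup>2)" and iY: "integrable M (\<lambda>\<omega>. (Y \<omega>)\<^sup>2)"
    and iXs: "\<And>m. integrable M (\<lambda>\<omega>. (X \<omega> - Xs m \<omega>)\<^sup>2)"
    and iYs: "\<And>m. integrable M (\<lambda>\<omega>. (Y \<omega> - Ys m \<omega>)\<^sup>2)"
    and lX: "(\<lambda>m. \<integral>\<omega>. (X \<omega> - Xs m \<omega>)\<^sup>2 \<partial>M) \<longlonglongrightarrow> 0"
    and lY: "(\<lambda>m. \<integral>\<omega>. (Y \<omega> - Ys m \<omega>)\<^sup>2 \<partial>M) \<longlonglongrightarrow> 0"
  shows "(\<lambda>m. \<integral>\<omega>. Xs m \<omega> * Ys m \<omega> \<partial>M) \<longlonglongrightarrow> (\<integral>\<omega>. X \<omega> * Y \<omega> \<partial>M)"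
proof -
  have lim0: "(\<lambda>m. \<integral>\<omega>. P m \<omega> * Q m \<omega> \<partial>M) \<longlonglongrightarrow> 0"
    if [measurable]: "\<And>m. P m \<in> borel_measurable M" "\<And>m. Q m \<in> borel_measurable M"
      and "\<And>m. integrable M (\<lambda>\<omega>. (P m \<omega>)\<^sup>2)" "\<And>m. integrable M (\<lambda>\<omega>. (Q m \<omega>)\<^sup>2)"
      and "(\<lambda>m. (\<integral>\<omega>. (P m \<omega>)\<^sup>2 \<partial>M) * (\<integral>\<omega>. (Q m \<omega>)\<^sup>2 \<partial>M)) \<longlonglongrightarrow> 0"
    for P Q :: "nat \<Rightarrow> 'a \<Rightarrow> real"
  proof -
    have "(\<lambda>m. (\<integral>\<omega>. P m \<omega> * Q m \<omega> \<partial>M)\<^sup>2) \<longlonglongrightarrow> 0"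
      by (rule tendsto_sandwich[OF _ _ tendsto_const that(5)])
         (use Cauchy_Schwarz_integral(2)[OF that(1-4)] in \<open>auto\<close>)
    then show ?thesis by simp
  qed
  let ?A = "\<lambda>m \<omega>. (X \<omega> - Xs m \<omega>) * (Y \<omega> - Ys m \<omega>)"
  let ?B = "\<lambda>m \<omega>. X \<omega> * (Y \<omega> - Ys m \<omega>)"
  let ?C = "\<lambda>m \<omega>. (X \<omega> - Xs m \<omega>) * Y \<omega>"
  have A: "(\<lambda>m. \<integral>\<omega>. ?A m \<omega> \<partial>M) \<longlonglongrightarrow> 0"
    using tendsto_mult[OF lX lY] by (intro lim0 iXs iYs) auto
  have B: "(\<lambda>m. \<integral>\<omega>. ?B m \<omega> \<partial>M) \<longlonglongrightarrow> 0"
    using tendsto_mult[OF tendsto_const lY] by (intro lim0 iX iYs) auto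
  have C: "(\<lambda>m. \<integral>\<omega>. ?C m \<omega> \<partial>M) \<longlonglongrightarrow> 0"
    using tendsto_mult[OF lX tendsto_const] by (intro lim0 iXs iY) auto
  have int: "integrable M (?A m)" "integrable M (?B m)" "integrable M (?C m)"
      "integrable M (\<lambda>\<omega>. X \<omega> * Y \<omega>)" for m
    by (intro Cauchy_Schwarz_integral(1) iXs iYs iX iY; simp)+
  have "(\<integral>\<omega>. Xs m \<omega> * Ys m \<omega> \<partial>M) = (\<integral>\<omega>. X \<omega> * Y \<omega> \<partial>M) + (\<integral>\<omega>. ?A m \<omega> \<partial>M)
      - (\<integral>\<omega>. ?B m \<omega> \<partial>M) - (\<integral>\<omega>. ?C m \<omega> \<partial>M)" for m
  proof -
    have "(\<lambda>\<omega>. Xs m \<omega> * Ys m \<omega>) = (\<lambda>\<omega>. X \<omega> * Y \<omega> + ?A m \<omega> - ?B m \<omega> - ?C m \<omega>)"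
      by (auto simp: algebra_simps)
    then show ?thesis using int(1-3)[of m] int(4) by simp
  qed
  moreover have "(\<lambda>m. (\<integral>\<omega>. X \<omega> * Y \<omega> \<partial>M) + (\<integral>\<omega>. ?A m \<omega> \<partial>M)
      - (\<integral>\<omega>. ?B m \<omega> \<partial>M) - (\<integral>\<omega>. ?C m \<omega> \<partial>M)) \<longlonglongrightarrow> (\<integral>\<omega>. X \<omega> * Y \<omega> \<partial>M) + 0 - 0 - 0"
    by (intro tendsto_intros A B C)
  ultimately show ?thesis by simp
qed

lemma nn_integral_kernel_tail:
  assumes "0 < \<alpha>" "0 < q" "0 \<le> v"
  shows "(\<integral>\<^sup>+u. ennreal (frac_kernel \<alpha> t u * (if v < u then (u - v) powr (q - 1) else 0)) \<partial>lborel)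
       = ennreal (Beta \<alpha> q * (if v \<le> t then (t - v) powr (\<alpha> + q - 1) else 0))"
proof (cases "v < t")
  case True
  have "(\<integral>\<^sup>+u. ennreal (frac_kernel \<alpha> t u * (if v < u then (u - v) powr (q - 1) else 0)) \<partial>lborel)
      = (\<integral>\<^sup>+u. ennreal (indicator {v..t} u * ((t - u) powr (\<alpha> - 1) * (u - v) powr (q - 1))) \<partial>lborel)"
    using assms by (intro nn_integral_cong) (auto simp: frac_kernel_def indicator_def)
  then show ?thesis
    using nn_integral_Beta[OF True assms(1,2)] True by (simp add: mult_ac)
next
  case False
  then have "(\<lambda>u. ennreal (frac_kernel \<alpha> t u * (if v < u then (u - v) powr (q - 1) else 0))) = (\<lambda>_. 0)"
    by (auto simp: frac_kernel_def indicator_def)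
  then show ?thesis using False by auto
qed

lemma nn_integral_kernel_pair:
  assumes "0 < \<alpha>" "0 < q" "0 \<le> s" "s \<le> t"
  shows "(\<integral>\<^sup>+p. ennreal (frac_kernel \<alpha> t (fst p) * frac_kernel \<alpha> s (snd p) * \<bar>fst p - snd p\<bar> powr (q - 1))
            \<partial>(lborel \<Otimes>\<^sub>M lborel))
       = ennreal (Beta \<alpha> q) *
         ((\<integral>\<^sup>+v. ennreal (frac_kernel \<alpha> s v * (t - v) powr (\<alpha> + q - 1)) \<partial>lborel)
        + (\<integral>\<^sup>+u. ennreal (indicator {0..s} u * ((t - u) powr (\<alpha> - 1) * (s - u) powr (\<alpha> + q - 1))) \<partial>lborel))"
proof -
  let ?f1 = "\<lambda>u v. frac_kernel \<alpha> s v * (frac_kernel \<alpha> t u * (if v < u then (u - v) powr (q - 1) else 0))"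
  let ?f2 = "\<lambda>u v. frac_kernel \<alpha> t u * (frac_kernel \<alpha> s v * (if u < v then (v - u) powr (q - 1) else 0))"
  have Beta: "0 \<le> Beta \<alpha> q" using assms by (simp add: Beta_def Gamma_real_pos less_imp_le)
  have "(\<integral>\<^sup>+p. ennreal (frac_kernel \<alpha> t (fst p) * frac_kernel \<alpha> s (snd p) * \<bar>fst p - snd p\<bar> powr (q - 1))
            \<partial>(lborel \<Otimes>\<^sub>M lborel))
      = (\<integral>\<^sup>+p. ennreal (?f1 (fst p) (snd p)) + ennreal (?f2 (fst p) (snd p)) \<partial>(lborel \<Otimes>\<^sub>M lborel))"
    by (intro nn_integral_cong)
       (auto simp: ennreal_plus[symmetric] mult_ac abs_if simp del: ennreal_plus)
  also have "\<dots> = (\<integral>\<^sup>+p. ennreal (?f1 (fst p) (snd p)) \<partial>(lborel \<Otimes>\<^sub>M lborel))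
      + (\<integral>\<^sup>+p. ennreal (?f2 (fst p) (snd p)) \<partial>(lborel \<Otimes>\<^sub>M lborel))"
    by (rule nn_integral_add) simp_all
  also have "(\<integral>\<^sup>+p. ennreal (?f1 (fst p) (snd p)) \<partial>(lborel \<Otimes>\<^sub>M lborel))
      = (\<integral>\<^sup>+v. (\<integral>\<^sup>+u. ennreal (?f1 u v) \<partial>lborel) \<partial>lborel)"
    by (subst lborel_pair.nn_integral_snd[symmetric]) (simp_all cong: if_cong)
  also have "\<dots> = (\<integral>\<^sup>+v. ennreal (Beta \<alpha> q) * ennreal (frac_kernel \<alpha> s v * (t - v) powr (\<alpha> + q - 1)) \<partial>lborel)"
  proof (intro nn_integral_cong)
    fix v :: real
    show "(\<integral>\<^sup>+u. ennreal (?f1 u v) \<partial>lborel)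
        = ennreal (Beta \<alpha> q) * ennreal (frac_kernel \<alpha> s v * (t - v) powr (\<alpha> + q - 1))"
    proof (cases "0 \<le> v \<and> v \<le> s")
      case True
      have "(\<integral>\<^sup>+u. ennreal (?f1 u v) \<partial>lborel)
          = (\<integral>\<^sup>+u. ennreal (frac_kernel \<alpha> s v) *
              ennreal (frac_kernel \<alpha> t u * (if v < u then (u - v) powr (q - 1) else 0)) \<partial>lborel)"
        by (intro nn_integral_cong) (simp add: ennreal_mult[symmetric])
      also have "\<dots> = ennreal (frac_kernel \<alpha> s v) * ennreal (Beta \<alpha> q * (t - v) powr (\<alpha> + q - 1))"
        using True assms by (subst nn_integral_cmult) (auto simp: nn_integral_kernel_tail)
      finally show ?thesis using Beta by (simp add: ennreal_mult[symmetric] mult_ac)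
    qed (auto simp: frac_kernel_def indicator_def)
  qed
  also have "\<dots> = ennreal (Beta \<alpha> q) * (\<integral>\<^sup>+v. ennreal (frac_kernel \<alpha> s v * (t - v) powr (\<alpha> + q - 1)) \<partial>lborel)"
    by (rule nn_integral_cmult) simp
  also have "(\<integral>\<^sup>+p. ennreal (?f2 (fst p) (snd p)) \<partial>(lborel \<Otimes>\<^sub>M lborel))
      = (\<integral>\<^sup>+u. (\<integral>\<^sup>+v. ennreal (?f2 u v) \<partial>lborel) \<partial>lborel)"
    by (subst lborel.nn_integral_fst[symmetric]) (simp_all cong: if_cong)
  also have "\<dots> = (\<integral>\<^sup>+u. ennreal (Beta \<alpha> q) *
      ennreal (indicator {0..s} u * ((t - u) powr (\<alpha> - 1) * (s - u) powr (\<alpha> + q - 1))) \<partial>lborel)"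
  proof (intro nn_integral_cong)
    fix u :: real
    show "(\<integral>\<^sup>+v. ennreal (?f2 u v) \<partial>lborel)
        = ennreal (Beta \<alpha> q) * ennreal (indicator {0..s} u * ((t - u) powr (\<alpha> - 1) * (s - u) powr (\<alpha> + q - 1)))"
    proof (cases "0 \<le> u \<and> u \<le> t")
      case True
      have "(\<integral>\<^sup>+v. ennreal (?f2 u v) \<partial>lborel)
          = (\<integral>\<^sup>+v. ennreal (frac_kernel \<alpha> t u) *
              ennreal (frac_kernel \<alpha> s v * (if u < v then (v - u) powr (q - 1) else 0)) \<partial>lborel)"
        by (intro nn_integral_cong) (simp add: ennreal_mult[symmetric])
      also have "\<dots> = ennreal (frac_kernel \<alpha> t u) *
          ennreal (Beta \<alpha> q * (if u \<le> s then (s - u) powr (\<alpha> + q - 1) else 0))"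
        using True assms by (subst nn_integral_cmult) (auto simp: nn_integral_kernel_tail)
      finally show ?thesis using Beta True
        by (auto simp: ennreal_mult[symmetric] mult_ac frac_kernel_def)
    qed (use assms in \<open>auto simp: frac_kernel_def indicator_def\<close>)
  qed
  also have "\<dots> = ennreal (Beta \<alpha> q) * (\<integral>\<^sup>+u.
      ennreal (indicator {0..s} u * ((t - u) powr (\<alpha> - 1) * (s - u) powr (\<alpha> + q - 1))) \<partial>lborel)"
    by (rule nn_integral_cmult) simp
  finally show ?thesis by (simp add: distrib_left)
qed

lemma nn_integral_kernel_pair_swap:
  "(\<integral>\<^sup>+p. ennreal (frac_kernel \<alpha> t (fst p) * frac_kernel \<alpha> s (snd p) * \<bar>fst p - snd p\<bar> powr (q - 1))
            \<partial>(lborel \<Otimes>\<^sub>M lborel))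
   = (\<integral>\<^sup>+p. ennreal (frac_kernel \<alpha> s (fst p) * frac_kernel \<alpha> t (snd p) * \<bar>fst p - snd p\<bar> powr (q - 1))
            \<partial>(lborel \<Otimes>\<^sub>M lborel))"
  by (subst lborel_pair.nn_integral_snd[symmetric], simp,
      subst lborel.nn_integral_fst[symmetric], simp, simp add: abs_minus_commute mult_ac)

lemma has_bochner_integral_kernel_pairI:
  assumes "\<And>s t. 0 \<le> s \<Longrightarrow> s \<le> t \<Longrightarrow>
      (\<integral>\<^sup>+p. ennreal (frac_kernel \<alpha> t (fst p) * frac_kernel \<alpha> s (snd p) * \<bar>fst p - snd p\<bar> powr (q - 1))
            \<partial>(lborel \<Otimes>\<^sub>M lborel)) = ennreal (c * (t powr r + s powr r - (t - s) powr r))"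
    and "0 \<le> c" "0 < r" "0 \<le> s" "0 \<le> t"
  shows "has_bochner_integral (lborel \<Otimes>\<^sub>M lborel)
    (\<lambda>p. frac_kernel \<alpha> t (fst p) * frac_kernel \<alpha> s (snd p) * \<bar>fst p - snd p\<bar> powr (q - 1))
    (c * (t powr r + s powr r - \<bar>t - s\<bar> powr r))"
proof (rule has_bochner_integral_nn_integral)
  have "\<bar>t - s\<bar> powr r \<le> max t s powr r" using assms by (intro powr_mono2) auto
  also have "\<dots> \<le> t powr r + s powr r" by (auto simp: max_def)
  finally show "0 \<le> c * (t powr r + s powr r - \<bar>t - s\<bar> powr r)" using assms by simp
  show "(\<integral>\<^sup>+p. ennreal (frac_kernel \<alpha> t (fst p) * frac_kernel \<alpha> s (snd p) * \<bar>fst p - snd p\<bar> powr (q - 1))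
            \<partial>(lborel \<Otimes>\<^sub>M lborel)) = ennreal (c * (t powr r + s powr r - \<bar>t - s\<bar> powr r))"
  proof (cases "s \<le> t")
    case True
    then show ?thesis using assms(1)[of s t] assms by simp
  next
    case False
    then show ?thesis using assms(1)[of t s] assms
      by (subst nn_integral_kernel_pair_swap) (simp add: abs_minus_commute add_ac)
  qed
qed auto

lemma has_bochner_integral_fbm_cov:
  assumes H: "1/2 < H" and "0 \<le> s" "0 \<le> t"
  shows "has_bochner_integral (lborel \<Otimes>\<^sub>M lborel)
    (\<lambda>p. frac_kernel 1 t (fst p) * frac_kernel 1 s (snd p) * \<bar>fst p - snd p\<bar> powr (2 * H - 2))
    (1 / (2 * H * (2 * H - 1)) * (t powr (2 * H) + s powr (2 * H) - \<bar>t - s\<bar> powr (2 * H)))"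
proof -
  define q where "q = 2 * H - 1"
  have q: "q > 0" using H by (simp add: q_def)
  have "has_bochner_integral (lborel \<Otimes>\<^sub>M lborel)
    (\<lambda>p. frac_kernel 1 t (fst p) * frac_kernel 1 s (snd p) * \<bar>fst p - snd p\<bar> powr (q - 1))
    (1 / ((q + 1) * q) * (t powr (q + 1) + s powr (q + 1) - \<bar>t - s\<bar> powr (q + 1)))"
  proof (rule has_bochner_integral_kernel_pairI)
    fix s t :: real assume st: "0 \<le> s" "s \<le> t"
    have Beta: "Beta 1 q = 1 / q"
    proof -
      have "q \<notin> \<int>\<^sub>\<le>\<^sub>0" using q by (auto elim: nonpos_Ints_cases)
      then have "Gamma (1 + q) = q * Gamma q" using Gamma_plus1[of q] by (simp add: add.commute)
      then show ?thesis using Gamma_real_pos[OF q] by (simp add: Beta_def)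
    qed
    have "(\<integral>\<^sup>+v. ennreal (frac_kernel 1 s v * (t - v) powr (1 + q - 1)) \<partial>lborel)
        = (\<integral>\<^sup>+v. ennreal (indicator {0..s} v * (t - v) powr ((q + 1) - 1)) \<partial>lborel)"
    proof (rule nn_integral_cong_AE)
      have "AE v in lborel. v \<noteq> s" by (rule AE_lborel_singleton)
      then show "AE v in lborel. ennreal (frac_kernel 1 s v * (t - v) powr (1 + q - 1))
          = ennreal (indicator {0..s} v * (t - v) powr ((q + 1) - 1))"
        by eventually_elim (auto simp: frac_kernel_def indicator_def)
    qed
    also have "\<dots> = ennreal ((t powr (q + 1) - (t - s) powr (q + 1)) / (q + 1))"
      using nn_integral_powr_reflected[of 0 s t "q + 1"] st q by simp
    finally have 1: "(\<integral>\<^sup>+v. ennreal (frac_kernel 1 s v * (t - v) powr (1 + q - 1)) \<partial>lborel)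
      = ennreal ((t powr (q + 1) - (t - s) powr (q + 1)) / (q + 1))" .
    have "(\<integral>\<^sup>+u. ennreal (indicator {0..s} u * ((t - u) powr (1 - 1) * (s - u) powr (1 + q - 1))) \<partial>lborel)
       = (\<integral>\<^sup>+v. ennreal (indicator {0..s} v * (s - v) powr ((q + 1) - 1)) \<partial>lborel)"
    proof (rule nn_integral_cong_AE)
      have "AE v in lborel. v \<noteq> t" by (rule AE_lborel_singleton)
      then show "AE u in lborel. ennreal (indicator {0..s} u * ((t - u) powr (1 - 1) * (s - u) powr (1 + q - 1)))
          = ennreal (indicator {0..s} u * (s - u) powr ((q + 1) - 1))"
        by eventually_elim (auto simp: indicator_def)
    qed
    also have "\<dots> = ennreal (s powr (q + 1) / (q + 1))"
      using nn_integral_powr_reflected[of 0 s s "q + 1"] st q by simp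
    finally have 2: "(\<integral>\<^sup>+u. ennreal (indicator {0..s} u * ((t - u) powr (1 - 1) * (s - u) powr (1 + q - 1))) \<partial>lborel)
       = ennreal (s powr (q + 1) / (q + 1))" .
    have "(t - s) powr (q + 1) \<le> t powr (q + 1)" using st q by (intro powr_mono2) auto
    then show "(\<integral>\<^sup>+p. ennreal (frac_kernel 1 t (fst p) * frac_kernel 1 s (snd p) * \<bar>fst p - snd p\<bar> powr (q - 1))
            \<partial>(lborel \<Otimes>\<^sub>M lborel))
        = ennreal (1 / ((q + 1) * q) * (t powr (q + 1) + s powr (q + 1) - (t - s) powr (q + 1)))"
      using st q nn_integral_kernel_pair[of 1 q s t, unfolded 1 2 Beta]
      by (simp add: ennreal_plus[symmetric] ennreal_mult[symmetric] add_divide_distrib[symmetric] del: ennreal_plus)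
         (simp add: algebra_simps)
  qed (use assms q in auto)
  then show ?thesis by (simp add: q_def)
qed

text \<open>The exponent \<open>-\<alpha>\<close> makes the inner Beta integral scale invariant, so that the
  covariance is again that of a fractional Brownian motion.\<close>
lemma has_bochner_integral_frac_noise_cov:
  assumes \<alpha>: "0 < \<alpha>" "\<alpha> < 1" and "0 \<le> s" "0 \<le> t"
  shows "has_bochner_integral (lborel \<Otimes>\<^sub>M lborel)
    (\<lambda>p. frac_kernel \<alpha> t (fst p) * frac_kernel \<alpha> s (snd p) * \<bar>fst p - snd p\<bar> powr (- \<alpha>))
    (Beta \<alpha> (1 - \<alpha>) / \<alpha> * (t powr \<alpha> + s powr \<alpha> - \<bar>t - s\<bar> powr \<alpha>))"
proof -
  have Beta: "0 \<le> Beta \<alpha> (1 - \<alpha>)" using \<alpha> by (simp add: Beta_def Gamma_real_pos less_imp_le)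
  have "has_bochner_integral (lborel \<Otimes>\<^sub>M lborel)
    (\<lambda>p. frac_kernel \<alpha> t (fst p) * frac_kernel \<alpha> s (snd p) * \<bar>fst p - snd p\<bar> powr ((1 - \<alpha>) - 1))
    (Beta \<alpha> (1 - \<alpha>) / \<alpha> * (t powr \<alpha> + s powr \<alpha> - \<bar>t - s\<bar> powr \<alpha>))"
  proof (rule has_bochner_integral_kernel_pairI)
    fix s t :: real assume st: "0 \<le> s" "s \<le> t"
    have "(\<integral>\<^sup>+v. ennreal (frac_kernel \<alpha> s v * (t - v) powr (\<alpha> + (1 - \<alpha>) - 1)) \<partial>lborel)
        = (\<integral>\<^sup>+v. ennreal (frac_kernel \<alpha> s v) \<partial>lborel)"
    proof (rule nn_integral_cong_AE)
      have "AE v in lborel. v \<noteq> t" by (rule AE_lborel_singleton)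
      then show "AE v in lborel. ennreal (frac_kernel \<alpha> s v * (t - v) powr (\<alpha> + (1 - \<alpha>) - 1))
          = ennreal (frac_kernel \<alpha> s v)"
        by eventually_elim auto
    qed
    also have "\<dots> = ennreal (s powr \<alpha> / \<alpha>)"
      using \<alpha> st by (intro nn_integral_frac_kernel)
    finally have 1: "(\<integral>\<^sup>+v. ennreal (frac_kernel \<alpha> s v * (t - v) powr (\<alpha> + (1 - \<alpha>) - 1)) \<partial>lborel)
      = ennreal (s powr \<alpha> / \<alpha>)" .
    have "(\<integral>\<^sup>+u. ennreal (indicator {0..s} u * ((t - u) powr (\<alpha> - 1) * (s - u) powr (\<alpha> + (1 - \<alpha>) - 1))) \<partial>lborel)
       = (\<integral>\<^sup>+u. ennreal (indicator {0..s} u * (t - u) powr (\<alpha> - 1)) \<partial>lborel)"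
    proof (rule nn_integral_cong_AE)
      have "AE v in lborel. v \<noteq> s" by (rule AE_lborel_singleton)
      then show "AE u in lborel. ennreal (indicator {0..s} u * ((t - u) powr (\<alpha> - 1) * (s - u) powr (\<alpha> + (1 - \<alpha>) - 1)))
          = ennreal (indicator {0..s} u * (t - u) powr (\<alpha> - 1))"
        by eventually_elim auto
    qed
    also have "\<dots> = ennreal ((t powr \<alpha> - (t - s) powr \<alpha>) / \<alpha>)"
      using nn_integral_powr_reflected[of 0 s t \<alpha>] st \<alpha> by simp
    finally have 2: "(\<integral>\<^sup>+u. ennreal (indicator {0..s} u * ((t - u) powr (\<alpha> - 1) * (s - u) powr (\<alpha> + (1 - \<alpha>) - 1))) \<partial>lborel)
       = ennreal ((t powr \<alpha> - (t - s) powr \<alpha>) / \<alpha>)" .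
    have "(t - s) powr \<alpha> \<le> t powr \<alpha>" using st \<alpha> by (intro powr_mono2) auto
    then show "(\<integral>\<^sup>+p. ennreal (frac_kernel \<alpha> t (fst p) * frac_kernel \<alpha> s (snd p) * \<bar>fst p - snd p\<bar> powr ((1 - \<alpha>) - 1))
            \<partial>(lborel \<Otimes>\<^sub>M lborel))
        = ennreal (Beta \<alpha> (1 - \<alpha>) / \<alpha> * (t powr \<alpha> + s powr \<alpha> - (t - s) powr \<alpha>))"
      using st \<alpha> Beta nn_integral_kernel_pair[of \<alpha> "1 - \<alpha>" s t, unfolded 1 2]
      by (simp add: ennreal_plus[symmetric] ennreal_mult[symmetric] add_divide_distrib[symmetric] del: ennreal_plus)
         (simp add: algebra_simps)
  qed (use assms Beta in auto)
  then show ?thesis by simp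
qed

subsection \<open>The noise as a fractional Brownian motion\<close>

lemma frac_kernel_1: "frac_kernel 1 t u = (if 0 \<le> u \<and> u < t then 1 else 0)"
  by (auto simp: frac_kernel_def indicator_def)

lemma fbm_integrable_square:
  assumes "fbm M H W" "0 \<le> t"
  shows "integrable M (\<lambda>\<omega>. (W t \<omega>)\<^sup>2)"
proof (cases "t = 0")
  case True
  have "integrable M (\<lambda>\<omega>. (W t \<omega>)\<^sup>2) \<longleftrightarrow> integrable M (\<lambda>_. 0 :: real)"
    using assms True by (intro Bochner_Integration.integrable_cong) (auto simp: fbm_def)
  then show ?thesis by simp
next
  case False
  have "(\<integral>\<omega>. W t \<omega> * W t \<omega> \<partial>M) = (t powr (2*H) + t powr (2*H) - \<bar>t - t\<bar> powr (2*H)) / 2"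
    using assms unfolding fbm_def by blast
  then have "(\<integral>\<omega>. (W t \<omega>)\<^sup>2 \<partial>M) \<noteq> 0"
    using False assms by (simp add: power2_eq_square)
  then show ?thesis using not_integrable_integral_eq by blast
qed

lemma fbm_cov:
  assumes W: "fbm M H W" and H: "1/2 < H" and "0 \<le> s" "0 \<le> t"
  shows "integrable M (\<lambda>\<omega>. W t \<omega> * W s \<omega>)"
    and "(\<integral>\<omega>. W t \<omega> * W s \<omega> \<partial>M) = H * (2 * H - 1) *
      (\<integral>p. frac_kernel 1 t (fst p) * frac_kernel 1 s (snd p) * \<bar>fst p - snd p\<bar> powr (2 * H - 2) \<partial>(lborel \<Otimes>\<^sub>M lborel))"
proof -
  have [measurable]: "W r \<in> borel_measurable M" for r using W by (auto simp: fbm_def)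
  show "integrable M (\<lambda>\<omega>. W t \<omega> * W s \<omega>)"
    using assms by (intro Cauchy_Schwarz_integral(1) fbm_integrable_square[OF W]) auto
  have "(\<integral>\<omega>. W t \<omega> * W s \<omega> \<partial>M) = (t powr (2*H) + s powr (2*H) - \<bar>t - s\<bar> powr (2*H)) / 2"
    using assms unfolding fbm_def by simp
  then show "(\<integral>\<omega>. W t \<omega> * W s \<omega> \<partial>M) = H * (2 * H - 1) *
      (\<integral>p. frac_kernel 1 t (fst p) * frac_kernel 1 s (snd p) * \<bar>fst p - snd p\<bar> powr (2 * H - 2) \<partial>(lborel \<Otimes>\<^sub>M lborel))"
    using has_bochner_integral_integral_eq[OF has_bochner_integral_fbm_cov[of H s t]] assms H
    by (simp add: field_simps)
qed

lemma fbm_sum_cov: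
  fixes a b f g :: "nat \<Rightarrow> real"
  assumes W: "fbm M H W" and H: "1/2 < H" and a: "\<And>i. 0 \<le> a i" and b: "\<And>j. 0 \<le> b j"
  shows "(\<integral>\<omega>. (\<Sum>i<m. f i * (W (a (Suc i)) \<omega> - W (a i) \<omega>)) *
              (\<Sum>j<n. g j * (W (b (Suc j)) \<omega> - W (b j) \<omega>)) \<partial>M)
    = H * (2 * H - 1) * (\<integral>p. (\<Sum>i<m. f i * (frac_kernel 1 (a (Suc i)) (fst p) - frac_kernel 1 (a i) (fst p))) *
          (\<Sum>j<n. g j * (frac_kernel 1 (b (Suc j)) (snd p) - frac_kernel 1 (b j) (snd p))) *
          \<bar>fst p - snd p\<bar> powr (2 * H - 2) \<partial>(lborel \<Otimes>\<^sub>M lborel))"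
proof -
  let ?k = "\<lambda>p::real\<times>real. \<bar>fst p - snd p\<bar> powr (2 * H - 2)"
  let ?L = "lborel \<Otimes>\<^sub>M lborel :: (real \<times> real) measure"
  define X where "X i \<omega> = W (a (Suc i)) \<omega> - W (a i) \<omega>" for i \<omega>
  define Y where "Y j \<omega> = W (b (Suc j)) \<omega> - W (b j) \<omega>" for j \<omega>
  define \<phi> where "\<phi> i u = frac_kernel 1 (a (Suc i)) u - frac_kernel 1 (a i) u" for i u
  define \<psi> where "\<psi> j v = frac_kernel 1 (b (Suc j)) v - frac_kernel 1 (b j) v" for j v
  have intk: "integrable ?L (\<lambda>p. frac_kernel 1 t (fst p) * frac_kernel 1 s (snd p) * ?k p)"
    if "0 \<le> s" "0 \<le> t" for s t
    using has_bochner_integral_fbm_cov[OF H that] by (simp add: has_bochner_integral_iff)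
  have expand: "\<phi> i (fst p) * \<psi> j (snd p) * ?k p =
      frac_kernel 1 (a (Suc i)) (fst p) * frac_kernel 1 (b (Suc j)) (snd p) * ?k p
    - frac_kernel 1 (a (Suc i)) (fst p) * frac_kernel 1 (b j) (snd p) * ?k p
    - frac_kernel 1 (a i) (fst p) * frac_kernel 1 (b (Suc j)) (snd p) * ?k p
    + frac_kernel 1 (a i) (fst p) * frac_kernel 1 (b j) (snd p) * ?k p" for i j p
    by (simp add: \<phi>_def \<psi>_def algebra_simps)
  have expand': "X i \<omega> * Y j \<omega> = W (a (Suc i)) \<omega> * W (b (Suc j)) \<omega> - W (a (Suc i)) \<omega> * W (b j) \<omega>
      - W (a i) \<omega> * W (b (Suc j)) \<omega> + W (a i) \<omega> * W (b j) \<omega>" for i j \<omega>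
    by (simp add: X_def Y_def algebra_simps)
  have iL: "integrable ?L (\<lambda>p. \<phi> i (fst p) * \<psi> j (snd p) * ?k p)" for i j
    unfolding expand using a b by (intro Bochner_Integration.integrable_add Bochner_Integration.integrable_diff intk)
  have iM: "integrable M (\<lambda>\<omega>. X i \<omega> * Y j \<omega>)" for i j
    unfolding expand' using a b by (intro Bochner_Integration.integrable_add Bochner_Integration.integrable_diff fbm_cov(1)[OF W H])
  have XY: "(\<integral>\<omega>. X i \<omega> * Y j \<omega> \<partial>M) = H * (2 * H - 1) * (\<integral>p. \<phi> i (fst p) * \<psi> j (snd p) * ?k p \<partial>?L)" for i j
    unfolding expand expand'
    using a b by (simp add: fbm_cov[OF W H] intk right_diff_distrib distrib_left)
  have "(\<integral>\<omega>. (\<Sum>i<m. f i * X i \<omega>) * (\<Sum>j<n. g j * Y j \<omega>) \<partial>M)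
      = (\<integral>\<omega>. (\<Sum>i<m. \<Sum>j<n. f i * g j * (X i \<omega> * Y j \<omega>)) \<partial>M)"
    by (simp add: sum_product mult_ac)
  also have "\<dots> = (\<Sum>i<m. \<Sum>j<n. f i * g j * (\<integral>\<omega>. X i \<omega> * Y j \<omega> \<partial>M))"
    by (simp add: Bochner_Integration.integral_sum iM)
  also have "\<dots> = H * (2 * H - 1) * (\<Sum>i<m. \<Sum>j<n. f i * g j * (\<integral>p. \<phi> i (fst p) * \<psi> j (snd p) * ?k p \<partial>?L))"
    by (simp add: XY sum_distrib_left mult_ac)
  also have "(\<Sum>i<m. \<Sum>j<n. f i * g j * (\<integral>p. \<phi> i (fst p) * \<psi> j (snd p) * ?k p \<partial>?L))
      = (\<integral>p. (\<Sum>i<m. \<Sum>j<n. f i * g j * (\<phi> i (fst p) * \<psi> j (snd p) * ?k p)) \<partial>?L)"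
    by (simp add: Bochner_Integration.integral_sum iL)
  also have "\<dots> = (\<integral>p. (\<Sum>i<m. f i * \<phi> i (fst p)) * (\<Sum>j<n. g j * \<psi> j (snd p)) * ?k p \<partial>?L)"
    by (intro Bochner_Integration.integral_cong refl, subst sum_product, simp only: sum_distrib_right,
        intro sum.cong refl, simp only: mult_ac)
  finally show ?thesis by (simp add: X_def Y_def \<phi>_def \<psi>_def)
qed

definition riemann_step :: "real \<Rightarrow> real \<Rightarrow> nat \<Rightarrow> real \<Rightarrow> real" where
  "riemann_step \<alpha> t m u = (\<Sum>i<m. (t - real i * t / real m) powr (\<alpha> - 1) *
     (frac_kernel 1 (real (Suc i) * t / real m) u - frac_kernel 1 (real i * t / real m) u))"

lemma riemann_step_measurable [measurable]: "riemann_step \<alpha> t m \<in> borel_measurable borel"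
  unfolding riemann_step_def by measurable

lemma riemann_step_eq:
  assumes "0 \<le> u" "u < t" "0 < m"
  shows "riemann_step \<alpha> t m u = (t - real (nat \<lfloor>u * real m / t\<rfloor>) * t / real m) powr (\<alpha> - 1)"
    and "nat \<lfloor>u * real m / t\<rfloor> < m"
proof -
  have t: "t > 0" using assms by simp
  define i0 where "i0 = nat \<lfloor>u * real m / t\<rfloor>"
  have lt: "u < real j * t / real m \<longleftrightarrow> i0 < j" for j
  proof -
    have "u < real j * t / real m \<longleftrightarrow> u * real m / t < real j"
      using t assms by (simp add: field_simps)
    also have "\<dots> \<longleftrightarrow> \<lfloor>u * real m / t\<rfloor> < int j" by linarith
    also have "\<dots> \<longleftrightarrow> i0 < j"
      using assms t by (auto simp: i0_def nat_less_iff)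
    finally show ?thesis .
  qed
  show i0: "i0 < m" using lt[of m] assms by simp
  have "frac_kernel 1 (real (Suc i) * t / real m) u - frac_kernel 1 (real i * t / real m) u
      = (if i = i0 then 1 else 0)" for i
    using lt[of "Suc i"] lt[of i] assms by (simp add: frac_kernel_1 less_Suc_eq_le)
  then have "riemann_step \<alpha> t m u = (\<Sum>i<m. if i = i0 then (t - real i * t / real m) powr (\<alpha> - 1) else 0)"
    unfolding riemann_step_def by (intro sum.cong) auto
  also have "\<dots> = (t - real i0 * t / real m) powr (\<alpha> - 1)" using i0 by simp
  finally show "riemann_step \<alpha> t m u = (t - real i0 * t / real m) powr (\<alpha> - 1)" .
qed

lemma riemann_step_outside:
  assumes "0 \<le> t" "\<not> (0 \<le> u \<and> u < t)"
  shows "riemann_step \<alpha> t m u = 0"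
  unfolding riemann_step_def
proof (intro sum.neutral ballI)
  fix i assume i: "i \<in> {..<m}"
  have "real j * t / real m \<le> t" if "j \<le> m" for j
  proof (cases "m = 0")
    case False
    have "real j * t \<le> real m * t" using that assms by (intro mult_right_mono) auto
    then show ?thesis using False by (simp add: field_simps)
  qed (use assms in auto)
  from this[of i] this[of "Suc i"] i have "real i * t / real m \<le> t" "real (Suc i) * t / real m \<le> t" by auto
  then show "(t - real i * t / real m) powr (\<alpha> - 1) *
     (frac_kernel 1 (real (Suc i) * t / real m) u - frac_kernel 1 (real i * t / real m) u) = 0"
    using assms(2) by (auto simp: frac_kernel_1)
qed

lemma grid_point_bounds:
  assumes "0 \<le> u" "0 < t" "0 < m"
  shows "real (nat \<lfloor>u * real m / t\<rfloor>) * t / real m \<le> u"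
    and "u < real (nat \<lfloor>u * real m / t\<rfloor>) * t / real m + t / real m"
proof -
  let ?x = "u * real m / t"
  have x: "0 \<le> ?x" using assms by simp
  then have r: "real (nat \<lfloor>?x\<rfloor>) = of_int \<lfloor>?x\<rfloor>" by simp
  define i where "i = real (nat \<lfloor>?x\<rfloor>)"
  have "i \<le> ?x" "?x < i + 1" unfolding i_def r by linarith+
  then have "i * t / real m \<le> u" "u < i * t / real m + t / real m"
    using assms by (simp_all add: field_simps)
  then show "real (nat \<lfloor>?x\<rfloor>) * t / real m \<le> u" "u < real (nat \<lfloor>?x\<rfloor>) * t / real m + t / real m"
    by (simp_all only: i_def)
qed

lemma riemann_step_bounds:
  assumes "0 \<le> t" "\<alpha> \<le> 1"
  shows "0 \<le> riemann_step \<alpha> t m u" "riemann_step \<alpha> t m u \<le> frac_kernel \<alpha> t u"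
proof -
  have "0 \<le> riemann_step \<alpha> t m u \<and> riemann_step \<alpha> t m u \<le> frac_kernel \<alpha> t u"
  proof (cases "0 \<le> u \<and> u < t \<and> 0 < m")
    case True
    then have "t - u \<le> t - real (nat \<lfloor>u * real m / t\<rfloor>) * t / real m"
      using grid_point_bounds(1)[of u t m] by simp
    then have "(t - real (nat \<lfloor>u * real m / t\<rfloor>) * t / real m) powr (\<alpha> - 1) \<le> (t - u) powr (\<alpha> - 1)"
      using True assms by (intro powr_mono2') auto
    then show ?thesis using True riemann_step_eq(1)[of u t m \<alpha>] by (simp add: frac_kernel_def)
  next
    case False
    then have "riemann_step \<alpha> t m u = 0"
      using riemann_step_outside[OF assms(1)] by (cases "m = 0") (auto simp: riemann_step_def)
    then show ?thesis by simp
  qed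
  then show "0 \<le> riemann_step \<alpha> t m u" "riemann_step \<alpha> t m u \<le> frac_kernel \<alpha> t u" by auto
qed

lemma riemann_step_tendsto:
  assumes "0 \<le> t"
  shows "(\<lambda>m. riemann_step \<alpha> t m u) \<longlonglongrightarrow> frac_kernel \<alpha> t u"
proof (cases "0 \<le> u \<and> u < t")
  case True
  then have t: "t > 0" by auto
  let ?g = "\<lambda>m. real (nat \<lfloor>u * real m / t\<rfloor>) * t / real m"
  have "(\<lambda>m. u - t * inverse (real m)) \<longlonglongrightarrow> u - t * 0"
    by (intro tendsto_intros LIMSEQ_inverse_real_of_nat[THEN LIMSEQ_imp_Suc] lim_inverse_n)
  then have l: "(\<lambda>m. u - t / real m) \<longlonglongrightarrow> u" by (simp add: field_simps)
  have "?g \<longlonglongrightarrow> u"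
  proof (rule tendsto_sandwich[OF _ _ l tendsto_const])
    show "eventually (\<lambda>m. u - t / real m \<le> ?g m) sequentially"
      using eventually_gt_at_top[of 0]
    proof eventually_elim
      case (elim m) then show ?case using grid_point_bounds(2)[of u t m] True t by simp
    qed
    show "eventually (\<lambda>m. ?g m \<le> u) sequentially"
      using eventually_gt_at_top[of 0]
    proof eventually_elim
      case (elim m) then show ?case using grid_point_bounds(1)[of u t m] True t by simp
    qed
  qed
  then have "(\<lambda>m. (t - ?g m) powr (\<alpha> - 1)) \<longlonglongrightarrow> (t - u) powr (\<alpha> - 1)"
    using True by (intro tendsto_intros) auto
  moreover have "eventually (\<lambda>m. (t - ?g m) powr (\<alpha> - 1) = riemann_step \<alpha> t m u) sequentially"
    using eventually_gt_at_top[of 0]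
  proof eventually_elim
    case (elim m) then show ?case using riemann_step_eq(1)[of u t m \<alpha>] True by simp
  qed
  ultimately have "(\<lambda>m. riemann_step \<alpha> t m u) \<longlonglongrightarrow> (t - u) powr (\<alpha> - 1)"
    by (rule Lim_transform_eventually)
  then show ?thesis using True by (simp add: frac_kernel_def)
next
  case False
  then have "frac_kernel \<alpha> t u = 0" by (auto simp: frac_kernel_def indicator_def)
  then show ?thesis using riemann_step_outside[OF assms False] by simp
qed

definition noise_const :: "real \<Rightarrow> real \<Rightarrow> real \<Rightarrow> real" where
  "noise_const \<sigma> \<alpha> H = (\<sigma> / Gamma \<alpha>)\<^sup>2 * (H * (2 * H - 1)) * (Beta \<alpha> (1 - \<alpha>) / \<alpha>)"

lemma noise_const_nonneg:
  assumes "0 < \<alpha>" "\<alpha> < 1" "1/2 < H"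
  shows "0 \<le> noise_const \<sigma> \<alpha> H"
proof -
  have "0 \<le> Beta \<alpha> (1 - \<alpha>)" using assms by (simp add: Beta_def Gamma_real_pos less_imp_le)
  then show ?thesis using assms by (simp add: noise_const_def)
qed

lemma frac_noise_measurable:
  assumes "is_frac_noise M \<sigma> \<alpha> BH G t" shows "G t \<in> borel_measurable M"
  using assms by (simp add: is_frac_noise_def)

lemma frac_noise_L2:
  assumes "is_frac_noise M \<sigma> \<alpha> BH G t" shows "integrable M (\<lambda>\<omega>. (norm (G t \<omega>))\<^sup>2)"
proof -
  have "integrable M (\<lambda>\<omega>. (norm (G t \<omega> - G_sum \<sigma> \<alpha> BH 0 t \<omega>))\<^sup>2)"
    using assms by (simp add: is_frac_noise_def)
  then show ?thesis by (simp add: G_sum_def)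
qed

lemma borel_measurable_vec_nth [measurable (raw)]:
  fixes f :: "'a \<Rightarrow> real^'d"
  assumes [measurable]: "f \<in> borel_measurable M"
  shows "(\<lambda>\<omega>. f \<omega> $ c) \<in> borel_measurable M"
  by (rule borel_measurable_continuous_on[OF _ assms]) (intro continuous_intros)

lemma borel_measurable_vecI:
  fixes f :: "'a \<Rightarrow> real^'d"
  assumes "\<And>c. (\<lambda>\<omega>. f \<omega> $ c) \<in> borel_measurable M"
  shows "f \<in> borel_measurable M"
  using assms by (subst borel_measurable_euclidean_space) (auto simp: Basis_vec_def inner_axis)

lemma integrable_square_nth:
  fixes f :: "'a \<Rightarrow> real^'d"
  assumes [measurable]: "f \<in> borel_measurable M" and "integrable M (\<lambda>\<omega>. (norm (f \<omega>))\<^sup>2)"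
  shows "integrable M (\<lambda>\<omega>. (f \<omega> $ c)\<^sup>2)"
    and "(\<integral>\<omega>. (f \<omega> $ c)\<^sup>2 \<partial>M) \<le> (\<integral>\<omega>. (norm (f \<omega>))\<^sup>2 \<partial>M)"
proof -
  have le: "(f \<omega> $ c)\<^sup>2 \<le> (norm (f \<omega>))\<^sup>2" for \<omega>
    using component_le_norm_cart[of "f \<omega>" c] by (simp add: abs_le_square_iff[symmetric])
  show "integrable M (\<lambda>\<omega>. (f \<omega> $ c)\<^sup>2)"
    by (rule Bochner_Integration.integrable_bound[OF assms(2)]) (use le in auto)
  then show "(\<integral>\<omega>. (f \<omega> $ c)\<^sup>2 \<partial>M) \<le> (\<integral>\<omega>. (norm (f \<omega>))\<^sup>2 \<partial>M)"
    using assms le by (intro integral_mono) auto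
qed

lemma frac_noise_cov_nth:
  fixes BH G :: "real \<Rightarrow> 'a \<Rightarrow> real^'d"
  assumes H: "1/2 < H" "H < 1" and \<alpha>: "\<alpha> = 2 - 2 * H"
    and W: "\<And>c. fbm M H (\<lambda>t \<omega>. BH t \<omega> $ c)"
    and G: "is_frac_noise M \<sigma> \<alpha> BH G t" "is_frac_noise M \<sigma> \<alpha> BH G s" and st: "0 \<le> s" "0 \<le> t"
  shows "(\<integral>\<omega>. G t \<omega> $ c * G s \<omega> $ c \<partial>M)
    = noise_const \<sigma> \<alpha> H * (t powr \<alpha> + s powr \<alpha> - \<bar>t - s\<bar> powr \<alpha>)"
proof -
  have a: "0 < \<alpha>" "\<alpha> < 1" using H \<alpha> by auto
  let ?L = "lborel \<Otimes>\<^sub>M lborel :: (real \<times> real) measure"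
  let ?k = "\<lambda>p::real\<times>real. \<bar>fst p - snd p\<bar> powr (- \<alpha>)"
  have [measurable]: "(\<lambda>\<omega>. BH r \<omega> $ c) \<in> borel_measurable M" for r c
    using W[of c] by (auto simp: fbm_def)
  have [measurable]: "BH r \<in> borel_measurable M" for r
    by (rule borel_measurable_vecI) simp
  have [measurable]: "G_sum \<sigma> \<alpha> BH m r \<in> borel_measurable M" for m r
    unfolding G_sum_def by measurable
  have [measurable]: "G t \<in> borel_measurable M" "G s \<in> borel_measurable M"
    using G by (auto intro: frac_noise_measurable)
  have approx: "integrable M (\<lambda>\<omega>. (G r \<omega> $ c - G_sum \<sigma> \<alpha> BH m r \<omega> $ c)\<^sup>2)"
      "(\<lambda>m. \<integral>\<omega>. (G r \<omega> $ c - G_sum \<sigma> \<alpha> BH m r \<omega> $ c)\<^sup>2 \<partial>M) \<longlonglongrightarrow> 0"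
    if r: "is_frac_noise M \<sigma> \<alpha> BH G r" for r m
  proof -
    have [measurable]: "G r \<in> borel_measurable M" using r by (rule frac_noise_measurable)
    have i: "integrable M (\<lambda>\<omega>. (norm (G r \<omega> - G_sum \<sigma> \<alpha> BH m r \<omega>))\<^sup>2)" for m
      using r by (simp add: is_frac_noise_def)
    note n = integrable_square_nth[OF _ i, of _ c, simplified vector_minus_component, OF borel_measurable_diff]
    show "integrable M (\<lambda>\<omega>. (G r \<omega> $ c - G_sum \<sigma> \<alpha> BH m r \<omega> $ c)\<^sup>2)"
      by (rule n(1)) auto
    have lim: "(\<lambda>m. \<integral>\<omega>. (norm (G r \<omega> - G_sum \<sigma> \<alpha> BH m r \<omega>))\<^sup>2 \<partial>M) \<longlonglongrightarrow> 0"
      using r by (simp add: is_frac_noise_def)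
    show "(\<lambda>m. \<integral>\<omega>. (G r \<omega> $ c - G_sum \<sigma> \<alpha> BH m r \<omega> $ c)\<^sup>2 \<partial>M) \<longlonglongrightarrow> 0"
      by (rule tendsto_sandwich[OF _ _ tendsto_const lim]) (auto intro!: always_eventually n(2))
  qed
  have lim1: "(\<lambda>m. \<integral>\<omega>. G_sum \<sigma> \<alpha> BH m t \<omega> $ c * G_sum \<sigma> \<alpha> BH m s \<omega> $ c \<partial>M)
      \<longlonglongrightarrow> (\<integral>\<omega>. G t \<omega> $ c * G s \<omega> $ c \<partial>M)"
    by (rule L2_inner_tendsto)
       (use G in \<open>auto intro!: approx integrable_square_nth frac_noise_L2\<close>)
  have eq: "(\<integral>\<omega>. G_sum \<sigma> \<alpha> BH m t \<omega> $ c * G_sum \<sigma> \<alpha> BH m s \<omega> $ c \<partial>M)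
      = (\<sigma> / Gamma \<alpha>)\<^sup>2 * (H * (2 * H - 1) *
        (\<integral>p. riemann_step \<alpha> t m (fst p) * riemann_step \<alpha> s m (snd p) * ?k p \<partial>?L))" for m
  proof -
    have "(\<integral>\<omega>. G_sum \<sigma> \<alpha> BH m t \<omega> $ c * G_sum \<sigma> \<alpha> BH m s \<omega> $ c \<partial>M)
      = (\<integral>\<omega>. (\<sigma> / Gamma \<alpha>)\<^sup>2 *
         ((\<Sum>i<m. (t - real i * t / real m) powr (\<alpha> - 1) *
             (BH (real (Suc i) * t / real m) \<omega> $ c - BH (real i * t / real m) \<omega> $ c)) *
          (\<Sum>i<m. (s - real i * s / real m) powr (\<alpha> - 1) *
             (BH (real (Suc i) * s / real m) \<omega> $ c - BH (real i * s / real m) \<omega> $ c))) \<partial>M)"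
      by (simp add: G_sum_def power2_eq_square mult_ac)
    also have "\<dots> = (\<sigma> / Gamma \<alpha>)\<^sup>2 * (\<integral>\<omega>.
         ((\<Sum>i<m. (t - real i * t / real m) powr (\<alpha> - 1) *
             (BH (real (Suc i) * t / real m) \<omega> $ c - BH (real i * t / real m) \<omega> $ c)) *
          (\<Sum>i<m. (s - real i * s / real m) powr (\<alpha> - 1) *
             (BH (real (Suc i) * s / real m) \<omega> $ c - BH (real i * s / real m) \<omega> $ c))) \<partial>M)"
      by (rule integral_mult_right_zero)
    also note fbm_sum_cov[OF W H(1), of "\<lambda>i. real i * t / real m" "\<lambda>i. real i * s / real m"
        "\<lambda>i. (t - real i * t / real m) powr (\<alpha> - 1)" c m "\<lambda>i. (s - real i * s / real m) powr (\<alpha> - 1)" m]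
    finally show ?thesis using st unfolding riemann_step_def by (simp add: \<alpha>)
  qed
  have "(\<lambda>m. \<integral>p. riemann_step \<alpha> t m (fst p) * riemann_step \<alpha> s m (snd p) * ?k p \<partial>?L)
      \<longlonglongrightarrow> (\<integral>p. frac_kernel \<alpha> t (fst p) * frac_kernel \<alpha> s (snd p) * ?k p \<partial>?L)"
  proof (rule integral_dominated_convergence[where w="\<lambda>p. frac_kernel \<alpha> t (fst p) * frac_kernel \<alpha> s (snd p) * ?k p"])
    show "integrable ?L (\<lambda>p. frac_kernel \<alpha> t (fst p) * frac_kernel \<alpha> s (snd p) * ?k p)"
      using has_bochner_integral_frac_noise_cov[OF a st] by (simp add: has_bochner_integral_iff)
    show "AE p in ?L. (\<lambda>m. riemann_step \<alpha> t m (fst p) * riemann_step \<alpha> s m (snd p) * ?k p)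
        \<longlonglongrightarrow> frac_kernel \<alpha> t (fst p) * frac_kernel \<alpha> s (snd p) * ?k p"
      using st by (intro AE_I2 tendsto_intros riemann_step_tendsto)
    show "AE p in ?L. norm (riemann_step \<alpha> t m (fst p) * riemann_step \<alpha> s m (snd p) * ?k p)
        \<le> frac_kernel \<alpha> t (fst p) * frac_kernel \<alpha> s (snd p) * ?k p" for m
      using st a by (intro AE_I2)
        (auto simp: abs_mult riemann_step_bounds intro!: mult_right_mono mult_mono)
  qed auto
  moreover have "(\<integral>p. frac_kernel \<alpha> t (fst p) * frac_kernel \<alpha> s (snd p) * ?k p \<partial>?L)
      = Beta \<alpha> (1 - \<alpha>) / \<alpha> * (t powr \<alpha> + s powr \<alpha> - \<bar>t - s\<bar> powr \<alpha>)"
    using has_bochner_integral_frac_noise_cov[OF a st] by (simp add: has_bochner_integral_iff)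
  ultimately have "(\<lambda>m. \<integral>\<omega>. G_sum \<sigma> \<alpha> BH m t \<omega> $ c * G_sum \<sigma> \<alpha> BH m s \<omega> $ c \<partial>M)
      \<longlonglongrightarrow> (\<sigma> / Gamma \<alpha>)\<^sup>2 * (H * (2 * H - 1) *
           (Beta \<alpha> (1 - \<alpha>) / \<alpha> * (t powr \<alpha> + s powr \<alpha> - \<bar>t - s\<bar> powr \<alpha>)))"
    unfolding eq by (intro tendsto_mult tendsto_const) simp
  with lim1 show ?thesis
    using LIMSEQ_unique by (fastforce simp: noise_const_def mult_ac)
qed

lemma L2_inner_integrable:
  fixes f g :: "'a \<Rightarrow> 'b::{real_inner, second_countable_topology}"
  assumes [measurable]: "f \<in> borel_measurable M" "g \<in> borel_measurable M"
    and "integrable M (\<lambda>\<omega>. (norm (f \<omega>))\<^sup>2)" "integrable M (\<lambda>\<omega>. (norm (g \<omega>))\<^sup>2)"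
  shows "integrable M (\<lambda>\<omega>. f \<omega> \<bullet> g \<omega>)"
  by (rule Bochner_Integration.integrable_bound[OF Cauchy_Schwarz_integral(1)[OF _ _ assms(3,4)]])
     (auto simp: Cauchy_Schwarz_ineq2)

lemma frac_noise_cov:
  fixes BH G :: "real \<Rightarrow> 'a \<Rightarrow> real^'d"
  assumes H: "1/2 < H" "H < 1" and \<alpha>: "\<alpha> = 2 - 2 * H"
    and W: "\<And>c. fbm M H (\<lambda>t \<omega>. BH t \<omega> $ c)"
    and G: "is_frac_noise M \<sigma> \<alpha> BH G t" "is_frac_noise M \<sigma> \<alpha> BH G s" and st: "0 \<le> s" "0 \<le> t"
  shows "(\<integral>\<omega>. G t \<omega> \<bullet> G s \<omega> \<partial>M)
    = real CARD('d) * noise_const \<sigma> \<alpha> H * (t powr \<alpha> + s powr \<alpha> - \<bar>t - s\<bar> powr \<alpha>)"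
proof -
  have [measurable]: "G t \<in> borel_measurable M" "G s \<in> borel_measurable M"
    using G by (auto intro: frac_noise_measurable)
  have "(\<integral>\<omega>. G t \<omega> \<bullet> G s \<omega> \<partial>M) = (\<integral>\<omega>. (\<Sum>c\<in>UNIV. G t \<omega> $ c * G s \<omega> $ c) \<partial>M)"
    by (simp add: inner_vec_def)
  also have "\<dots> = (\<Sum>c\<in>UNIV. \<integral>\<omega>. G t \<omega> $ c * G s \<omega> $ c \<partial>M)"
    using G by (intro Bochner_Integration.integral_sum Cauchy_Schwarz_integral(1) integrable_square_nth)
      (auto intro: frac_noise_L2)
  finally show ?thesis by (simp add: frac_noise_cov_nth[OF assms])
qed

lemma frac_noise_increment_cov:
  fixes BH G :: "real \<Rightarrow> 'a \<Rightarrow> real^'d"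
  assumes H: "1/2 < H" "H < 1" and \<alpha>: "\<alpha> = 2 - 2 * H"
    and W: "\<And>c. fbm M H (\<lambda>t \<omega>. BH t \<omega> $ c)"
    and G: "\<And>t. t \<in> {0..T} \<Longrightarrow> is_frac_noise M \<sigma> \<alpha> BH G t"
    and T: "s \<in> {0..T}" "a \<in> {0..T}" "r \<in> {0..T}" "b \<in> {0..T}"
  shows "(\<integral>\<omega>. (G s \<omega> - G a \<omega>) \<bullet> (G r \<omega> - G b \<omega>) \<partial>M)
    = real CARD('d) * noise_const \<sigma> \<alpha> H *
      (\<bar>s - b\<bar> powr \<alpha> + \<bar>a - r\<bar> powr \<alpha> - \<bar>s - r\<bar> powr \<alpha> - \<bar>a - b\<bar> powr \<alpha>)"
proof -
  have int: "integrable M (\<lambda>\<omega>. G x \<omega> \<bullet> G y \<omega>)" if "x \<in> {0..T}" "y \<in> {0..T}" for x y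
    using that by (intro L2_inner_integrable frac_noise_L2[OF G] frac_noise_measurable[OF G])
  have "(\<integral>\<omega>. (G s \<omega> - G a \<omega>) \<bullet> (G r \<omega> - G b \<omega>) \<partial>M)
      = (\<integral>\<omega>. G s \<omega> \<bullet> G r \<omega> - G s \<omega> \<bullet> G b \<omega> - G a \<omega> \<bullet> G r \<omega> + G a \<omega> \<bullet> G b \<omega> \<partial>M)"
    by (simp add: inner_diff_left inner_diff_right algebra_simps)
  also have "\<dots> = (\<integral>\<omega>. G s \<omega> \<bullet> G r \<omega> \<partial>M) - (\<integral>\<omega>. G s \<omega> \<bullet> G b \<omega> \<partial>M)
      - (\<integral>\<omega>. G a \<omega> \<bullet> G r \<omega> \<partial>M) + (\<integral>\<omega>. G a \<omega> \<bullet> G b \<omega> \<partial>M)"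
    using T by (simp add: int)
  finally show ?thesis
    using T by (simp add: frac_noise_cov[OF H \<alpha> W G G] algebra_simps)
qed

subsection \<open>Mean squares of random integrals\<close>

definition msq :: "'a measure \<Rightarrow> ('a \<Rightarrow> 'b::real_normed_vector) \<Rightarrow> ennreal" where
  "msq M v = (\<integral>\<^sup>+\<omega>. ennreal ((norm (v \<omega>))\<^sup>2) \<partial>M)"

lemma msq_cong_AE: "AE \<omega> in M. u \<omega> = v \<omega> \<Longrightarrow> msq M u = msq M v"
  unfolding msq_def by (intro nn_integral_cong_AE) auto

lemma msq_cong: "(\<And>\<omega>. \<omega> \<in> space M \<Longrightarrow> u \<omega> = v \<omega>) \<Longrightarrow> msq M u = msq M v"
  unfolding msq_def by (intro nn_integral_cong) auto

lemma msq_scaleR: 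
  assumes [measurable]: "v \<in> borel_measurable M"
  shows "msq M (\<lambda>\<omega>. c *\<^sub>R v \<omega>) = ennreal (c\<^sup>2) * msq M v"
  unfolding msq_def
  by (subst nn_integral_cmult[symmetric]) (auto simp: power_mult_distrib ennreal_mult)

lemma msq_minus: "msq M (\<lambda>\<omega>. - v \<omega>) = msq M v"
  by (simp add: msq_def)

lemma msq_add_le:
  assumes [measurable]: "u \<in> borel_measurable M" "v \<in> borel_measurable M"
  shows "msq M (\<lambda>\<omega>. u \<omega> + v \<omega>) \<le> 2 * msq M u + 2 * msq M v"
proof -
  have le: "(norm (a + b))\<^sup>2 \<le> 2 * (norm a)\<^sup>2 + 2 * (norm b)\<^sup>2" for a b :: 'b
  proof -
    have "(norm (a + b))\<^sup>2 \<le> (norm a + norm b)\<^sup>2" by (intro power_mono norm_triangle_ineq) auto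
    also have "\<dots> \<le> 2 * (norm a)\<^sup>2 + 2 * (norm b)\<^sup>2"
      using sum_squares_bound[of "norm a" "norm b"] by (simp add: power2_sum)
    finally show ?thesis .
  qed
  have "msq M (\<lambda>\<omega>. u \<omega> + v \<omega>) \<le> (\<integral>\<^sup>+\<omega>. 2 * ennreal ((norm (u \<omega>))\<^sup>2) + 2 * ennreal ((norm (v \<omega>))\<^sup>2) \<partial>M)"
    unfolding msq_def
    using le by (intro nn_integral_mono)
      (auto simp: ennreal_plus[symmetric] ennreal_mult'[symmetric] ennreal_numeral[symmetric] ennreal_leI
         simp del: ennreal_plus ennreal_numeral)
  also have "\<dots> = 2 * msq M u + 2 * msq M v"
    by (simp add: msq_def nn_integral_add nn_integral_cmult)
  finally show ?thesis .
qed

lemma msq_diff_le: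
  fixes u v :: "'a \<Rightarrow> 'b::{real_normed_vector, second_countable_topology}"
  assumes "u \<in> borel_measurable M" "v \<in> borel_measurable M"
  shows "msq M (\<lambda>\<omega>. u \<omega> - v \<omega>) \<le> 2 * msq M u + 2 * msq M v"
  using msq_add_le[of u M "\<lambda>\<omega>. - v \<omega>"] assms by (simp add: msq_minus)

lemma msq_mono:
  assumes "\<And>\<omega>. \<omega> \<in> space M \<Longrightarrow> norm (u \<omega>) \<le> norm (v \<omega>)"
  shows "msq M u \<le> msq M v"
  unfolding msq_def using assms by (intro nn_integral_mono ennreal_leI power_mono) auto

lemma msq_bounded_linear_le:
  assumes "\<And>x. norm (L x) \<le> b * norm x" and [measurable]: "v \<in> borel_measurable M"
  shows "msq M (\<lambda>\<omega>. L (v \<omega>)) \<le> ennreal (b\<^sup>2) * msq M v"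
proof -
  have "msq M (\<lambda>\<omega>. L (v \<omega>)) \<le> (\<integral>\<^sup>+\<omega>. ennreal (b\<^sup>2) * ennreal ((norm (v \<omega>))\<^sup>2) \<partial>M)"
    unfolding msq_def
    using power_mono[OF assms(1) norm_ge_zero, of _ 2]
    by (intro nn_integral_mono) (auto simp: ennreal_mult[symmetric] power_mult_distrib ennreal_leI)
  also have "\<dots> = ennreal (b\<^sup>2) * msq M v"
    by (simp add: msq_def nn_integral_cmult)
  finally show ?thesis .
qed

lemma msq_eq_integral:
  assumes "integrable M (\<lambda>\<omega>. (norm (v \<omega>))\<^sup>2)"
  shows "msq M v = ennreal (\<integral>\<omega>. (norm (v \<omega>))\<^sup>2 \<partial>M)"
  unfolding msq_def using assms by (intro nn_integral_eq_integral) auto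

lemma msq_finite_imp_integrable:
  fixes v :: "'a \<Rightarrow> 'b::{real_normed_vector, second_countable_topology}"
  assumes [measurable]: "v \<in> borel_measurable M" and "msq M v < \<infinity>"
  shows "integrable M (\<lambda>\<omega>. (norm (v \<omega>))\<^sup>2)"
  using assms(2) by (intro integrableI_bounded) (auto simp: msq_def)

lemma norm_integral_square_le:
  fixes f :: "real \<Rightarrow> 'b::{banach, second_countable_topology}"
  assumes [measurable]: "w \<in> borel_measurable borel" "f \<in> borel_measurable borel"
  shows "ennreal ((norm (\<integral>s. w s *\<^sub>R f s \<partial>lborel))\<^sup>2)
    \<le> (\<integral>\<^sup>+s. ennreal \<bar>w s\<bar> \<partial>lborel) * (\<integral>\<^sup>+s. ennreal (\<bar>w s\<bar> * (norm (f s))\<^sup>2) \<partial>lborel)"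
proof -
  have "ennreal (norm (\<integral>s. w s *\<^sub>R f s \<partial>lborel)) \<le> (\<integral>\<^sup>+s. ennreal (norm (w s *\<^sub>R f s)) \<partial>lborel)"
  proof (cases "integrable lborel (\<lambda>s. w s *\<^sub>R f s)")
    case True then show ?thesis by (rule integral_norm_bound_ennreal)
  next
    case False then show ?thesis by (simp add: not_integrable_integral_eq)
  qed
  then have "(ennreal (norm (\<integral>s. w s *\<^sub>R f s \<partial>lborel)))\<^sup>2 \<le> (\<integral>\<^sup>+s. ennreal (norm (w s *\<^sub>R f s)) \<partial>lborel)\<^sup>2"
    by (intro power_mono) auto
  also have "\<dots> = (\<integral>\<^sup>+s. ennreal (sqrt \<bar>w s\<bar>) * ennreal (sqrt \<bar>w s\<bar> * norm (f s)) \<partial>lborel)\<^sup>2"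
    by (intro arg_cong[where f="\<lambda>z. z\<^sup>2"] nn_integral_cong)
       (auto simp: ennreal_mult[symmetric] mult.assoc[symmetric])
  also have "\<dots> \<le> (\<integral>\<^sup>+s. (ennreal (sqrt \<bar>w s\<bar>))\<^sup>2 \<partial>lborel) * (\<integral>\<^sup>+s. (ennreal (sqrt \<bar>w s\<bar> * norm (f s)))\<^sup>2 \<partial>lborel)"
    by (rule Cauchy_Schwarz_nn_integral) auto
  finally show ?thesis by (simp add: ennreal_power power_mult_distrib)
qed

lemma (in sigma_finite_measure) borel_measurable_msq:
  assumes [measurable]: "(\<lambda>(s, \<omega>). f s \<omega>) \<in> borel_measurable (lborel \<Otimes>\<^sub>M M)"
  shows "(\<lambda>s. msq M (f s)) \<in> borel_measurable lborel"
  unfolding msq_def by measurable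

lemma (in sigma_finite_measure) msq_integral_le:
  fixes f :: "real \<Rightarrow> 'a \<Rightarrow> 'b::{banach, second_countable_topology}"
  assumes [measurable]: "w \<in> borel_measurable borel"
    and f[measurable]: "(\<lambda>(s, \<omega>). f s \<omega>) \<in> borel_measurable (lborel \<Otimes>\<^sub>M M)"
  shows "msq M (\<lambda>\<omega>. \<integral>s. w s *\<^sub>R f s \<omega> \<partial>lborel)
    \<le> (\<integral>\<^sup>+s. ennreal \<bar>w s\<bar> \<partial>lborel) * (\<integral>\<^sup>+s. ennreal \<bar>w s\<bar> * msq M (f s) \<partial>lborel)"
proof -
  interpret P: pair_sigma_finite lborel M ..
  have "msq M (\<lambda>\<omega>. \<integral>s. w s *\<^sub>R f s \<omega> \<partial>lborel)
      \<le> (\<integral>\<^sup>+\<omega>. (\<integral>\<^sup>+s. ennreal \<bar>w s\<bar> \<partial>lborel) * (\<integral>\<^sup>+s. ennreal (\<bar>w s\<bar> * (norm (f s \<omega>))\<^sup>2) \<partial>lborel) \<partial>M)"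
    unfolding msq_def by (intro nn_integral_mono norm_integral_square_le) auto
  also have "\<dots> = (\<integral>\<^sup>+s. ennreal \<bar>w s\<bar> \<partial>lborel) * (\<integral>\<^sup>+\<omega>. (\<integral>\<^sup>+s. ennreal (\<bar>w s\<bar> * (norm (f s \<omega>))\<^sup>2) \<partial>lborel) \<partial>M)"
    by (rule nn_integral_cmult) measurable
  also have "(\<integral>\<^sup>+\<omega>. (\<integral>\<^sup>+s. ennreal (\<bar>w s\<bar> * (norm (f s \<omega>))\<^sup>2) \<partial>lborel) \<partial>M)
      = (\<integral>\<^sup>+s. (\<integral>\<^sup>+\<omega>. ennreal (\<bar>w s\<bar> * (norm (f s \<omega>))\<^sup>2) \<partial>M) \<partial>lborel)"
    by (rule P.Fubini'[where f="\<lambda>s \<omega>. ennreal (\<bar>w s\<bar> * (norm (f s \<omega>))\<^sup>2)"]) measurable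
  also have "\<dots> = (\<integral>\<^sup>+s. ennreal \<bar>w s\<bar> * msq M (f s) \<partial>lborel)"
    unfolding msq_def
    by (intro nn_integral_cong, subst nn_integral_cmult[symmetric]) (auto simp: ennreal_mult)
  finally show ?thesis .
qed

lemma (in sigma_finite_measure) msq_integral_le_const:
  fixes f :: "real \<Rightarrow> 'a \<Rightarrow> 'b::{banach, second_countable_topology}"
  assumes [measurable]: "w \<in> borel_measurable borel"
    and f[measurable]: "(\<lambda>(s, \<omega>). f s \<omega>) \<in> borel_measurable (lborel \<Otimes>\<^sub>M M)"
    and D: "\<And>s. w s \<noteq> 0 \<Longrightarrow> msq M (f s) \<le> D"
    and I: "(\<integral>\<^sup>+s. ennreal \<bar>w s\<bar> \<partial>lborel) \<le> ennreal I" "0 \<le> I"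
  shows "msq M (\<lambda>\<omega>. \<integral>s. w s *\<^sub>R f s \<omega> \<partial>lborel) \<le> ennreal (I\<^sup>2) * D"
proof -
  have "msq M (\<lambda>\<omega>. \<integral>s. w s *\<^sub>R f s \<omega> \<partial>lborel)
    \<le> (\<integral>\<^sup>+s. ennreal \<bar>w s\<bar> \<partial>lborel) * (\<integral>\<^sup>+s. ennreal \<bar>w s\<bar> * msq M (f s) \<partial>lborel)"
    by (rule msq_integral_le) auto
  also have "(\<integral>\<^sup>+s. ennreal \<bar>w s\<bar> * msq M (f s) \<partial>lborel) \<le> (\<integral>\<^sup>+s. ennreal \<bar>w s\<bar> * D \<partial>lborel)"
  proof (intro nn_integral_mono)
    fix s show "ennreal \<bar>w s\<bar> * msq M (f s) \<le> ennreal \<bar>w s\<bar> * D"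
      by (cases "w s = 0") (auto intro!: mult_left_mono D)
  qed
  also have "\<dots> = (\<integral>\<^sup>+s. ennreal \<bar>w s\<bar> \<partial>lborel) * D"
    by (rule nn_integral_multc) simp
  finally have "msq M (\<lambda>\<omega>. \<integral>s. w s *\<^sub>R f s \<omega> \<partial>lborel)
      \<le> (\<integral>\<^sup>+s. ennreal \<bar>w s\<bar> \<partial>lborel) * ((\<integral>\<^sup>+s. ennreal \<bar>w s\<bar> \<partial>lborel) * D)"
    by (simp add: mult_left_mono)
  also have "\<dots> \<le> ennreal I * (ennreal I * D)"
    using I by (intro mult_mono) auto
  also have "\<dots> = ennreal (I\<^sup>2) * D"
    using I by (simp add: mult.assoc[symmetric] ennreal_mult[symmetric] power2_eq_square)
  finally show ?thesis .
qed

lemma (in sigma_finite_measure) msq_integral_le_covariance: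
  fixes f :: "real \<Rightarrow> 'a \<Rightarrow> 'b::euclidean_space" and \<rho> :: "real \<Rightarrow> real \<Rightarrow> real"
  assumes w[measurable]: "w \<in> borel_measurable borel" and w0: "\<And>s. 0 \<le> w s"
    and wI: "integrable lborel w"
    and f[measurable]: "(\<lambda>(s, \<omega>). f s \<omega>) \<in> borel_measurable (lborel \<Otimes>\<^sub>M M)"
    and D: "\<And>s. w s \<noteq> 0 \<Longrightarrow> msq M (f s) \<le> ennreal D" "0 \<le> D"
    and [measurable]: "(\<lambda>(s, r). \<rho> s r) \<in> borel_measurable (borel \<Otimes>\<^sub>M borel)"
    and \<rho>: "\<And>s r. w s \<noteq> 0 \<Longrightarrow> w r \<noteq> 0 \<Longrightarrow> (\<integral>\<omega>. f s \<omega> \<bullet> f r \<omega> \<partial>M) \<le> \<rho> s r"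
  shows "msq M (\<lambda>\<omega>. \<integral>s. w s *\<^sub>R f s \<omega> \<partial>lborel)
    \<le> (\<integral>\<^sup>+s. (\<integral>\<^sup>+r. ennreal (w s * w r * \<rho> s r) \<partial>lborel) \<partial>lborel)"
proof -
  let ?L = "lborel \<Otimes>\<^sub>M lborel :: (real \<times> real) measure"
  interpret P: pair_sigma_finite ?L M ..
  interpret P1: pair_sigma_finite lborel M ..
  define h where "h p \<omega> = w (fst p) * w (snd p) * (f (fst p) \<omega> \<bullet> f (snd p) \<omega>)" for p \<omega>
  define I where "I \<omega> = (\<integral>s. w s *\<^sub>R f s \<omega> \<partial>lborel)" for \<omega>
  have fm[measurable (raw)]: "(\<lambda>x. f (a x) (b x)) \<in> borel_measurable N"
    if [measurable]: "a \<in> borel_measurable N" "b \<in> measurable N M" for a b and N :: "'c measure"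
    using measurable_compose[of "\<lambda>x. (a x, b x)" N "lborel \<Otimes>\<^sub>M M", OF _ f] by simp
  have hm[measurable]: "(\<lambda>(p, \<omega>). h p \<omega>) \<in> borel_measurable (?L \<Otimes>\<^sub>M M)"
    unfolding h_def split_def by (intro borel_measurable_times borel_measurable_inner fm measurable_compose[OF _ w]) auto
  have fin: "(\<integral>\<^sup>+\<omega>. ennreal (norm (h p \<omega>)) \<partial>M) \<le> ennreal D * (ennreal (w (fst p)) * ennreal (w (snd p)))" for p
  proof (cases "w (fst p) = 0 \<or> w (snd p) = 0")
    case False
    have "(\<integral>\<^sup>+\<omega>. ennreal (norm (h p \<omega>)) \<partial>M)
       \<le> (\<integral>\<^sup>+\<omega>. ennreal (w (fst p) * w (snd p) / 2) * (ennreal ((norm (f (fst p) \<omega>))\<^sup>2) + ennreal ((norm (f (snd p) \<omega>))\<^sup>2)) \<partial>M)"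
    proof (intro nn_integral_mono)
      fix \<omega>
      have "\<bar>f (fst p) \<omega> \<bullet> f (snd p) \<omega>\<bar> \<le> norm (f (fst p) \<omega>) * norm (f (snd p) \<omega>)"
        by (rule Cauchy_Schwarz_ineq2)
      also have "\<dots> \<le> ((norm (f (fst p) \<omega>))\<^sup>2 + (norm (f (snd p) \<omega>))\<^sup>2) / 2"
        using sum_squares_bound[of "norm (f (fst p) \<omega>)" "norm (f (snd p) \<omega>)"] by simp
      finally have "(w (fst p) * w (snd p)) * \<bar>f (fst p) \<omega> \<bullet> f (snd p) \<omega>\<bar>
         \<le> (w (fst p) * w (snd p)) * (((norm (f (fst p) \<omega>))\<^sup>2 + (norm (f (snd p) \<omega>))\<^sup>2) / 2)"
        using w0 by (intro mult_left_mono) auto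
      then show "ennreal (norm (h p \<omega>)) \<le> ennreal (w (fst p) * w (snd p) / 2) * (ennreal ((norm (f (fst p) \<omega>))\<^sup>2) + ennreal ((norm (f (snd p) \<omega>))\<^sup>2))"
        using w0 by (auto simp: h_def abs_mult ennreal_plus[symmetric] ennreal_mult[symmetric] simp del: ennreal_plus intro!: ennreal_leI)
    qed
    also have "\<dots> = ennreal (w (fst p) * w (snd p) / 2) * (msq M (f (fst p)) + msq M (f (snd p)))"
      unfolding msq_def by (simp add: nn_integral_cmult nn_integral_add)
    also have "\<dots> \<le> ennreal (w (fst p) * w (snd p) / 2) * (ennreal D + ennreal D)"
      using False by (intro mult_left_mono add_mono D) auto
    also have "\<dots> = ennreal D * (ennreal (w (fst p)) * ennreal (w (snd p)))"
      using w0 D(2) by (simp add: ennreal_plus[symmetric] ennreal_mult[symmetric] mult_ac del: ennreal_plus)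
    finally show ?thesis .
  qed (auto simp: h_def)
  have "(\<integral>\<^sup>+z. ennreal (norm (case z of (p, \<omega>) \<Rightarrow> h p \<omega>)) \<partial>(?L \<Otimes>\<^sub>M M))
      = (\<integral>\<^sup>+p. (\<integral>\<^sup>+\<omega>. ennreal (norm (h p \<omega>)) \<partial>M) \<partial>?L)"
    by (subst nn_integral_fst[symmetric]) auto
  also have "\<dots> \<le> (\<integral>\<^sup>+p. ennreal D * (ennreal (w (fst p)) * ennreal (w (snd p))) \<partial>?L)"
    by (intro nn_integral_mono fin)
  also have "\<dots> = ennreal D * (\<integral>\<^sup>+s. \<integral>\<^sup>+r. ennreal (w s) * ennreal (w r) \<partial>lborel \<partial>lborel)"
    by (subst nn_integral_cmult) (auto simp: lborel.nn_integral_fst[symmetric])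
  also have "\<dots> = ennreal D * ((\<integral>\<^sup>+s. ennreal (w s) \<partial>lborel) * (\<integral>\<^sup>+r. ennreal (w r) \<partial>lborel))"
    by (simp add: nn_integral_cmult nn_integral_multc)
  also have "\<dots> < \<infinity>"
    using wI w0 by (simp add: nn_integral_eq_integral ennreal_mult[symmetric] ennreal_mult_less_top)
  finally have hI: "integrable (?L \<Otimes>\<^sub>M M) (\<lambda>(p, \<omega>). h p \<omega>)"
    by (intro integrableI_bounded) auto
  have ae1: "AE \<omega> in M. integrable ?L (\<lambda>p. h p \<omega>)"
    using P.AE_integrable_snd[OF hI] by simp
  have "(\<integral>\<^sup>+\<omega>. (\<integral>\<^sup>+s. ennreal (w s * (norm (f s \<omega>))\<^sup>2) \<partial>lborel) \<partial>M)
      = (\<integral>\<^sup>+s. (\<integral>\<^sup>+\<omega>. ennreal (w s * (norm (f s \<omega>))\<^sup>2) \<partial>M) \<partial>lborel)"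
    by (rule P1.Fubini'[where f="\<lambda>s \<omega>. ennreal (w s * (norm (f s \<omega>))\<^sup>2)"]) measurable
  also have "\<dots> \<le> (\<integral>\<^sup>+s. ennreal (w s) * ennreal D \<partial>lborel)"
  proof (intro nn_integral_mono)
    fix s
    have "(\<integral>\<^sup>+\<omega>. ennreal (w s * (norm (f s \<omega>))\<^sup>2) \<partial>M) = ennreal (w s) * msq M (f s)"
      unfolding msq_def using w0 by (subst nn_integral_cmult[symmetric]) (auto simp: ennreal_mult)
    also have "\<dots> \<le> ennreal (w s) * ennreal D"
      using D(1)[of s] by (cases "w s = 0") (auto intro!: mult_left_mono)
    finally show "(\<integral>\<^sup>+\<omega>. ennreal (w s * (norm (f s \<omega>))\<^sup>2) \<partial>M) \<le> ennreal (w s) * ennreal D" .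
  qed
  also have "\<dots> < \<infinity>"
    using wI w0 by (simp add: nn_integral_multc nn_integral_eq_integral ennreal_mult_less_top)
  finally have "AE \<omega> in M. (\<integral>\<^sup>+s. ennreal (w s * (norm (f s \<omega>))\<^sup>2) \<partial>lborel) \<noteq> \<infinity>"
    by (intro nn_integral_PInf_AE) auto
  then have ae2: "AE \<omega> in M. integrable lborel (\<lambda>s. w s *\<^sub>R f s \<omega>)"
  proof (rule AE_mp, intro AE_I2 impI)
    fix \<omega> assume [measurable]: "\<omega> \<in> space M" and n: "(\<integral>\<^sup>+s. ennreal (w s * (norm (f s \<omega>))\<^sup>2) \<partial>lborel) \<noteq> \<infinity>"
    have i2: "integrable lborel (\<lambda>s. w s * (norm (f s \<omega>))\<^sup>2)"
      using n w0 by (intro integrableI_bounded) (auto simp: less_top[symmetric])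
    show "integrable lborel (\<lambda>s. w s *\<^sub>R f s \<omega>)"
    proof (rule Bochner_Integration.integrable_bound[OF Bochner_Integration.integrable_add[OF wI i2]])
      show "AE s in lborel. norm (w s *\<^sub>R f s \<omega>) \<le> norm (w s + w s * (norm (f s \<omega>))\<^sup>2)"
      proof (intro AE_I2)
        fix s
        have "norm (f s \<omega>) \<le> 1 + (norm (f s \<omega>))\<^sup>2"
          using sum_squares_bound[of 1 "norm (f s \<omega>)"] norm_ge_zero[of "f s \<omega>"]
          unfolding one_power2 mult_1_right by linarith
        then have "w s * norm (f s \<omega>) \<le> w s * (1 + (norm (f s \<omega>))\<^sup>2)"
          using w0 by (intro mult_left_mono) auto
        then show "norm (w s *\<^sub>R f s \<omega>) \<le> norm (w s + w s * (norm (f s \<omega>))\<^sup>2)"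
          using w0[of s] by (simp add: distrib_left)
      qed
    qed auto
  qed
  have key: "AE \<omega> in M. (\<integral>p. h p \<omega> \<partial>?L) = (norm (I \<omega>))\<^sup>2"
    using ae1 ae2
  proof eventually_elim
    fix \<omega> assume 1: "integrable ?L (\<lambda>p. h p \<omega>)" and 2: "integrable lborel (\<lambda>s. w s *\<^sub>R f s \<omega>)"
    have "(\<integral>p. h p \<omega> \<partial>?L) = (\<integral>s. (\<integral>r. h (s, r) \<omega> \<partial>lborel) \<partial>lborel)"
      using lborel_pair.integral_fst'[OF 1] by simp
    also have "\<dots> = (\<integral>s. (\<integral>r. (w s *\<^sub>R f s \<omega>) \<bullet> (w r *\<^sub>R f r \<omega>) \<partial>lborel) \<partial>lborel)"
      by (simp add: h_def mult_ac)
    also have "\<dots> = (\<integral>s. (w s *\<^sub>R f s \<omega>) \<bullet> I \<omega> \<partial>lborel)"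
      unfolding I_def using 2 by (intro Bochner_Integration.integral_cong refl integral_inner_right) auto
    also have "\<dots> = I \<omega> \<bullet> I \<omega>"
      unfolding I_def using 2 by (intro integral_inner_left) auto
    finally show "(\<integral>p. h p \<omega> \<partial>?L) = (norm (I \<omega>))\<^sup>2" by (simp add: power2_norm_eq_inner)
  qed
  have "msq M I = (\<integral>\<^sup>+\<omega>. ennreal (\<integral>p. h p \<omega> \<partial>?L) \<partial>M)"
    unfolding msq_def using key by (intro nn_integral_cong_AE) auto
  also have "\<dots> = ennreal (\<integral>\<omega>. (\<integral>p. h p \<omega> \<partial>?L) \<partial>M)"
  proof (rule nn_integral_eq_integral)
    show "integrable M (\<lambda>\<omega>. \<integral>p. h p \<omega> \<partial>?L)" using P.integrable_snd[OF hI] by simp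
    show "AE \<omega> in M. 0 \<le> (\<integral>p. h p \<omega> \<partial>?L)" using key by eventually_elim simp
  qed
  also have "(\<integral>\<omega>. (\<integral>p. h p \<omega> \<partial>?L) \<partial>M) = (\<integral>p. (\<integral>\<omega>. h p \<omega> \<partial>M) \<partial>?L)"
    using P.Fubini_integral[OF hI] by simp
  also have "ennreal \<dots> \<le> (\<integral>\<^sup>+p. ennreal (\<integral>\<omega>. h p \<omega> \<partial>M) \<partial>?L)"
  proof -
    have i: "integrable ?L (\<lambda>p. \<integral>\<omega>. h p \<omega> \<partial>M)" using P.integrable_fst[OF hI] by simp
    have "(\<integral>p. (\<integral>\<omega>. h p \<omega> \<partial>M) \<partial>?L) \<le> (\<integral>p. max 0 (\<integral>\<omega>. h p \<omega> \<partial>M) \<partial>?L)"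
      using i by (intro integral_mono integrable_max) auto
    then have "ennreal (\<integral>p. (\<integral>\<omega>. h p \<omega> \<partial>M) \<partial>?L) \<le> ennreal (\<integral>p. max 0 (\<integral>\<omega>. h p \<omega> \<partial>M) \<partial>?L)"
      by (rule ennreal_leI)
    also have "\<dots> = (\<integral>\<^sup>+p. ennreal (max 0 (\<integral>\<omega>. h p \<omega> \<partial>M)) \<partial>?L)"
      using i by (intro nn_integral_eq_integral[symmetric] integrable_max) auto
    finally show ?thesis by (simp add: ennreal_max_0)
  qed
  also have "\<dots> \<le> (\<integral>\<^sup>+p. ennreal (w (fst p) * w (snd p) * \<rho> (fst p) (snd p)) \<partial>?L)"
  proof (intro nn_integral_mono ennreal_leI)
    fix p
    have "(\<integral>\<omega>. h p \<omega> \<partial>M) = w (fst p) * w (snd p) * (\<integral>\<omega>. f (fst p) \<omega> \<bullet> f (snd p) \<omega> \<partial>M)"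
      by (simp add: h_def)
    also have "\<dots> \<le> w (fst p) * w (snd p) * \<rho> (fst p) (snd p)"
    proof (cases "w (fst p) = 0 \<or> w (snd p) = 0")
      case False
      then show ?thesis using \<rho>[of "fst p" "snd p"] w0 by (intro mult_left_mono) auto
    qed auto
    finally show "(\<integral>\<omega>. h p \<omega> \<partial>M) \<le> w (fst p) * w (snd p) * \<rho> (fst p) (snd p)" .
  qed
  also have "\<dots> = (\<integral>\<^sup>+s. (\<integral>\<^sup>+r. ennreal (w s * w r * \<rho> s r) \<partial>lborel) \<partial>lborel)"
    by (subst lborel.nn_integral_fst[symmetric]) auto
  finally show ?thesis unfolding I_def .
qed

lemma borel_measurable_continuous_process:
  fixes y :: "real \<Rightarrow> 'a \<Rightarrow> 'b::metric_space"
  assumes [measurable]: "\<And>t. y t \<in> borel_measurable M"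
    and cont: "\<And>\<omega>. \<omega> \<in> space M \<Longrightarrow> continuous_on UNIV (\<lambda>t. y t \<omega>)"
  shows "(\<lambda>(t, \<omega>). y t \<omega>) \<in> borel_measurable (lborel \<Otimes>\<^sub>M M)"
proof (rule borel_measurable_LIMSEQ_metric)
  let ?g = "\<lambda>n t. of_int \<lfloor>real (Suc n) * t\<rfloor> / real (Suc n)"
  show "(\<lambda>(t, \<omega>). y (?g n t) \<omega>) \<in> borel_measurable (lborel \<Otimes>\<^sub>M M)" for n
    unfolding split_def
    by (rule measurable_compose_countable[where f="\<lambda>i z. y (of_int i / real (Suc n)) (snd z)"
          and g="\<lambda>z. \<lfloor>real (Suc n) * fst z\<rfloor>"]) measurable
  fix z :: "real \<times> 'a" assume z: "z \<in> space (lborel \<Otimes>\<^sub>M M)"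
  obtain t :: real and \<omega> :: 'a where z': "z = (t, \<omega>)" "\<omega> \<in> space M" using z by (auto simp: space_pair_measure)
  have "(\<lambda>n. ?g n t) \<longlonglongrightarrow> t"
  proof (rule tendsto_sandwich)
    show "(\<lambda>n. t - 1 / real (Suc n)) \<longlonglongrightarrow> t"
      using tendsto_diff[OF tendsto_const LIMSEQ_inverse_real_of_nat, of t] by (simp add: inverse_eq_divide)
    show "(\<lambda>n. t) \<longlonglongrightarrow> t" by simp
    have lo: "t - 1 / real (Suc n) \<le> ?g n t" and hi: "?g n t \<le> t" for n
    proof -
      define i :: real where "i = of_int \<lfloor>real (Suc n) * t\<rfloor>"
      define N where "N = real (Suc n)"
      have N: "N > 0" by (simp add: N_def)
      have "i \<le> N * t" "N * t < i + 1" unfolding i_def N_def by linarith+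
      then have "t \<le> (i + 1) / N" "i / N \<le> t"
        using N by (simp_all add: pos_le_divide_eq pos_divide_le_eq mult.commute)
      then have "t - 1 / N \<le> i / N" "i / N \<le> t" by (simp_all add: add_divide_distrib)
      then show "t - 1 / real (Suc n) \<le> ?g n t" "?g n t \<le> t" by (simp_all only: i_def N_def)
    qed
    show "eventually (\<lambda>n. t - 1 / real (Suc n) \<le> ?g n t) sequentially" using lo by simp
    show "eventually (\<lambda>n. ?g n t \<le> t) sequentially" using hi by simp
  qed
  then have "(\<lambda>n. y (?g n t) \<omega>) \<longlonglongrightarrow> y t \<omega>"
    using cont[OF z'(2)] by (auto simp: continuous_on_eq_continuous_at intro: isCont_tendsto_compose)
  then show "(\<lambda>n. case z of (t, \<omega>) \<Rightarrow> y (?g n t) \<omega>) \<longlonglongrightarrow> (case z of (t, \<omega>) \<Rightarrow> y t \<omega>)"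
    by (simp add: z')
qed

text \<open>The weight \<open>exp (- \<Lambda> t)\<close> turns the Volterra operator into a contraction.\<close>
lemma frac_gronwall:
  fixes m :: "real \<Rightarrow> ennreal"
  assumes m: "\<And>t. t \<in> {0..T} \<Longrightarrow>
        m t \<le> ennreal A + ennreal K * (\<integral>\<^sup>+s. ennreal (frac_kernel \<alpha> t s) * m s \<partial>lborel)"
    and R: "\<And>t. t \<in> {0..T} \<Longrightarrow> m t \<le> ennreal R"
    and A: "0 \<le> A" "0 \<le> K" and \<Lambda>: "0 \<le> \<Lambda>"
      "\<And>t. t \<in> {0..T} \<Longrightarrow> (\<integral>\<^sup>+s. ennreal (frac_kernel \<alpha> t s * exp (\<Lambda> * s)) \<partial>lborel) \<le> ennreal (\<delta> * exp (\<Lambda> * t))"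
    and \<delta>: "0 \<le> \<delta>" "K * \<delta> \<le> 1/2" and t: "t \<in> {0..T}"
  shows "m t \<le> ennreal (2 * A * exp (\<Lambda> * t))"
proof -
  define S where "S = (SUP t\<in>{0..T}. m t * ennreal (exp (- (\<Lambda> * t))))"
  have "S \<le> ennreal R"
    unfolding S_def
  proof (rule SUP_least)
    fix t assume t: "t \<in> {0..T}"
    have "m t * ennreal (exp (- (\<Lambda> * t))) \<le> m t * ennreal 1"
      using t \<Lambda> by (intro mult_left_mono ennreal_leI) auto
    then show "m t * ennreal (exp (- (\<Lambda> * t))) \<le> ennreal R" using R[OF t] by simp
  qed
  then have "S < \<top>" using ennreal_less_top le_less_trans by blast
  then obtain S' where S': "S = ennreal S'" "0 \<le> S'" by (cases S) auto
  have canc: "ennreal (exp (- (\<Lambda> * t))) * ennreal (exp (\<Lambda> * t)) = 1" for t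
    by (simp add: ennreal_mult[symmetric] exp_add[symmetric])
  have mS: "m t \<le> S * ennreal (exp (\<Lambda> * t))" if "t \<in> {0..T}" for t
  proof -
    have "m t = m t * ennreal (exp (- (\<Lambda> * t))) * ennreal (exp (\<Lambda> * t))"
      by (simp add: mult.assoc canc)
    also have "\<dots> \<le> S * ennreal (exp (\<Lambda> * t))"
      unfolding S_def using that by (intro mult_right_mono SUP_upper) auto
    finally show ?thesis .
  qed
  have step: "m t \<le> ennreal ((A + S' / 2) * exp (\<Lambda> * t))" if t: "t \<in> {0..T}" for t
  proof -
    have "(\<integral>\<^sup>+s. ennreal (frac_kernel \<alpha> t s) * m s \<partial>lborel)
        \<le> (\<integral>\<^sup>+s. ennreal S' * ennreal (frac_kernel \<alpha> t s * exp (\<Lambda> * s)) \<partial>lborel)"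
    proof (intro nn_integral_mono)
      fix s :: real
      show "ennreal (frac_kernel \<alpha> t s) * m s \<le> ennreal S' * ennreal (frac_kernel \<alpha> t s * exp (\<Lambda> * s))"
      proof (cases "s \<in> {0..t}")
        case True
        then have "m s \<le> ennreal S' * ennreal (exp (\<Lambda> * s))" using mS[of s] t by (simp add: S')
        then have "ennreal (frac_kernel \<alpha> t s) * m s \<le> ennreal (frac_kernel \<alpha> t s) * (ennreal S' * ennreal (exp (\<Lambda> * s)))"
          by (rule mult_left_mono) simp
        then show ?thesis using S'(2) by (simp add: ennreal_mult[symmetric] mult_ac)
      next
        case False then show ?thesis by (simp add: frac_kernel_def)
      qed
    qed
    also have "\<dots> = ennreal S' * (\<integral>\<^sup>+s. ennreal (frac_kernel \<alpha> t s * exp (\<Lambda> * s)) \<partial>lborel)"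
      by (rule nn_integral_cmult) simp
    also have "\<dots> \<le> ennreal S' * ennreal (\<delta> * exp (\<Lambda> * t))"
      using \<Lambda>(2)[OF t] by (intro mult_left_mono) auto
    finally have "m t \<le> ennreal A + ennreal K * (ennreal S' * ennreal (\<delta> * exp (\<Lambda> * t)))"
      using m[OF t] by (meson add_left_mono dual_order.trans mult_left_mono zero_le)
    also have "\<dots> = ennreal (A + (K * \<delta>) * (S' * exp (\<Lambda> * t)))"
      using A S' \<delta> by (simp add: ennreal_plus[symmetric] ennreal_mult[symmetric] mult_ac del: ennreal_plus)
    also have "\<dots> \<le> ennreal (A * exp (\<Lambda> * t) + 1/2 * (S' * exp (\<Lambda> * t)))"
    proof (intro ennreal_leI add_mono)
      have "1 \<le> exp (\<Lambda> * t)" using \<Lambda>(1) t by simp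
      then show "A \<le> A * exp (\<Lambda> * t)" using A by (simp add: mult_le_cancel_left1)
      show "K * \<delta> * (S' * exp (\<Lambda> * t)) \<le> 1/2 * (S' * exp (\<Lambda> * t))"
        using \<delta> S' by (intro mult_right_mono) auto
    qed
    finally show ?thesis by (simp add: algebra_simps)
  qed
  have "S \<le> ennreal (A + S' / 2)"
    unfolding S_def
  proof (rule SUP_least)
    fix t assume "t \<in> {0..T}"
    then have "m t * ennreal (exp (- (\<Lambda> * t))) \<le> ennreal ((A + S' / 2) * exp (\<Lambda> * t)) * ennreal (exp (- (\<Lambda> * t)))"
      by (intro mult_right_mono step) auto
    also have "\<dots> = ennreal (A + S' / 2)"
      using A S' by (simp add: ennreal_mult[symmetric] mult.assoc exp_add[symmetric] del: distrib_right_numeral)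
    finally show "m t * ennreal (exp (- (\<Lambda> * t))) \<le> ennreal (A + S' / 2)" .
  qed
  then have "S' \<le> 2 * A" using A S' by (simp del: ennreal_plus)
  then have "(A + S' / 2) * exp (\<Lambda> * t) \<le> 2 * A * exp (\<Lambda> * t)" by (intro mult_right_mono) auto
  then show ?thesis using step[OF t] by (meson ennreal_leI order_trans)
qed

subsection \<open>Moments of the solution\<close>

lemma borel_measurable_matrix_vector_mult [measurable (raw)]:
  fixes B :: "real^'d^'d"
  assumes "f \<in> borel_measurable M"
  shows "(\<lambda>\<omega>. B *v f \<omega>) \<in> borel_measurable M"
  by (rule borel_measurable_continuous_on[OF _ assms])
     (intro linear_continuous_on matrix_vector_mul_bounded_linear)

lemma two_mult_ennreal: "2 * ennreal r = ennreal (2 * r)"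
  by (simp add: ennreal_mult')

locale frac_volterra = prob_space M for M :: "'a measure" +
  fixes T \<alpha> \<kappa> :: real and x0 :: "'a \<Rightarrow> real^'d" and G x :: "real \<Rightarrow> 'a \<Rightarrow> real^'d" and B :: "real^'d^'d"
  assumes T: "0 < T" and \<alpha>: "0 < \<alpha>" "\<alpha> < 1" and \<kappa>: "0 \<le> \<kappa>"
    and x0_meas [measurable]: "x0 \<in> borel_measurable M"
    and x0_L2: "integrable M (\<lambda>\<omega>. (norm (x0 \<omega>))\<^sup>2)"
    and G_meas: "\<And>t. t \<in> {0..T} \<Longrightarrow> G t \<in> borel_measurable M"
    and G_L2: "\<And>t. t \<in> {0..T} \<Longrightarrow> integrable M (\<lambda>\<omega>. (norm (G t \<omega>))\<^sup>2)"
    and G_cov: "\<And>s a r b. s \<in> {0..T} \<Longrightarrow> a \<in> {0..T} \<Longrightarrow> r \<in> {0..T} \<Longrightarrow> b \<in> {0..T} \<Longrightarrow>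
      (\<integral>\<omega>. (G s \<omega> - G a \<omega>) \<bullet> (G r \<omega> - G b \<omega>) \<partial>M)
      = \<kappa> * (\<bar>s - b\<bar> powr \<alpha> + \<bar>a - r\<bar> powr \<alpha> - \<bar>s - r\<bar> powr \<alpha> - \<bar>a - b\<bar> powr \<alpha>)"
    and x_meas: "\<And>t. t \<in> {0..T} \<Longrightarrow> x t \<in> borel_measurable M"
    and x_cont: "\<And>\<omega>. \<omega> \<in> space M \<Longrightarrow> continuous_on {0..T} (\<lambda>t. x t \<omega>)"
    and x_eq: "\<And>t. t \<in> {0..T} \<Longrightarrow> AE \<omega> in M.
        x t \<omega> = x0 \<omega> + (1 / Gamma \<alpha>) *\<^sub>R
           (LINT s:{0..t}|lborel. (t - s) powr (\<alpha> - 1) *\<^sub>R (B *v x s \<omega>)) + G t \<omega>"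
begin

definition y :: "real \<Rightarrow> 'a \<Rightarrow> real^'d" where
  "y t \<omega> = x (max 0 (min T t)) \<omega>"

definition F :: "real \<Rightarrow> 'a \<Rightarrow> real^'d" where
  "F t \<omega> = (\<integral>s. frac_kernel \<alpha> t s *\<^sub>R (B *v y s \<omega>) \<partial>lborel)"

text \<open>\<open>G\<close> itself need not be jointly measurable; this modification is.\<close>
definition Gm :: "real \<Rightarrow> 'a \<Rightarrow> real^'d" where
  "Gm t \<omega> = y t \<omega> - x0 \<omega> - (1 / Gamma \<alpha>) *\<^sub>R F t \<omega>"

definition b :: real where "b = onorm ((*v) B)"

lemma b_nonneg: "0 \<le> b"
  unfolding b_def by (intro onorm_pos_le matrix_vector_mul_bounded_linear)

lemma norm_B_le: "norm (B *v v) \<le> b * norm v"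
  unfolding b_def by (intro onorm matrix_vector_mul_bounded_linear)

lemma y_eq: "t \<in> {0..T} \<Longrightarrow> y t = x t"
  by (auto simp: y_def fun_eq_iff max_def min_def)

lemma y_cont: "\<omega> \<in> space M \<Longrightarrow> continuous_on UNIV (\<lambda>t. y t \<omega>)"
  unfolding y_def using T
  by (intro continuous_on_compose2[OF x_cont, of \<omega> UNIV "\<lambda>t. max 0 (min T t)"] continuous_intros) auto

lemma y_path_bounded:
  assumes "\<omega> \<in> space M"
  obtains R where "0 \<le> R" "\<And>s. norm (y s \<omega>) \<le> R"
proof -
  have "bounded ((\<lambda>t. x t \<omega>) ` {0..T})"
    using x_cont[OF assms] by (intro compact_imp_bounded compact_continuous_image) auto
  then obtain R where "\<forall>v\<in>(\<lambda>t. x t \<omega>) ` {0..T}. norm v \<le> R"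
    unfolding bounded_iff by blast
  then have R: "norm (x s \<omega>) \<le> R" if "s \<in> {0..T}" for s using that by blast
  have "norm (y s \<omega>) \<le> R" for s
    unfolding y_def using R[of "max 0 (min T s)"] T by auto
  moreover from this have "0 \<le> R" using norm_ge_zero order_trans by blast
  ultimately show ?thesis using that by blast
qed

lemma y_joint: "(\<lambda>(s, \<omega>). y s \<omega>) \<in> borel_measurable (lborel \<Otimes>\<^sub>M M)"
proof (rule borel_measurable_continuous_process)
  show "y t \<in> borel_measurable M" for t
    unfolding y_def using x_meas[of "max 0 (min T t)"] T by simp
qed (rule y_cont)

lemma y_measurable [measurable (raw)]:
  assumes [measurable]: "f \<in> borel_measurable N" "g \<in> measurable N M"
  shows "(\<lambda>z. y (f z) (g z)) \<in> borel_measurable N"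
  using measurable_compose[of "\<lambda>z. (f z, g z)" N "lborel \<Otimes>\<^sub>M M", OF _ y_joint] by simp

lemma F_measurable [measurable (raw)]:
  assumes [measurable]: "f \<in> borel_measurable N" "g \<in> measurable N M"
  shows "(\<lambda>z. F (f z) (g z)) \<in> borel_measurable N"
  unfolding F_def by measurable

lemma Gm_measurable [measurable (raw)]:
  assumes [measurable]: "f \<in> borel_measurable N" "g \<in> measurable N M"
  shows "(\<lambda>z. Gm (f z) (g z)) \<in> borel_measurable N"
  unfolding Gm_def by measurable

lemma Gm_AE:
  assumes t: "t \<in> {0..T}"
  shows "AE \<omega> in M. Gm t \<omega> = G t \<omega>"
proof -
  have "(LINT s:{0..t}|lborel. (t - s) powr (\<alpha> - 1) *\<^sub>R (B *v x s \<omega>)) = F t \<omega>" for \<omega>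
    unfolding F_def set_lebesgue_integral_def
    using t by (intro Bochner_Integration.integral_cong refl) (auto simp: frac_kernel_def indicator_def y_eq)
  then have "AE \<omega> in M. x t \<omega> = x0 \<omega> + (1 / Gamma \<alpha>) *\<^sub>R F t \<omega> + G t \<omega>"
    using x_eq[OF t] by simp
  then show ?thesis by eventually_elim (simp add: Gm_def y_eq[OF t])
qed

lemma msq_x0: "msq M x0 = ennreal (\<integral>\<omega>. (norm (x0 \<omega>))\<^sup>2 \<partial>M)"
  by (rule msq_eq_integral[OF x0_L2])

lemma Gm_cov:
  assumes "s \<in> {0..T}" "a \<in> {0..T}" "r \<in> {0..T}" "d \<in> {0..T}"
  shows "(\<integral>\<omega>. (Gm s \<omega> - Gm a \<omega>) \<bullet> (Gm r \<omega> - Gm d \<omega>) \<partial>M)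
      = \<kappa> * (\<bar>s - d\<bar> powr \<alpha> + \<bar>a - r\<bar> powr \<alpha> - \<bar>s - r\<bar> powr \<alpha> - \<bar>a - d\<bar> powr \<alpha>)"
proof -
  note [measurable] = G_meas[OF assms(1)] G_meas[OF assms(2)] G_meas[OF assms(3)] G_meas[OF assms(4)]
  have "(\<integral>\<omega>. (Gm s \<omega> - Gm a \<omega>) \<bullet> (Gm r \<omega> - Gm d \<omega>) \<partial>M)
      = (\<integral>\<omega>. (G s \<omega> - G a \<omega>) \<bullet> (G r \<omega> - G d \<omega>) \<partial>M)"
  proof (rule integral_cong_AE)
    show "AE \<omega> in M. (Gm s \<omega> - Gm a \<omega>) \<bullet> (Gm r \<omega> - Gm d \<omega>) = (G s \<omega> - G a \<omega>) \<bullet> (G r \<omega> - G d \<omega>)"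
      using Gm_AE[OF assms(1)] Gm_AE[OF assms(2)] Gm_AE[OF assms(3)] Gm_AE[OF assms(4)]
      by eventually_elim simp
  qed measurable
  then show ?thesis using G_cov[OF assms] by simp
qed

lemma msq_Gm_diff:
  assumes "s \<in> {0..T}" "a \<in> {0..T}"
  shows "msq M (\<lambda>\<omega>. Gm s \<omega> - Gm a \<omega>) = ennreal (2 * \<kappa> * \<bar>s - a\<bar> powr \<alpha>)"
proof -
  note [measurable] = G_meas[OF assms(1)] G_meas[OF assms(2)]
  have "msq M (\<lambda>\<omega>. Gm s \<omega> - Gm a \<omega>) = msq M (\<lambda>\<omega>. G s \<omega> - G a \<omega>)"
  proof (rule msq_cong_AE)
    show "AE \<omega> in M. Gm s \<omega> - Gm a \<omega> = G s \<omega> - G a \<omega>"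
      using Gm_AE[OF assms(1)] Gm_AE[OF assms(2)] by eventually_elim simp
  qed
  also have "\<dots> = ennreal (\<integral>\<omega>. (norm (G s \<omega> - G a \<omega>))\<^sup>2 \<partial>M)"
  proof (rule msq_eq_integral, rule msq_finite_imp_integrable)
    have "msq M (\<lambda>\<omega>. G s \<omega> - G a \<omega>) \<le> 2 * msq M (G s) + 2 * msq M (G a)"
      by (rule msq_diff_le) auto
    also have "\<dots> < \<infinity>"
      by (simp add: msq_eq_integral[OF G_L2[OF assms(1)]] msq_eq_integral[OF G_L2[OF assms(2)]] ennreal_mult_less_top)
    finally show "msq M (\<lambda>\<omega>. G s \<omega> - G a \<omega>) < \<infinity>" .
  qed measurable
  also have "(\<integral>\<omega>. (norm (G s \<omega> - G a \<omega>))\<^sup>2 \<partial>M) = 2 * \<kappa> * \<bar>s - a\<bar> powr \<alpha>"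
    using G_cov[OF assms assms] by (simp add: power2_norm_eq_inner abs_minus_commute)
  finally show ?thesis .
qed

lemma msq_Gm_bounded:
  obtains g where "0 \<le> g" "\<And>t. t \<in> {0..T} \<Longrightarrow> msq M (Gm t) \<le> ennreal g"
proof -
  have 0: "0 \<in> {0..T}" using T by simp
  define g0 where "g0 = (\<integral>\<omega>. (norm (G 0 \<omega>))\<^sup>2 \<partial>M)"
  have g0: "msq M (Gm 0) = ennreal g0" "0 \<le> g0"
    using msq_cong_AE[OF Gm_AE[OF 0]] msq_eq_integral[OF G_L2[OF 0]] by (simp_all add: g0_def)
  show ?thesis
  proof (rule that[of "2 * (2 * \<kappa> * T powr \<alpha>) + 2 * g0"])
    fix t assume t: "t \<in> {0..T}"
    have "msq M (Gm t) = msq M (\<lambda>\<omega>. (Gm t \<omega> - Gm 0 \<omega>) + Gm 0 \<omega>)" by simp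
    also have "\<dots> \<le> 2 * msq M (\<lambda>\<omega>. Gm t \<omega> - Gm 0 \<omega>) + 2 * msq M (Gm 0)"
      by (rule msq_add_le) measurable
    also have "\<dots> = 2 * ennreal (2 * \<kappa> * t powr \<alpha>) + 2 * ennreal g0"
      using t by (simp add: msq_Gm_diff[OF t 0] g0)
    also have "\<dots> \<le> 2 * ennreal (2 * \<kappa> * T powr \<alpha>) + 2 * ennreal g0"
      using t \<kappa> \<alpha> by (intro add_mono mult_left_mono ennreal_leI powr_mono2) auto
    also have "\<dots> = ennreal (2 * (2 * \<kappa> * T powr \<alpha>) + 2 * g0)"
      using g0 \<kappa> by (simp add: two_mult_ennreal ennreal_plus[symmetric] del: ennreal_plus)
    finally show "msq M (Gm t) \<le> ennreal (2 * (2 * \<kappa> * T powr \<alpha>) + 2 * g0)" .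
  qed (use g0 \<kappa> in auto)
qed

lemma msq_B_le:
  assumes "v \<in> borel_measurable M"
  shows "msq M (\<lambda>\<omega>. B *v v \<omega>) \<le> ennreal (b\<^sup>2) * msq M v"
  by (rule msq_bounded_linear_le[OF norm_B_le assms])

lemma msq_frac_integral_le:
  fixes f :: "real \<Rightarrow> 'a \<Rightarrow> real^'d"
  assumes f: "(\<lambda>(s, \<omega>). f s \<omega>) \<in> borel_measurable (lborel \<Otimes>\<^sub>M M)" and t: "t \<in> {0..T}"
  shows "msq M (\<lambda>\<omega>. \<integral>s. frac_kernel \<alpha> t s *\<^sub>R (B *v f s \<omega>) \<partial>lborel)
    \<le> ennreal (T powr \<alpha> / \<alpha> * b\<^sup>2) * (\<integral>\<^sup>+s. ennreal (frac_kernel \<alpha> t s) * msq M (f s) \<partial>lborel)"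
proof -
  have [measurable (raw)]: "(\<lambda>x. f (a x) (b x)) \<in> borel_measurable N"
    if [measurable]: "a \<in> borel_measurable N" "b \<in> measurable N M" for a b and N :: "'z measure"
    using measurable_compose[of "\<lambda>x. (a x, b x)" N "lborel \<Otimes>\<^sub>M M", OF _ f] by simp
  have [measurable]: "(\<lambda>s. msq M (f s)) \<in> borel_measurable lborel"
    by (rule borel_measurable_msq[OF f])
  have "msq M (\<lambda>\<omega>. \<integral>s. frac_kernel \<alpha> t s *\<^sub>R (B *v f s \<omega>) \<partial>lborel)
      \<le> (\<integral>\<^sup>+s. ennreal \<bar>frac_kernel \<alpha> t s\<bar> \<partial>lborel) *
         (\<integral>\<^sup>+s. ennreal \<bar>frac_kernel \<alpha> t s\<bar> * msq M (\<lambda>\<omega>. B *v f s \<omega>) \<partial>lborel)"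
    by (rule msq_integral_le) measurable
  also have "\<dots> \<le> ennreal (T powr \<alpha> / \<alpha>) *
         (\<integral>\<^sup>+s. ennreal (b\<^sup>2) * (ennreal (frac_kernel \<alpha> t s) * msq M (f s)) \<partial>lborel)"
  proof (rule mult_mono)
    show "(\<integral>\<^sup>+s. ennreal \<bar>frac_kernel \<alpha> t s\<bar> \<partial>lborel) \<le> ennreal (T powr \<alpha> / \<alpha>)"
      using t \<alpha> by (simp add: nn_integral_frac_kernel ennreal_leI divide_right_mono powr_mono2)
    show "(\<integral>\<^sup>+s. ennreal \<bar>frac_kernel \<alpha> t s\<bar> * msq M (\<lambda>\<omega>. B *v f s \<omega>) \<partial>lborel)
        \<le> (\<integral>\<^sup>+s. ennreal (b\<^sup>2) * (ennreal (frac_kernel \<alpha> t s) * msq M (f s)) \<partial>lborel)"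
    proof (intro nn_integral_mono)
      fix s
      show "ennreal \<bar>frac_kernel \<alpha> t s\<bar> * msq M (\<lambda>\<omega>. B *v f s \<omega>)
          \<le> ennreal (b\<^sup>2) * (ennreal (frac_kernel \<alpha> t s) * msq M (f s))"
        using mult_left_mono[OF msq_B_le[of "f s"], of "ennreal (frac_kernel \<alpha> t s)"] by (simp add: mult_ac)
    qed
  qed auto
  also have "\<dots> = ennreal (T powr \<alpha> / \<alpha>) * (ennreal (b\<^sup>2) *
         (\<integral>\<^sup>+s. ennreal (frac_kernel \<alpha> t s) * msq M (f s) \<partial>lborel))"
    by (subst nn_integral_cmult) auto
  also have "\<dots> = ennreal (T powr \<alpha> / \<alpha> * b\<^sup>2) * (\<integral>\<^sup>+s. ennreal (frac_kernel \<alpha> t s) * msq M (f s) \<partial>lborel)"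
    using \<alpha> by (subst ennreal_mult) (auto simp: mult.assoc)
  finally show ?thesis .
qed

lemma gronwall_rate:
  assumes "0 \<le> K"
  obtains \<Lambda> \<delta> where "0 \<le> \<Lambda>" "0 \<le> \<delta>" "K * \<delta> \<le> 1/2"
    "\<And>t. t \<in> {0..T} \<Longrightarrow> (\<integral>\<^sup>+s. ennreal (frac_kernel \<alpha> t s * exp (\<Lambda> * s)) \<partial>lborel) \<le> ennreal (\<delta> * exp (\<Lambda> * t))"
proof -
  define \<delta> where "\<delta> = 1 / (2 * (K + 1))"
  have \<delta>: "0 < \<delta>" "K * \<delta> \<le> 1/2" using assms by (auto simp: \<delta>_def field_simps)
  obtain \<Lambda> where "0 \<le> \<Lambda>"
    "\<And>t. t \<in> {0..T} \<Longrightarrow> (\<integral>\<^sup>+s. ennreal (frac_kernel \<alpha> t s * exp (\<Lambda> * s)) \<partial>lborel) \<le> ennreal (\<delta> * exp (\<Lambda> * t))"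
    using frac_kernel_exp_small[of \<alpha> T \<delta>] \<alpha> T \<delta> by auto
  with \<delta> show ?thesis by (intro that[of \<Lambda> \<delta>]) auto
qed

text \<open>Square integrability of the solution is not assumed. Truncating to paths bounded by \<open>n\<close>
  makes the Gronwall argument applicable, with a bound independent of \<open>n\<close>.\<close>
lemma msq_y_bounded:
  obtains D where "0 \<le> D" "\<And>t. t \<in> {0..T} \<Longrightarrow> msq M (y t) \<le> ennreal D"
proof -
  obtain g where g: "0 \<le> g" "\<And>t. t \<in> {0..T} \<Longrightarrow> msq M (Gm t) \<le> ennreal g"
    using msq_Gm_bounded by blast
  define X where "X = (\<integral>\<omega>. (norm (x0 \<omega>))\<^sup>2 \<partial>M)"
  have X: "0 \<le> X" by (simp add: X_def)
  define c where "c = 1 / Gamma \<alpha>"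
  define A where "A = 4 * X + 4 * g"
  define K where "K = 2 * c\<^sup>2 * (T powr \<alpha> / \<alpha> * b\<^sup>2)"
  have A: "0 \<le> A" "0 \<le> K" using X g \<alpha> by (auto simp: A_def K_def)
  obtain \<Lambda> \<delta> where \<Lambda>: "0 \<le> \<Lambda>" "0 \<le> \<delta>" "K * \<delta> \<le> 1/2"
    "\<And>t. t \<in> {0..T} \<Longrightarrow> (\<integral>\<^sup>+s. ennreal (frac_kernel \<alpha> t s * exp (\<Lambda> * s)) \<partial>lborel) \<le> ennreal (\<delta> * exp (\<Lambda> * t))"
    using gronwall_rate[OF A(2)] by blast
  define \<Omega> where "\<Omega> n = {\<omega> \<in> space M. \<forall>q::rat. norm (y (real_of_rat q) \<omega>) \<le> real n}" for n :: nat
  have [measurable]: "\<Omega> n \<in> sets M" for n unfolding \<Omega>_def by measurable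
  have \<Omega>: "norm (y t \<omega>) \<le> real n" if "\<omega> \<in> \<Omega> n" for \<omega> n t
  proof -
    have "closed {t. norm (y t \<omega>) \<le> real n}"
      using that by (intro closed_Collect_le continuous_intros y_cont) (auto simp: \<Omega>_def)
    moreover have "\<rat> \<subseteq> {t. norm (y t \<omega>) \<le> real n}"
      using that by (auto simp: \<Omega>_def Rats_def)
    ultimately have "closure \<rat> \<subseteq> {t. norm (y t \<omega>) \<le> real n}" by (rule closure_minimal[rotated])
    then show ?thesis using Rats_closure_real by auto
  qed
  define z where "z n t \<omega> = indicator (\<Omega> n) \<omega> *\<^sub>R y t \<omega>" for n t \<omega>
  have zm [measurable (raw)]: "(\<lambda>w. z n (f w) (g w)) \<in> borel_measurable N"
    if [measurable]: "f \<in> borel_measurable N" "g \<in> measurable N M" for f g n and N :: "'z measure"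
    unfolding z_def by measurable
  have bound: "msq M (z n t) \<le> ennreal (2 * A * exp (\<Lambda> * t))" if t: "t \<in> {0..T}" for n t
  proof (rule frac_gronwall[where m="\<lambda>t. msq M (z n t)" and R="(real n)\<^sup>2" and K=K and \<delta>=\<delta>, OF _ _ A \<Lambda>(1,4,2,3) t])
    fix t assume t: "t \<in> {0..T}"
    have "msq M (z n t) \<le> (\<integral>\<^sup>+\<omega>. ennreal ((real n)\<^sup>2) \<partial>M)"
      unfolding msq_def using \<Omega> by (intro nn_integral_mono ennreal_leI power_mono) (auto simp: z_def indicator_def)
    then show "msq M (z n t) \<le> ennreal ((real n)\<^sup>2)" by (simp add: emeasure_space_1)
    let ?I = "\<lambda>\<omega>. \<integral>s. frac_kernel \<alpha> t s *\<^sub>R (B *v z n s \<omega>) \<partial>lborel"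
    have zeq: "z n t \<omega> = indicator (\<Omega> n) \<omega> *\<^sub>R (x0 \<omega> + Gm t \<omega>) + c *\<^sub>R ?I \<omega>" for \<omega>
    proof -
      have "?I \<omega> = indicator (\<Omega> n) \<omega> *\<^sub>R F t \<omega>"
        unfolding F_def z_def by (cases "\<omega> \<in> \<Omega> n") auto
      then show ?thesis by (cases "\<omega> \<in> \<Omega> n") (auto simp: z_def Gm_def c_def)
    qed
    have "msq M (z n t) = msq M (\<lambda>\<omega>. indicator (\<Omega> n) \<omega> *\<^sub>R (x0 \<omega> + Gm t \<omega>) + c *\<^sub>R ?I \<omega>)"
      by (intro msq_cong) (rule zeq)
    also have "\<dots> \<le> 2 * msq M (\<lambda>\<omega>. indicator (\<Omega> n) \<omega> *\<^sub>R (x0 \<omega> + Gm t \<omega>)) + 2 * msq M (\<lambda>\<omega>. c *\<^sub>R ?I \<omega>)"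
      by (rule msq_add_le) measurable
    also have "msq M (\<lambda>\<omega>. indicator (\<Omega> n) \<omega> *\<^sub>R (x0 \<omega> + Gm t \<omega>)) \<le> msq M (\<lambda>\<omega>. x0 \<omega> + Gm t \<omega>)"
      by (rule msq_mono) (auto simp: indicator_def)
    also have "\<dots> \<le> 2 * msq M x0 + 2 * msq M (Gm t)"
      by (rule msq_add_le) measurable
    also have "\<dots> \<le> 2 * ennreal X + 2 * ennreal g"
      using g(2)[OF t] by (intro add_mono mult_left_mono) (auto simp: msq_x0 X_def)
    also have "msq M (\<lambda>\<omega>. c *\<^sub>R ?I \<omega>) = ennreal (c\<^sup>2) * msq M ?I"
      by (rule msq_scaleR) measurable
    also have "msq M ?I \<le> ennreal (T powr \<alpha> / \<alpha> * b\<^sup>2) * (\<integral>\<^sup>+s. ennreal (frac_kernel \<alpha> t s) * msq M (z n s) \<partial>lborel)"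
      by (rule msq_frac_integral_le[OF _ t]) measurable
    finally have "msq M (z n t) \<le> 2 * (2 * ennreal X + 2 * ennreal g) +
        2 * (ennreal (c\<^sup>2) * (ennreal (T powr \<alpha> / \<alpha> * b\<^sup>2) * (\<integral>\<^sup>+s. ennreal (frac_kernel \<alpha> t s) * msq M (z n s) \<partial>lborel)))"
      by (simp add: mult_left_mono add_mono)
    also have "2 * (2 * ennreal X + 2 * ennreal g) = ennreal A"
      using X g(1) by (simp add: A_def ennreal_plus ennreal_mult' algebra_simps)
    also have "2 * (ennreal (c\<^sup>2) * (ennreal (T powr \<alpha> / \<alpha> * b\<^sup>2) * (\<integral>\<^sup>+s. ennreal (frac_kernel \<alpha> t s) * msq M (z n s) \<partial>lborel)))
        = ennreal K * (\<integral>\<^sup>+s. ennreal (frac_kernel \<alpha> t s) * msq M (z n s) \<partial>lborel)"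
    proof -
      have "ennreal K = 2 * (ennreal (c\<^sup>2) * ennreal (T powr \<alpha> / \<alpha> * b\<^sup>2))"
        using \<alpha> by (simp add: K_def two_mult_ennreal ennreal_mult[symmetric] mult.assoc)
      then show ?thesis by (simp add: mult.assoc)
    qed
    finally show "msq M (z n t) \<le> ennreal A + ennreal K * (\<integral>\<^sup>+s. ennreal (frac_kernel \<alpha> t s) * msq M (z n s) \<partial>lborel)" .
  qed
  show ?thesis
  proof (rule that[of "2 * A * exp (\<Lambda> * T)"])
    fix t assume t: "t \<in> {0..T}"
    have "msq M (y t) = (\<integral>\<^sup>+\<omega>. (SUP n. ennreal ((norm (z n t \<omega>))\<^sup>2)) \<partial>M)"
      unfolding msq_def
    proof (intro nn_integral_cong)
      fix \<omega> assume \<omega>: "\<omega> \<in> space M"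
      obtain R where R: "\<And>s. norm (y s \<omega>) \<le> R" using y_path_bounded[OF \<omega>] by blast
      obtain n where n: "R \<le> real n" using real_arch_simple by blast
      have "\<omega> \<in> \<Omega> n" using \<omega> order_trans[OF R n] by (auto simp: \<Omega>_def)
      then have "ennreal ((norm (y t \<omega>))\<^sup>2) = ennreal ((norm (z n t \<omega>))\<^sup>2)" by (simp add: z_def)
      also have "\<dots> \<le> (SUP n. ennreal ((norm (z n t \<omega>))\<^sup>2))" by (rule SUP_upper) simp
      finally show "ennreal ((norm (y t \<omega>))\<^sup>2) = (SUP n. ennreal ((norm (z n t \<omega>))\<^sup>2))"
        by (intro antisym SUP_least) (auto simp: z_def indicator_def)
    qed
    also have "\<dots> = (SUP n. msq M (z n t))"
      unfolding msq_def
    proof (rule nn_integral_monotone_convergence_SUP)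
      show "incseq (\<lambda>n \<omega>. ennreal ((norm (z n t \<omega>))\<^sup>2))"
      proof (intro incseq_SucI le_funI ennreal_leI power_mono)
        fix n \<omega>
        have "\<Omega> n \<subseteq> \<Omega> (Suc n)"
        proof
          fix \<omega> assume "\<omega> \<in> \<Omega> n"
          then have "\<omega> \<in> space M" "\<And>q. norm (y (real_of_rat q) \<omega>) \<le> real n" by (auto simp: \<Omega>_def)
          then have "\<And>q. norm (y (real_of_rat q) \<omega>) \<le> real (Suc n)" by (meson le_SucI of_nat_mono order_refl order_trans)
          then show "\<omega> \<in> \<Omega> (Suc n)" using \<open>\<omega> \<in> space M\<close> by (simp add: \<Omega>_def)
        qed
        then show "norm (z n t \<omega>) \<le> norm (z (Suc n) t \<omega>)" by (auto simp: z_def indicator_def)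
      qed simp
    qed measurable
    also have "\<dots> \<le> ennreal (2 * A * exp (\<Lambda> * T))"
    proof (rule SUP_least)
      fix n
      have "2 * A * exp (\<Lambda> * t) \<le> 2 * A * exp (\<Lambda> * T)"
        using t A \<Lambda>(1) by (intro mult_left_mono) (auto intro: mult_left_mono)
      then show "msq M (z n t) \<le> ennreal (2 * A * exp (\<Lambda> * T))"
        using bound[OF t, of n] by (meson ennreal_leI order_trans)
    qed
    finally show "msq M (y t) \<le> ennreal (2 * A * exp (\<Lambda> * T))" .
  qed (use A in auto)
qed

subsection \<open>Mean-square regularity of the solution\<close>

lemma integrable_frac_kernel_scaleR:
  fixes g :: "real \<Rightarrow> real^'d"
  assumes t: "0 \<le> t" and [measurable]: "g \<in> borel_measurable borel"
    and R: "\<And>s. s \<in> {0..t} \<Longrightarrow> norm (g s) \<le> R"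
  shows "integrable lborel (\<lambda>s. frac_kernel \<alpha> t s *\<^sub>R g s)"
proof (rule Bochner_Integration.integrable_bound)
  show "integrable lborel (\<lambda>s. R * frac_kernel \<alpha> t s)"
    using integrable_frac_kernel[OF \<alpha>(1) t] by simp
  show "AE s in lborel. norm (frac_kernel \<alpha> t s *\<^sub>R g s) \<le> norm (R * frac_kernel \<alpha> t s)"
  proof (intro AE_I2)
    fix s
    show "norm (frac_kernel \<alpha> t s *\<^sub>R g s) \<le> norm (R * frac_kernel \<alpha> t s)"
    proof (cases "s \<in> {0..t}")
      case True
      then have "norm (g s) * frac_kernel \<alpha> t s \<le> R * frac_kernel \<alpha> t s"
        using R by (intro mult_right_mono) auto
      moreover have "0 \<le> R" using R[OF True] norm_ge_zero order_trans by blast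
      ultimately show ?thesis by (simp add: mult.commute abs_mult)
    qed (auto simp: frac_kernel_def)
  qed
qed measurable

lemma integrable_F:
  assumes "0 \<le> t" and \<omega>[measurable]: "\<omega> \<in> space M"
  shows "integrable lborel (\<lambda>s. frac_kernel \<alpha> t s *\<^sub>R (B *v y s \<omega>))"
proof -
  obtain R where R: "\<And>s. norm (y s \<omega>) \<le> R" using y_path_bounded[OF \<omega>] by blast
  have "norm (B *v y s \<omega>) \<le> b * R" for s
    using norm_B_le[of "y s \<omega>"] mult_left_mono[OF R[of s] b_nonneg] by linarith
  then show ?thesis using assms by (intro integrable_frac_kernel_scaleR[of t _ "b * R"]) auto
qed

lemma path_bounded:
  assumes \<omega>[measurable]: "\<omega> \<in> space M"
  obtains R where "0 \<le> R" "\<And>s. s \<in> {0..T} \<Longrightarrow> norm (y s \<omega>) \<le> R"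
    "\<And>s. s \<in> {0..T} \<Longrightarrow> norm (F s \<omega>) \<le> R" "\<And>s. s \<in> {0..T} \<Longrightarrow> norm (Gm s \<omega>) \<le> R"
proof -
  obtain R where R: "0 \<le> R" "\<And>s. norm (y s \<omega>) \<le> R" using y_path_bounded[OF \<omega>] by blast
  have F: "norm (F s \<omega>) \<le> b * R * (T powr \<alpha> / \<alpha>)" if s: "s \<in> {0..T}" for s
  proof -
    have le: "norm (frac_kernel \<alpha> s r *\<^sub>R (B *v y r \<omega>)) \<le> b * R * frac_kernel \<alpha> s r" for r
    proof -
      have "norm (B *v y r \<omega>) \<le> b * R"
        using norm_B_le[of "y r \<omega>"] mult_left_mono[OF R(2)[of r] b_nonneg] by linarith
      then have "frac_kernel \<alpha> s r * norm (B *v y r \<omega>) \<le> frac_kernel \<alpha> s r * (b * R)"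
        by (rule mult_left_mono) simp
      then show ?thesis by (simp add: mult_ac)
    qed
    have "norm (F s \<omega>) \<le> (\<integral>r. norm (frac_kernel \<alpha> s r *\<^sub>R (B *v y r \<omega>)) \<partial>lborel)"
      unfolding F_def by (rule integral_norm_bound)
    also have "\<dots> \<le> (\<integral>r. b * R * frac_kernel \<alpha> s r \<partial>lborel)"
    proof (rule integral_mono)
      show "integrable lborel (\<lambda>r. norm (frac_kernel \<alpha> s r *\<^sub>R (B *v y r \<omega>)))"
        using s \<omega> by (intro integrable_norm integrable_F) auto
      show "integrable lborel (\<lambda>r. b * R * frac_kernel \<alpha> s r)"
        using s integrable_frac_kernel[OF \<alpha>(1), of s] by simp
    qed (rule le)
    also have "\<dots> = b * R * (s powr \<alpha> / \<alpha>)"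
      using s \<alpha> by (simp add: integral_frac_kernel)
    also have "\<dots> \<le> b * R * (T powr \<alpha> / \<alpha>)"
      using s \<alpha> b_nonneg R(1) by (intro mult_left_mono divide_right_mono powr_mono2) auto
    finally show ?thesis .
  qed
  define Q where "Q = b * R * (T powr \<alpha> / \<alpha>)"
  have Q: "0 \<le> Q" using b_nonneg R \<alpha> by (auto simp: Q_def)
  define c where "c = \<bar>1 / Gamma \<alpha>\<bar>"
  have c: "0 \<le> c" by (simp add: c_def)
  show ?thesis
  proof (rule that[of "R + Q + (R + norm (x0 \<omega>) + c * Q)"])
    fix s assume s: "s \<in> {0..T}"
    have Fs: "norm (F s \<omega>) \<le> Q" using F[OF s] by (simp add: Q_def)
    have "norm (Gm s \<omega>) \<le> norm (y s \<omega>) + norm (x0 \<omega>) + norm ((1 / Gamma \<alpha>) *\<^sub>R F s \<omega>)"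
      unfolding Gm_def by (meson add_mono norm_triangle_ineq4 order_refl order_trans)
    also have "norm ((1 / Gamma \<alpha>) *\<^sub>R F s \<omega>) \<le> c * Q"
      unfolding norm_scaleR c_def using Fs by (intro mult_left_mono) auto
    finally have G: "norm (Gm s \<omega>) \<le> R + norm (x0 \<omega>) + c * Q" using R(2)[of s] by linarith
    have "0 \<le> c * Q" using c Q by simp
    then show "norm (y s \<omega>) \<le> R + Q + (R + norm (x0 \<omega>) + c * Q)"
      "norm (F s \<omega>) \<le> R + Q + (R + norm (x0 \<omega>) + c * Q)"
      "norm (Gm s \<omega>) \<le> R + Q + (R + norm (x0 \<omega>) + c * Q)"
      using Fs G R(2)[of s] R(1) Q norm_ge_zero[of "x0 \<omega>"] by linarith+
  qed (use R Q c in auto)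
qed

lemma F_diff:
  assumes "0 \<le> s" "0 \<le> a" "\<omega> \<in> space M"
  shows "F s \<omega> - F a \<omega> = (\<integral>r. (frac_kernel \<alpha> s r - frac_kernel \<alpha> a r) *\<^sub>R (B *v y r \<omega>) \<partial>lborel)"
  unfolding F_def scaleR_left_diff_distrib
  using integrable_F assms by (intro Bochner_Integration.integral_diff[symmetric]) auto

lemma msq_F_diff_crude:
  obtains C where "0 \<le> C"
    "\<And>a s. 0 \<le> a \<Longrightarrow> a \<le> s \<Longrightarrow> s \<le> T \<Longrightarrow> msq M (\<lambda>\<omega>. F s \<omega> - F a \<omega>) \<le> ennreal (C * (s - a) powr (2 * \<alpha>))"
proof -
  obtain D where D: "0 \<le> D" "\<And>t. t \<in> {0..T} \<Longrightarrow> msq M (y t) \<le> ennreal D"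
    using msq_y_bounded by blast
  show ?thesis
  proof (rule that[of "(2 / \<alpha>)\<^sup>2 * (b\<^sup>2 * D)"])
    fix a s assume as: "0 \<le> a" "a \<le> s" "s \<le> T"
    have "msq M (\<lambda>\<omega>. F s \<omega> - F a \<omega>)
        = msq M (\<lambda>\<omega>. \<integral>r. (frac_kernel \<alpha> s r - frac_kernel \<alpha> a r) *\<^sub>R (B *v y r \<omega>) \<partial>lborel)"
      using as by (intro msq_cong F_diff) auto
    also have "\<dots> \<le> ennreal ((2 * (s - a) powr \<alpha> / \<alpha>)\<^sup>2) * (ennreal (b\<^sup>2) * ennreal D)"
    proof (rule msq_integral_le_const)
      show "(\<integral>\<^sup>+r. ennreal \<bar>frac_kernel \<alpha> s r - frac_kernel \<alpha> a r\<bar> \<partial>lborel) \<le> ennreal (2 * (s - a) powr \<alpha> / \<alpha>)"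
        using as \<alpha> by (intro nn_integral_frac_kernel_diff) auto
      fix r assume "frac_kernel \<alpha> s r - frac_kernel \<alpha> a r \<noteq> 0"
      then have "frac_kernel \<alpha> s r \<noteq> 0 \<or> frac_kernel \<alpha> a r \<noteq> 0" by auto
      then have r: "r \<in> {0..T}" using as by (auto dest: frac_kernel_nonzeroD)
      have "msq M (\<lambda>\<omega>. B *v y r \<omega>) \<le> ennreal (b\<^sup>2) * msq M (y r)"
        by (rule msq_B_le) measurable
      also have "\<dots> \<le> ennreal (b\<^sup>2) * ennreal D" using D(2)[OF r] by (intro mult_left_mono) auto
      finally show "msq M (\<lambda>\<omega>. B *v y r \<omega>) \<le> ennreal (b\<^sup>2) * ennreal D" .
    qed (use \<alpha> in \<open>measurable, auto\<close>)
    also have "\<dots> = ennreal ((2 / \<alpha>)\<^sup>2 * (b\<^sup>2 * D) * (s - a) powr (2 * \<alpha>))"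
    proof -
      have "((s - a) powr \<alpha>)\<^sup>2 = (s - a) powr (2 * \<alpha>)"
        using as by (simp add: power2_eq_square powr_add[symmetric])
      then have "(2 * (s - a) powr \<alpha> / \<alpha>)\<^sup>2 = (2 / \<alpha>)\<^sup>2 * (s - a) powr (2 * \<alpha>)"
        by (simp add: power_mult_distrib power_divide)
      then show ?thesis using D by (simp add: ennreal_mult[symmetric] mult_ac)
    qed
    finally show "msq M (\<lambda>\<omega>. F s \<omega> - F a \<omega>) \<le> ennreal ((2 / \<alpha>)\<^sup>2 * (b\<^sup>2 * D) * (s - a) powr (2 * \<alpha>))" .
  qed (use D in auto)
qed

lemma y_diff: "y s \<omega> - y a \<omega> = (1 / Gamma \<alpha>) *\<^sub>R (F s \<omega> - F a \<omega>) + (Gm s \<omega> - Gm a \<omega>)"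
  by (simp add: Gm_def scaleR_right_diff_distrib)

lemma msq_y_diff:
  obtains C where "0 \<le> C"
    "\<And>a s. a \<in> {0..T} \<Longrightarrow> s \<in> {0..T} \<Longrightarrow> msq M (\<lambda>\<omega>. y s \<omega> - y a \<omega>) \<le> ennreal (C * \<bar>s - a\<bar> powr \<alpha>)"
proof -
  obtain C where C: "0 \<le> C"
    "\<And>a s. 0 \<le> a \<Longrightarrow> a \<le> s \<Longrightarrow> s \<le> T \<Longrightarrow> msq M (\<lambda>\<omega>. F s \<omega> - F a \<omega>) \<le> ennreal (C * (s - a) powr (2 * \<alpha>))"
    using msq_F_diff_crude by blast
  define c where "c = 1 / Gamma \<alpha>"
  define C' where "C' = 2 * (c\<^sup>2 * (C * T powr \<alpha>)) + 2 * (2 * \<kappa>)"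
  have le: "msq M (\<lambda>\<omega>. y s \<omega> - y a \<omega>) \<le> ennreal (C' * \<bar>s - a\<bar> powr \<alpha>)"
    if as: "0 \<le> a" "a \<le> s" "s \<le> T" for a s
  proof -
    have "msq M (\<lambda>\<omega>. y s \<omega> - y a \<omega>) = msq M (\<lambda>\<omega>. c *\<^sub>R (F s \<omega> - F a \<omega>) + (Gm s \<omega> - Gm a \<omega>))"
      by (simp add: y_diff c_def)
    also have "\<dots> \<le> 2 * msq M (\<lambda>\<omega>. c *\<^sub>R (F s \<omega> - F a \<omega>)) + 2 * msq M (\<lambda>\<omega>. Gm s \<omega> - Gm a \<omega>)"
      by (rule msq_add_le) measurable
    also have "\<dots> = 2 * (ennreal (c\<^sup>2) * msq M (\<lambda>\<omega>. F s \<omega> - F a \<omega>)) + 2 * ennreal (2 * \<kappa> * \<bar>s - a\<bar> powr \<alpha>)"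
      using as by (subst msq_scaleR) (measurable, auto simp: msq_Gm_diff)
    also have "\<dots> \<le> 2 * (ennreal (c\<^sup>2) * ennreal (C * (s - a) powr (2 * \<alpha>))) + 2 * ennreal (2 * \<kappa> * \<bar>s - a\<bar> powr \<alpha>)"
      using as by (intro add_mono mult_left_mono C(2)) auto
    also have "\<dots> = ennreal (2 * (c\<^sup>2 * (C * (s - a) powr (2 * \<alpha>))) + 2 * (2 * \<kappa> * \<bar>s - a\<bar> powr \<alpha>))"
      using C(1) \<kappa> by (simp add: two_mult_ennreal ennreal_mult[symmetric] ennreal_plus[symmetric] del: ennreal_plus)
    also have "\<dots> \<le> ennreal (C' * \<bar>s - a\<bar> powr \<alpha>)"
    proof (rule ennreal_leI)
      have "(s - a) powr (2 * \<alpha>) = (s - a) powr \<alpha> * (s - a) powr \<alpha>" by (simp add: powr_add[symmetric])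
      also have "\<dots> \<le> T powr \<alpha> * (s - a) powr \<alpha>" using as \<alpha> by (intro mult_right_mono powr_mono2) auto
      finally have "2 * (c\<^sup>2 * (C * (s - a) powr (2 * \<alpha>))) \<le> 2 * (c\<^sup>2 * (C * (T powr \<alpha> * (s - a) powr \<alpha>)))"
        using C(1) by (intro mult_left_mono) auto
      then show "2 * (c\<^sup>2 * (C * (s - a) powr (2 * \<alpha>))) + 2 * (2 * \<kappa> * \<bar>s - a\<bar> powr \<alpha>) \<le> C' * \<bar>s - a\<bar> powr \<alpha>"
        using as by (simp add: C'_def algebra_simps)
    qed
    finally show ?thesis .
  qed
  show ?thesis
  proof (rule that[of C'])
    show "0 \<le> C'" using C(1) \<kappa> by (simp add: C'_def)
    fix a s assume as: "a \<in> {0..T}" "s \<in> {0..T}"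
    show "msq M (\<lambda>\<omega>. y s \<omega> - y a \<omega>) \<le> ennreal (C' * \<bar>s - a\<bar> powr \<alpha>)"
    proof (cases "a \<le> s")
      case True then show ?thesis using as le by auto
    next
      case False
      have "msq M (\<lambda>\<omega>. y s \<omega> - y a \<omega>) = msq M (\<lambda>\<omega>. y a \<omega> - y s \<omega>)"
        using msq_minus[of M "\<lambda>\<omega>. y a \<omega> - y s \<omega>"] by simp
      then show ?thesis using False as le[of s a] by (simp add: abs_minus_commute)
    qed
  qed
qed

text \<open>Subtracting \<open>y a\<close> under the integral exploits the mean-square Hoelder continuity of the
  solution; the remaining term carries the singularity at \<open>s = 0\<close>.\<close>
lemma msq_F_diff:
  assumes \<gamma>: "\<alpha> \<le> \<gamma>" "\<gamma> < 1" "2 * \<gamma> \<le> 3 * \<alpha>"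
  obtains C where "0 \<le> C"
    "\<And>a s. 0 \<le> a \<Longrightarrow> a \<le> s \<Longrightarrow> 0 < s \<Longrightarrow> s \<le> T \<Longrightarrow>
       msq M (\<lambda>\<omega>. F s \<omega> - F a \<omega>) \<le> ennreal (C * ((s - a) powr \<gamma> * s powr (\<alpha> - \<gamma>))\<^sup>2)"
proof -
  obtain D where D: "0 \<le> D" "\<And>t. t \<in> {0..T} \<Longrightarrow> msq M (y t) \<le> ennreal D"
    using msq_y_bounded by blast
  obtain E where E: "0 \<le> E"
    "\<And>a s. a \<in> {0..T} \<Longrightarrow> s \<in> {0..T} \<Longrightarrow> msq M (\<lambda>\<omega>. y s \<omega> - y a \<omega>) \<le> ennreal (E * \<bar>s - a\<bar> powr \<alpha>)"
    using msq_y_diff by blast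
  define \<beta> where "\<beta> = \<gamma> - \<alpha>"
  define q where "q = 1 / \<gamma> + 1 / (1 - \<gamma>) + 1 / \<alpha>"
  have q: "0 \<le> q" using \<gamma> \<alpha> by (simp add: q_def)
  define D1 where "D1 = b\<^sup>2 * (E * T powr (\<alpha> - 2 * \<beta>))"
  have D1: "0 \<le> D1" using E by (simp add: D1_def)
  define C where "C = 2 * (q\<^sup>2 * D1 * (T powr \<beta>)\<^sup>2) + 2 * ((1 / \<alpha>)\<^sup>2 * (b\<^sup>2 * D))"
  have C: "0 \<le> C" using D D1 by (simp add: C_def)
  show ?thesis
  proof (rule that[OF C])
    fix a s assume as: "0 \<le> a" "a \<le> s" "0 < s" "s \<le> T"
    show "msq M (\<lambda>\<omega>. F s \<omega> - F a \<omega>) \<le> ennreal (C * ((s - a) powr \<gamma> * s powr (\<alpha> - \<gamma>))\<^sup>2)"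
    proof (cases "a = s")
      case True then show ?thesis by (simp add: msq_def)
    next
      case False
      then have as': "a < s" using as by simp
      define h where "h = s - a"
      define w where "w r = (frac_kernel \<alpha> s r - frac_kernel \<alpha> a r) * \<bar>r - a\<bar> powr \<beta>" for r
      define f where "f r \<omega> = (\<bar>r - a\<bar> powr (- \<beta>)) *\<^sub>R (B *v (y r \<omega> - y a \<omega>))" for r \<omega>
      define v where "v = (s powr \<alpha> - a powr \<alpha>) / \<alpha>"
      have [measurable]: "w \<in> borel_measurable borel" unfolding w_def by measurable
      have fm: "(\<lambda>(r, \<omega>). f r \<omega>) \<in> borel_measurable (lborel \<Otimes>\<^sub>M M)"
        unfolding f_def by measurable
      have [measurable]: "(\<lambda>\<omega>. \<integral>r. w r *\<^sub>R f r \<omega> \<partial>lborel) \<in> borel_measurable M"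
        unfolding f_def by measurable
      have split: "F s \<omega> - F a \<omega> = (\<integral>r. w r *\<^sub>R f r \<omega> \<partial>lborel) + v *\<^sub>R (B *v y a \<omega>)"
        if \<omega>: "\<omega> \<in> space M" for \<omega>
      proof -
        have wf: "w r *\<^sub>R f r \<omega> = (frac_kernel \<alpha> s r *\<^sub>R (B *v y r \<omega>) - frac_kernel \<alpha> a r *\<^sub>R (B *v y r \<omega>))
            - (frac_kernel \<alpha> s r - frac_kernel \<alpha> a r) *\<^sub>R (B *v y a \<omega>)" for r
        proof (cases "r = a")
          case False
          then have "\<bar>r - a\<bar> powr \<beta> * \<bar>r - a\<bar> powr (- \<beta>) = 1" by (simp add: powr_add[symmetric])
          then show ?thesis
            by (simp add: w_def f_def matrix_vector_mult_diff_distrib mult.assoc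
                scaleR_left_diff_distrib scaleR_right_diff_distrib)
        qed (simp add: w_def f_def scaleR_left_diff_distrib)
        have "(\<integral>r. w r *\<^sub>R f r \<omega> \<partial>lborel) = (F s \<omega> - F a \<omega>)
            - (\<integral>r. frac_kernel \<alpha> s r - frac_kernel \<alpha> a r \<partial>lborel) *\<^sub>R (B *v y a \<omega>)"
          unfolding wf F_def
          using as \<omega> integrable_F[of s \<omega>] integrable_F[of a \<omega>]
            integrable_frac_kernel[OF \<alpha>(1), of s] integrable_frac_kernel[OF \<alpha>(1), of a]
          by simp
        also have "(\<integral>r. frac_kernel \<alpha> s r - frac_kernel \<alpha> a r \<partial>lborel) = v"
          using as \<alpha> integrable_frac_kernel[OF \<alpha>(1), of s] integrable_frac_kernel[OF \<alpha>(1), of a]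
          by (simp add: integral_frac_kernel v_def diff_divide_distrib)
        finally show ?thesis by simp
      qed
      have "msq M (\<lambda>\<omega>. F s \<omega> - F a \<omega>) = msq M (\<lambda>\<omega>. (\<integral>r. w r *\<^sub>R f r \<omega> \<partial>lborel) + v *\<^sub>R (B *v y a \<omega>))"
        by (rule msq_cong) (rule split)
      also have "\<dots> \<le> 2 * msq M (\<lambda>\<omega>. \<integral>r. w r *\<^sub>R f r \<omega> \<partial>lborel) + 2 * msq M (\<lambda>\<omega>. v *\<^sub>R (B *v y a \<omega>))"
        by (rule msq_add_le) measurable
      also have "msq M (\<lambda>\<omega>. \<integral>r. w r *\<^sub>R f r \<omega> \<partial>lborel) \<le> ennreal ((q * h powr \<gamma>)\<^sup>2) * ennreal D1"
      proof (rule msq_integral_le_const[OF _ fm])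
        show "(\<integral>\<^sup>+r. ennreal \<bar>w r\<bar> \<partial>lborel) \<le> ennreal (q * h powr \<gamma>)"
          using nn_integral_frac_kernel_diff_weighted[of \<alpha> \<gamma> a s] as' as \<gamma> \<alpha>
          by (simp add: w_def abs_mult \<beta>_def q_def h_def)
        show "0 \<le> q * h powr \<gamma>" using q by simp
        fix r assume "w r \<noteq> 0"
        then have "frac_kernel \<alpha> s r \<noteq> 0 \<or> frac_kernel \<alpha> a r \<noteq> 0" by (auto simp: w_def)
        then have r: "r \<in> {0..T}" using as by (auto dest: frac_kernel_nonzeroD)
        have a: "a \<in> {0..T}" using as by auto
        have "msq M (f r) = ennreal ((\<bar>r - a\<bar> powr (- \<beta>))\<^sup>2) * msq M (\<lambda>\<omega>. B *v (y r \<omega> - y a \<omega>))"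
          unfolding f_def by (rule msq_scaleR) measurable
        also have "msq M (\<lambda>\<omega>. B *v (y r \<omega> - y a \<omega>)) \<le> ennreal (b\<^sup>2) * msq M (\<lambda>\<omega>. y r \<omega> - y a \<omega>)"
          by (rule msq_B_le) measurable
        also have "msq M (\<lambda>\<omega>. y r \<omega> - y a \<omega>) \<le> ennreal (E * \<bar>r - a\<bar> powr \<alpha>)" by (rule E(2)[OF a r])
        finally have "msq M (f r) \<le> ennreal ((\<bar>r - a\<bar> powr (- \<beta>))\<^sup>2) * (ennreal (b\<^sup>2) * ennreal (E * \<bar>r - a\<bar> powr \<alpha>))"
          by (simp add: mult_left_mono)
        also have "\<dots> = ennreal (b\<^sup>2 * (E * (\<bar>r - a\<bar> powr \<alpha> * (\<bar>r - a\<bar> powr (- \<beta>))\<^sup>2)))"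
          using E(1) by (simp add: ennreal_mult[symmetric] mult_ac)
        also have "\<bar>r - a\<bar> powr \<alpha> * (\<bar>r - a\<bar> powr (- \<beta>))\<^sup>2 = \<bar>r - a\<bar> powr (\<alpha> - 2 * \<beta>)"
          by (simp add: power2_eq_square powr_add[symmetric])
        also have "ennreal (b\<^sup>2 * (E * \<bar>r - a\<bar> powr (\<alpha> - 2 * \<beta>))) \<le> ennreal D1"
          unfolding D1_def using r as \<gamma> E(1)
          by (intro ennreal_leI mult_left_mono powr_mono2) (auto simp: \<beta>_def)
        finally show "msq M (f r) \<le> ennreal D1" .
      qed measurable
      also have "msq M (\<lambda>\<omega>. v *\<^sub>R (B *v y a \<omega>)) = ennreal (v\<^sup>2) * msq M (\<lambda>\<omega>. B *v y a \<omega>)"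
        by (rule msq_scaleR) measurable
      also have "msq M (\<lambda>\<omega>. B *v y a \<omega>) \<le> ennreal (b\<^sup>2) * msq M (y a)"
        by (rule msq_B_le) measurable
      also have "msq M (y a) \<le> ennreal D" using as by (intro D) auto
      finally have "msq M (\<lambda>\<omega>. F s \<omega> - F a \<omega>)
          \<le> 2 * (ennreal ((q * h powr \<gamma>)\<^sup>2) * ennreal D1) + 2 * (ennreal (v\<^sup>2) * (ennreal (b\<^sup>2) * ennreal D))"
        by (simp add: mult_left_mono add_mono)
      also have "\<dots> = ennreal (2 * ((q * h powr \<gamma>)\<^sup>2 * D1) + 2 * (v\<^sup>2 * (b\<^sup>2 * D)))"
        using D(1) D1 by (simp add: two_mult_ennreal ennreal_mult[symmetric] ennreal_plus[symmetric] del: ennreal_plus)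
      also have "\<dots> \<le> ennreal (C * (h powr \<gamma> * s powr (\<alpha> - \<gamma>))\<^sup>2)"
      proof (rule ennreal_leI)
        have v0: "0 \<le> v" using as \<alpha> by (simp add: v_def powr_mono2)
        have "s powr \<alpha> - a powr \<alpha> \<le> h powr \<gamma> * s powr (\<alpha> - \<gamma>)"
          unfolding h_def using as \<alpha> \<gamma> by (intro powr_diff_interpolate) auto
        then have "v \<le> 1 / \<alpha> * (h powr \<gamma> * s powr (\<alpha> - \<gamma>))"
          using \<alpha> by (simp add: v_def divide_right_mono)
        then have "v\<^sup>2 \<le> (1 / \<alpha> * (h powr \<gamma> * s powr (\<alpha> - \<gamma>)))\<^sup>2" using v0 by (intro power_mono)
        then have 2: "v\<^sup>2 * (b\<^sup>2 * D) \<le> (1 / \<alpha>)\<^sup>2 * (b\<^sup>2 * D) * (h powr \<gamma> * s powr (\<alpha> - \<gamma>))\<^sup>2"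
          using D(1) mult_right_mono[of "v\<^sup>2" "(1 / \<alpha> * (h powr \<gamma> * s powr (\<alpha> - \<gamma>)))\<^sup>2" "b\<^sup>2 * D"]
          by (simp add: power_mult_distrib power_divide mult_ac)
        have "1 = s powr \<beta> * s powr (\<alpha> - \<gamma>)" using as by (simp add: \<beta>_def powr_add[symmetric])
        also have "\<dots> \<le> T powr \<beta> * s powr (\<alpha> - \<gamma>)"
          using as \<gamma> by (intro mult_right_mono powr_mono2) (auto simp: \<beta>_def)
        finally have "1\<^sup>2 \<le> (T powr \<beta> * s powr (\<alpha> - \<gamma>))\<^sup>2" by (intro power_mono) auto
        then have "(q * h powr \<gamma>)\<^sup>2 * D1 * 1 \<le> (q * h powr \<gamma>)\<^sup>2 * D1 * (T powr \<beta> * s powr (\<alpha> - \<gamma>))\<^sup>2"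
          using D1 by (intro mult_left_mono) auto
        then have 1: "(q * h powr \<gamma>)\<^sup>2 * D1 \<le> q\<^sup>2 * D1 * (T powr \<beta>)\<^sup>2 * (h powr \<gamma> * s powr (\<alpha> - \<gamma>))\<^sup>2"
          by (simp add: power_mult_distrib mult_ac)
        show "2 * ((q * h powr \<gamma>)\<^sup>2 * D1) + 2 * (v\<^sup>2 * (b\<^sup>2 * D)) \<le> C * (h powr \<gamma> * s powr (\<alpha> - \<gamma>))\<^sup>2"
          unfolding C_def distrib_right using 1 2 by linarith
      qed
      finally show ?thesis by (simp add: h_def)
    qed
  qed
qed

end

subsection \<open>Noise part of the local error\<close>

definition grid :: "real \<Rightarrow> real \<Rightarrow> real" where
  "grid k s = k * of_int \<lfloor>s / k\<rfloor>"

lemma grid_measurable [measurable]: "grid k \<in> borel_measurable borel"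
  unfolding grid_def by measurable

lemma grid_bounds:
  assumes "0 < k"
  shows "grid k s \<le> s" "s < grid k s + k" "0 \<le> s \<Longrightarrow> 0 \<le> grid k s"
proof -
  define i :: real where "i = of_int \<lfloor>s / k\<rfloor>"
  have "i \<le> s / k" "s / k < i + 1" unfolding i_def by linarith+
  then have "k * i \<le> s" "s < k * i + k" using assms by (simp_all add: field_simps)
  then show "grid k s \<le> s" "s < grid k s + k" by (simp_all add: grid_def i_def)
  show "0 \<le> grid k s" if "0 \<le> s" using that assms by (simp add: grid_def)
qed

lemma grid_index:
  assumes "0 < k" "0 \<le> s" "s < real n * k"
  shows "nat \<lfloor>s / k\<rfloor> < n" "grid k s = real (nat \<lfloor>s / k\<rfloor>) * k"
proof -
  have "s / k < real n" using assms by (simp add: field_simps)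
  then have "\<lfloor>s / k\<rfloor> < int n" by linarith
  then show "nat \<lfloor>s / k\<rfloor> < n" using assms by (simp add: nat_less_iff)
  show "grid k s = real (nat \<lfloor>s / k\<rfloor>) * k" using assms by (simp add: grid_def)
qed

lemma grid_separated:
  assumes "0 < k" "\<lfloor>s / k\<rfloor> < \<lfloor>r / k\<rfloor>"
  shows "s \<le> grid k r"
proof -
  have "(of_int \<lfloor>s / k\<rfloor> :: real) + 1 \<le> of_int \<lfloor>r / k\<rfloor>" using assms(2) by linarith
  then have "k * (of_int \<lfloor>s / k\<rfloor> + 1) \<le> k * of_int \<lfloor>r / k\<rfloor>" using assms(1) by (intro mult_left_mono) auto
  then show ?thesis using grid_bounds(2)[OF assms(1), of s] by (simp add: grid_def distrib_left)
qed

definition cell_weight :: "real \<Rightarrow> nat \<Rightarrow> real" where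
  "cell_weight \<alpha> j = real (j + 1) powr \<alpha> - real j powr \<alpha>"

lemma cell_weight_nonneg: "0 \<le> \<alpha> \<Longrightarrow> 0 \<le> cell_weight \<alpha> j"
  by (simp add: cell_weight_def powr_mono2)

context frac_volterra begin

text \<open>The noise is a fractional Brownian motion of Hurst index \<open>\<alpha>/2 < 1/2\<close>, so its increments
  over disjoint intervals are negatively correlated, by concavity of \<open>r \<mapsto> r powr \<alpha>\<close>.\<close>
lemma Gm_increment_cov_le:
  assumes k: "0 < k" and s: "s \<in> {0..T}" and r: "r \<in> {0..T}"
  shows "(\<integral>\<omega>. (Gm s \<omega> - Gm (grid k s) \<omega>) \<bullet> (Gm r \<omega> - Gm (grid k r) \<omega>) \<partial>M)
    \<le> (if \<lfloor>s / k\<rfloor> = \<lfloor>r / k\<rfloor> then 2 * \<kappa> * k powr \<alpha> else 0)"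
proof -
  have g: "grid k s \<in> {0..T}" "grid k r \<in> {0..T}"
    using grid_bounds(1,3)[OF k, of s] grid_bounds(1,3)[OF k, of r] s r by auto
  have neg: "\<bar>s - b\<bar> powr \<alpha> + \<bar>a - r\<bar> powr \<alpha> - \<bar>s - r\<bar> powr \<alpha> - \<bar>a - b\<bar> powr \<alpha> \<le> 0"
    if "a \<le> s" "s \<le> b" "b \<le> r" for a s b r :: real
  proof -
    have abs: "\<bar>s - b\<bar> = b - s" "\<bar>a - r\<bar> = r - a" "\<bar>s - r\<bar> = r - s" "\<bar>a - b\<bar> = b - a"
      using that by auto
    show ?thesis
      unfolding abs using powr_increment_antimono[of "b - s" "r - b" "s - a" \<alpha>] that \<alpha> by simp
  qed
  show ?thesis
  proof (cases "\<lfloor>s / k\<rfloor> = \<lfloor>r / k\<rfloor>")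
    case True
    then have eq: "grid k r = grid k s" by (simp add: grid_def)
    have le: "\<bar>u - grid k u\<bar> powr \<alpha> \<le> k powr \<alpha>" for u
      using grid_bounds(1,2)[OF k, of u] \<alpha> by (intro powr_mono2) auto
    have "(\<integral>\<omega>. (Gm s \<omega> - Gm (grid k s) \<omega>) \<bullet> (Gm r \<omega> - Gm (grid k r) \<omega>) \<partial>M)
        = \<kappa> * (\<bar>s - grid k s\<bar> powr \<alpha> + \<bar>r - grid k r\<bar> powr \<alpha> - \<bar>s - r\<bar> powr \<alpha>)"
      using Gm_cov[OF s g(1) r g(2)] by (simp add: eq abs_minus_commute)
    also have "\<dots> \<le> \<kappa> * (k powr \<alpha> + k powr \<alpha> - 0)"
      using le[of s] le[of r] \<kappa> by (intro mult_left_mono diff_mono add_mono) auto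
    finally show ?thesis using True by simp
  next
    case False
    then consider "\<lfloor>s / k\<rfloor> < \<lfloor>r / k\<rfloor>" | "\<lfloor>r / k\<rfloor> < \<lfloor>s / k\<rfloor>" by linarith
    then have "\<bar>s - grid k r\<bar> powr \<alpha> + \<bar>grid k s - r\<bar> powr \<alpha> - \<bar>s - r\<bar> powr \<alpha>
        - \<bar>grid k s - grid k r\<bar> powr \<alpha> \<le> 0"
    proof cases
      case 1
      show ?thesis using neg[OF grid_bounds(1)[OF k] grid_separated[OF k 1] grid_bounds(1)[OF k]] .
    next
      case 2
      show ?thesis
        using neg[OF grid_bounds(1)[OF k] grid_separated[OF k 2] grid_bounds(1)[OF k]]
        by (simp add: abs_minus_commute add.commute)
    qed
    then have "\<kappa> * (\<bar>s - grid k r\<bar> powr \<alpha> + \<bar>grid k s - r\<bar> powr \<alpha> - \<bar>s - r\<bar> powr \<alpha>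
        - \<bar>grid k s - grid k r\<bar> powr \<alpha>) \<le> 0"
      using \<kappa> by (simp add: mult_nonneg_nonpos)
    then show ?thesis using False Gm_cov[OF s g(1) r g(2)] by simp
  qed
qed

lemma nn_integral_cell:
  assumes k: "0 < k" and i: "i < n"
  shows "(\<integral>\<^sup>+s. ennreal (indicator {real i * k..real (Suc i) * k} s * frac_kernel \<alpha> (real n * k) s) \<partial>lborel)
    = ennreal (k powr \<alpha> / \<alpha> * cell_weight \<alpha> (n - Suc i))"
proof -
  have le: "real (Suc i) * k \<le> real n * k" using i k by (intro mult_right_mono) auto
  have e: "real n * k - real i * k = real (n - Suc i + 1) * k" "real n * k - real (Suc i) * k = real (n - Suc i) * k"
    using i by (simp_all add: left_diff_distrib[symmetric] of_nat_diff)
  have p: "(real m * k) powr \<alpha> = real m powr \<alpha> * k powr \<alpha>" for m using k by (simp add: powr_mult)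
  have "((real n * k - real i * k) powr \<alpha> - (real n * k - real (Suc i) * k) powr \<alpha>) / \<alpha>
      = k powr \<alpha> / \<alpha> * cell_weight \<alpha> (n - Suc i)"
    unfolding e p cell_weight_def by (simp add: algebra_simps diff_divide_distrib)
  moreover have "real i * k \<le> real (Suc i) * k" using k by (intro mult_right_mono) auto
  ultimately show ?thesis
    using nn_integral_frac_kernel_Icc[of \<alpha> "real i * k" "real (Suc i) * k" "real n * k"] \<alpha> k le by simp
qed

lemma integral_cell:
  assumes k: "0 < k" and i: "i < n"
  shows "has_bochner_integral lborel (\<lambda>s. indicator {real i * k..<real (Suc i) * k} s * frac_kernel \<alpha> (real n * k) s)
    (k powr \<alpha> / \<alpha> * cell_weight \<alpha> (n - Suc i))"
proof (rule has_bochner_integral_nn_integral)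
  show "0 \<le> k powr \<alpha> / \<alpha> * cell_weight \<alpha> (n - Suc i)" using \<alpha> cell_weight_nonneg by simp
  have "AE s in lborel. s \<noteq> real (Suc i) * k" by (rule AE_lborel_singleton)
  then have "(\<integral>\<^sup>+s. ennreal (indicator {real i * k..<real (Suc i) * k} s * frac_kernel \<alpha> (real n * k) s) \<partial>lborel)
    = (\<integral>\<^sup>+s. ennreal (indicator {real i * k..real (Suc i) * k} s * frac_kernel \<alpha> (real n * k) s) \<partial>lborel)"
    by (intro nn_integral_cong_AE) (auto elim!: eventually_mono simp: indicator_def)
  then show "(\<integral>\<^sup>+s. ennreal (indicator {real i * k..<real (Suc i) * k} s * frac_kernel \<alpha> (real n * k) s) \<partial>lborel)
    = ennreal (k powr \<alpha> / \<alpha> * cell_weight \<alpha> (n - Suc i))"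
    using nn_integral_cell[OF assms] by simp
qed auto

lemma msq_noise_term:
  assumes k: "0 < k" and n: "real n * k \<le> T"
  shows "msq M (\<lambda>\<omega>. \<integral>s. frac_kernel \<alpha> (real n * k) s *\<^sub>R (Gm s \<omega> - Gm (grid k s) \<omega>) \<partial>lborel)
    \<le> ennreal (2 * \<kappa> * k powr \<alpha> * (\<Sum>j<n. (k powr \<alpha> / \<alpha> * cell_weight \<alpha> j)\<^sup>2))"
proof -
  define t where "t = real n * k"
  have t: "0 \<le> t" "t \<le> T" using k n by (auto simp: t_def)
  let ?K = "frac_kernel \<alpha> t"
  let ?\<rho> = "\<lambda>s r. if \<lfloor>s / k\<rfloor> = \<lfloor>r / k\<rfloor> then 2 * \<kappa> * k powr \<alpha> else 0"
  let ?C = "\<lambda>i s. ennreal (indicator {real i * k..real (Suc i) * k} s * ?K s)"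
  have range: "s \<in> {0..T}" "grid k s \<in> {0..T}" if "?K s \<noteq> 0" for s
    using frac_kernel_nonzeroD[OF that] t grid_bounds(1,3)[OF k, of s] by auto
  have "msq M (\<lambda>\<omega>. \<integral>s. ?K s *\<^sub>R (Gm s \<omega> - Gm (grid k s) \<omega>) \<partial>lborel)
      \<le> (\<integral>\<^sup>+s. (\<integral>\<^sup>+r. ennreal (?K s * ?K r * ?\<rho> s r) \<partial>lborel) \<partial>lborel)"
  proof (rule msq_integral_le_covariance[where D="2 * \<kappa> * k powr \<alpha>"])
    show "integrable lborel ?K" using integrable_frac_kernel[OF \<alpha>(1) t(1)] .
    fix s assume s: "?K s \<noteq> 0"
    have "2 * \<kappa> * \<bar>s - grid k s\<bar> powr \<alpha> \<le> 2 * \<kappa> * k powr \<alpha>"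
      using grid_bounds(1,2)[OF k, of s] \<alpha> \<kappa> by (intro mult_left_mono powr_mono2) auto
    then show "msq M (\<lambda>\<omega>. Gm s \<omega> - Gm (grid k s) \<omega>) \<le> ennreal (2 * \<kappa> * k powr \<alpha>)"
      using msq_Gm_diff[OF range[OF s]] by (simp add: ennreal_leI)
    fix r assume r: "?K r \<noteq> 0"
    show "(\<integral>\<omega>. (Gm s \<omega> - Gm (grid k s) \<omega>) \<bullet> (Gm r \<omega> - Gm (grid k r) \<omega>) \<partial>M) \<le> ?\<rho> s r"
      using Gm_increment_cov_le[OF k range(1)[OF s] range(1)[OF r]] .
  qed (use \<kappa> in \<open>measurable, auto\<close>)
  also have "\<dots> \<le> (\<integral>\<^sup>+s. (\<integral>\<^sup>+r. ennreal (2 * \<kappa> * k powr \<alpha>) * (\<Sum>i<n. ?C i s * ?C i r) \<partial>lborel) \<partial>lborel)"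
  proof (intro nn_integral_mono)
    fix s r :: real
    show "ennreal (?K s * ?K r * ?\<rho> s r) \<le> ennreal (2 * \<kappa> * k powr \<alpha>) * (\<Sum>i<n. ?C i s * ?C i r)"
    proof (cases "?K s \<noteq> 0 \<and> ?K r \<noteq> 0 \<and> \<lfloor>s / k\<rfloor> = \<lfloor>r / k\<rfloor>")
      case True
      define i where "i = nat \<lfloor>s / k\<rfloor>"
      have s: "0 \<le> s" "s < real n * k" and r: "0 \<le> r" "r < real n * k"
        using True frac_kernel_nonzeroD[of \<alpha> t s] frac_kernel_nonzeroD[of \<alpha> t r] by (auto simp: t_def)
      have i: "i < n" using grid_index(1)[OF k s] by (simp add: i_def)
      have gs: "grid k s = real i * k" using grid_index(2)[OF k s] by (simp add: i_def)
      have gr: "grid k r = real i * k" using gs True by (simp add: grid_def)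
      have "s \<in> {real i * k..real (Suc i) * k}" "r \<in> {real i * k..real (Suc i) * k}"
        using grid_bounds(1,2)[OF k, of s] grid_bounds(1,2)[OF k, of r] gs gr by (auto simp: algebra_simps)
      then have "ennreal (?K s * ?K r * ?\<rho> s r) = ennreal (2 * \<kappa> * k powr \<alpha>) * (?C i s * ?C i r)"
        using True \<kappa> by (simp add: ennreal_mult[symmetric] mult_ac)
      also have "\<dots> \<le> ennreal (2 * \<kappa> * k powr \<alpha>) * (\<Sum>i<n. ?C i s * ?C i r)"
        using i by (intro mult_left_mono sum_nonneg_leq_bound[OF _ _ refl]) (auto intro!: member_le_sum)
      finally show ?thesis .
    qed auto
  qed
  also have "\<dots> = ennreal (2 * \<kappa> * k powr \<alpha>) * (\<Sum>i<n. (\<integral>\<^sup>+s. ?C i s \<partial>lborel)\<^sup>2)"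
    by (simp add: nn_integral_cmult nn_integral_sum nn_integral_multc power2_eq_square)
  also have "(\<Sum>i<n. (\<integral>\<^sup>+s. ?C i s \<partial>lborel)\<^sup>2) = (\<Sum>i<n. ennreal ((k powr \<alpha> / \<alpha> * cell_weight \<alpha> (n - Suc i))\<^sup>2))"
    using nn_integral_cell[OF k] \<alpha> cell_weight_nonneg by (intro sum.cong) (auto simp: t_def ennreal_power)
  also have "\<dots> = ennreal (\<Sum>i<n. (k powr \<alpha> / \<alpha> * cell_weight \<alpha> (n - Suc i))\<^sup>2)"
    by (rule sum_ennreal) simp
  also have "(\<Sum>i<n. (k powr \<alpha> / \<alpha> * cell_weight \<alpha> (n - Suc i))\<^sup>2) = (\<Sum>j<n. (k powr \<alpha> / \<alpha> * cell_weight \<alpha> j)\<^sup>2)"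
    by (rule sum.nat_diff_reindex)
  finally show ?thesis using \<kappa> by (simp add: t_def ennreal_mult[symmetric] sum_nonneg)
qed

lemma scheme_sum_eq:
  fixes X :: "nat \<Rightarrow> 'a \<Rightarrow> real^'d"
  assumes k: "0 < k" and n: "n \<le> N"
  shows "(k powr \<alpha> / Gamma (1 + \<alpha>)) *\<^sub>R
      (\<Sum>j\<in>{1..n}. (real (n - j + 1) powr \<alpha> - real (n - j) powr \<alpha>) *\<^sub>R (B *v X (j - 1) \<omega>))
    = (1 / Gamma \<alpha>) *\<^sub>R (\<integral>s. frac_kernel \<alpha> (real n * k) s *\<^sub>R (B *v X (min N (nat \<lfloor>s / k\<rfloor>)) \<omega>) \<partial>lborel)"
proof -
  let ?c = "\<lambda>i s. indicator {real i * k..<real (Suc i) * k} s * frac_kernel \<alpha> (real n * k) s"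
  have pw: "frac_kernel \<alpha> (real n * k) s *\<^sub>R (B *v X (min N (nat \<lfloor>s / k\<rfloor>)) \<omega>)
      = (\<Sum>i<n. ?c i s *\<^sub>R (B *v X i \<omega>))" for s
  proof (cases "frac_kernel \<alpha> (real n * k) s = 0")
    case False
    then have s: "0 \<le> s" "s < real n * k" using frac_kernel_nonzeroD by blast+
    define i0 where "i0 = nat \<lfloor>s / k\<rfloor>"
    have i0: "i0 < n" using grid_index(1)[OF k s] by (simp add: i0_def)
    have mem: "s \<in> {real i * k..<real (Suc i) * k} \<longleftrightarrow> i = i0" for i
    proof -
      have "s \<in> {real i * k..<real (Suc i) * k} \<longleftrightarrow> real i \<le> s / k \<and> s / k < real i + 1"
        using k by (auto simp: field_simps)
      also have "\<dots> \<longleftrightarrow> \<lfloor>s / k\<rfloor> = int i" by (auto simp: floor_eq_iff)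
      also have "\<dots> \<longleftrightarrow> i = i0" using s k by (auto simp: i0_def)
      finally show ?thesis .
    qed
    have "(\<Sum>i<n. ?c i s *\<^sub>R (B *v X i \<omega>))
        = (\<Sum>i<n. if i = i0 then frac_kernel \<alpha> (real n * k) s *\<^sub>R (B *v X i \<omega>) else 0)"
      using mem by (intro sum.cong) (auto simp: indicator_def)
    also have "\<dots> = frac_kernel \<alpha> (real n * k) s *\<^sub>R (B *v X i0 \<omega>)" using i0 by simp
    finally show ?thesis using i0 n by (simp add: i0_def[symmetric])
  qed simp
  have "(\<integral>s. frac_kernel \<alpha> (real n * k) s *\<^sub>R (B *v X (min N (nat \<lfloor>s / k\<rfloor>)) \<omega>) \<partial>lborel)
      = (\<Sum>i<n. (k powr \<alpha> / \<alpha> * cell_weight \<alpha> (n - Suc i)) *\<^sub>R (B *v X i \<omega>))"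
    unfolding pw using integral_cell[OF k, of _ n]
    by (subst Bochner_Integration.integral_sum) (auto simp: has_bochner_integral_iff intro!: sum.cong)
  also have "\<dots> = (k powr \<alpha> / \<alpha>) *\<^sub>R (\<Sum>i<n. cell_weight \<alpha> (n - Suc i) *\<^sub>R (B *v X i \<omega>))"
    by (simp add: scaleR_sum_right)
  also have "(\<Sum>i<n. cell_weight \<alpha> (n - Suc i) *\<^sub>R (B *v X i \<omega>))
      = (\<Sum>j\<in>{1..n}. (real (n - j + 1) powr \<alpha> - real (n - j) powr \<alpha>) *\<^sub>R (B *v X (j - 1) \<omega>))"
    by (rule sum.reindex_bij_witness[of _ "\<lambda>j. j - 1" Suc]) (auto simp: cell_weight_def)
  finally have "(1 / Gamma \<alpha>) *\<^sub>R (\<integral>s. frac_kernel \<alpha> (real n * k) s *\<^sub>R (B *v X (min N (nat \<lfloor>s / k\<rfloor>)) \<omega>) \<partial>lborel)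
     = (k powr \<alpha> / (\<alpha> * Gamma \<alpha>)) *\<^sub>R
      (\<Sum>j\<in>{1..n}. (real (n - j + 1) powr \<alpha> - real (n - j) powr \<alpha>) *\<^sub>R (B *v X (j - 1) \<omega>))"
    by simp
  moreover have "Gamma (1 + \<alpha>) = \<alpha> * Gamma \<alpha>"
  proof -
    have "\<alpha> \<notin> \<int>\<^sub>\<le>\<^sub>0" using \<alpha> by (auto elim: nonpos_Ints_cases)
    then show ?thesis using Gamma_plus1[of \<alpha>] by (simp add: add.commute)
  qed
  ultimately show ?thesis by simp
qed

subsection \<open>Propagation of the error\<close>

lemma scheme_measurable:
  fixes X :: "nat \<Rightarrow> 'a \<Rightarrow> real^'d"
  assumes grid: "\<And>n. n \<le> N \<Longrightarrow> real n * k \<in> {0..T}"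
    and X: "\<And>n \<omega>. n \<le> N \<Longrightarrow> \<omega> \<in> space M \<Longrightarrow> X n \<omega> = x0 \<omega> + c *\<^sub>R
          (\<Sum>j\<in>{1..n}. w n j *\<^sub>R (B *v X (j - 1) \<omega>)) + G (real n * k) \<omega>"
    and "n \<le> N"
  shows "X n \<in> borel_measurable M"
  using \<open>n \<le> N\<close>
proof (induction n rule: less_induct)
  case (less n)
  have Xj: "X (j - 1) \<in> borel_measurable M" if "j \<in> {1..n}" for j
    using less that by auto
  have [measurable]: "G (real n * k) \<in> borel_measurable M" using grid[OF less.prems] by (rule G_meas)
  have "(\<lambda>\<omega>. x0 \<omega> + c *\<^sub>R (\<Sum>j\<in>{1..n}. w n j *\<^sub>R (B *v X (j - 1) \<omega>)) + G (real n * k) \<omega>) \<in> borel_measurable M"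
    by (intro borel_measurable_add borel_measurable_scaleR borel_measurable_sum borel_measurable_matrix_vector_mult Xj) auto
  then show ?case using X[OF less.prems] by (subst measurable_cong) auto
qed

lemma msq_drift_term:
  assumes \<gamma>: "\<alpha> \<le> \<gamma>" "\<gamma> < 1" "2 * \<gamma> \<le> 3 * \<alpha>"
  obtains C where "0 \<le> C"
    "\<And>k t. 0 < k \<Longrightarrow> t \<in> {0..T} \<Longrightarrow>
       msq M (\<lambda>\<omega>. \<integral>s. frac_kernel \<alpha> t s *\<^sub>R (B *v (F s \<omega> - F (grid k s) \<omega>)) \<partial>lborel)
       \<le> ennreal (C * (k powr \<gamma>)\<^sup>2)"
proof -
  obtain C where C: "0 \<le> C"
    "\<And>a s. 0 \<le> a \<Longrightarrow> a \<le> s \<Longrightarrow> 0 < s \<Longrightarrow> s \<le> T \<Longrightarrow>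
       msq M (\<lambda>\<omega>. F s \<omega> - F a \<omega>) \<le> ennreal (C * ((s - a) powr \<gamma> * s powr (\<alpha> - \<gamma>))\<^sup>2)"
    using msq_F_diff[OF \<gamma>] by blast
  define q where "q = \<alpha> - \<gamma> + 1"
  have q: "0 < q" using \<gamma> \<alpha> by (simp add: q_def)
  define W where "W = T powr (\<alpha> + q - 1) * Beta \<alpha> q"
  have Beta: "0 \<le> Beta \<alpha> q" using \<alpha> q by (simp add: Beta_def Gamma_real_pos less_imp_le)
  then have W: "0 \<le> W" by (simp add: W_def)
  show ?thesis
  proof (rule that[of "W\<^sup>2 * (b\<^sup>2 * C)"])
    fix k t :: real assume k: "0 < k" and t: "t \<in> {0..T}"
    define w where "w s = frac_kernel \<alpha> t s * s powr (q - 1)" for s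
    define f where "f s \<omega> = (s powr (- (q - 1))) *\<^sub>R (B *v (F s \<omega> - F (grid k s) \<omega>))" for s \<omega>
    have [measurable]: "w \<in> borel_measurable borel" unfolding w_def by measurable
    have fm: "(\<lambda>(s, \<omega>). f s \<omega>) \<in> borel_measurable (lborel \<Otimes>\<^sub>M M)"
      unfolding f_def by measurable
    have wf: "frac_kernel \<alpha> t s *\<^sub>R (B *v (F s \<omega> - F (grid k s) \<omega>)) = w s *\<^sub>R f s \<omega>" for s \<omega>
    proof (cases "s = 0")
      case True then show ?thesis by (simp add: w_def grid_def)
    next
      case False
      show ?thesis
      proof (cases "s < 0")
        case True then show ?thesis by (simp add: w_def frac_kernel_def)
      next
        case False
        then have "s powr (q - 1) * s powr (- (q - 1)) = 1"
          using \<open>s \<noteq> 0\<close> by (simp only: powr_add[symmetric]) simp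
        then show ?thesis by (simp add: w_def f_def mult.assoc)
      qed
    qed
    have "msq M (\<lambda>\<omega>. \<integral>s. w s *\<^sub>R f s \<omega> \<partial>lborel) \<le> ennreal (W\<^sup>2) * ennreal (b\<^sup>2 * (C * (k powr \<gamma>)\<^sup>2))"
    proof (rule msq_integral_le_const[OF _ fm _ _ W])
      show "(\<integral>\<^sup>+s. ennreal \<bar>w s\<bar> \<partial>lborel) \<le> ennreal W"
      proof (cases "t = 0")
        case True
        then have "w s = 0" for s by (auto simp: w_def frac_kernel_def indicator_def)
        then show ?thesis by simp
      next
        case False
        then have t': "0 < t" using t by auto
        have "(\<integral>\<^sup>+s. ennreal \<bar>w s\<bar> \<partial>lborel) = ennreal (t powr (\<alpha> + q - 1) * Beta \<alpha> q)"
          using nn_integral_frac_kernel_powr[OF \<alpha>(1) q t'] by (simp add: w_def abs_mult)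
        also have "\<dots> \<le> ennreal W"
          unfolding W_def using t \<gamma> \<alpha> Beta by (intro ennreal_leI mult_right_mono powr_mono2) (auto simp: q_def)
        finally show ?thesis .
      qed
      fix s assume "w s \<noteq> 0"
      then have s: "0 < s" "s \<le> T"
        using frac_kernel_nonzeroD[of \<alpha> t s] t by (cases "s = 0"; auto simp: w_def)+
      note g = grid_bounds[OF k, of s]
      have "msq M (f s) = ennreal ((s powr (- (q - 1)))\<^sup>2) * msq M (\<lambda>\<omega>. B *v (F s \<omega> - F (grid k s) \<omega>))"
        unfolding f_def by (rule msq_scaleR) measurable
      also have "msq M (\<lambda>\<omega>. B *v (F s \<omega> - F (grid k s) \<omega>)) \<le> ennreal (b\<^sup>2) * msq M (\<lambda>\<omega>. F s \<omega> - F (grid k s) \<omega>)"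
        by (rule msq_B_le) measurable
      also have "msq M (\<lambda>\<omega>. F s \<omega> - F (grid k s) \<omega>) \<le> ennreal (C * ((s - grid k s) powr \<gamma> * s powr (\<alpha> - \<gamma>))\<^sup>2)"
        using g s by (intro C(2)) auto
      also have "\<dots> \<le> ennreal (C * (k powr \<gamma> * s powr (\<alpha> - \<gamma>))\<^sup>2)"
        using g s C(1) \<gamma> \<alpha> by (intro ennreal_leI mult_left_mono power_mono mult_right_mono powr_mono2) auto
      finally have "msq M (f s) \<le> ennreal ((s powr (- (q - 1)))\<^sup>2) * (ennreal (b\<^sup>2) * ennreal (C * (k powr \<gamma> * s powr (\<alpha> - \<gamma>))\<^sup>2))"
        by (simp add: mult_left_mono)
      also have "\<dots> = ennreal (b\<^sup>2 * (C * ((k powr \<gamma>)\<^sup>2 * (s powr (- (q - 1)) * s powr (\<alpha> - \<gamma>))\<^sup>2)))"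
        using C(1) by (simp add: ennreal_mult[symmetric] power_mult_distrib mult_ac)
      also have "s powr (- (q - 1)) * s powr (\<alpha> - \<gamma>) = 1"
        using s by (simp add: q_def powr_add[symmetric])
      finally show "msq M (f s) \<le> ennreal (b\<^sup>2 * (C * (k powr \<gamma>)\<^sup>2))" by simp
    qed measurable
    then show "msq M (\<lambda>\<omega>. \<integral>s. frac_kernel \<alpha> t s *\<^sub>R (B *v (F s \<omega> - F (grid k s) \<omega>)) \<partial>lborel)
        \<le> ennreal (W\<^sup>2 * (b\<^sup>2 * C) * (k powr \<gamma>)\<^sup>2)"
      unfolding wf using C(1) by (simp add: ennreal_mult[symmetric] mult_ac)
  qed (use C in auto)
qed

lemma scheme_error_decomposition:
  fixes X :: "nat \<Rightarrow> 'a \<Rightarrow> real^'d"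
  assumes k: "0 < k" and n: "n \<le> N" and nk: "real n * k \<in> {0..T}" and \<omega>[measurable]: "\<omega> \<in> space M"
    and X: "X n \<omega> = x0 \<omega> + (k powr \<alpha> / Gamma (1 + \<alpha>)) *\<^sub>R
          (\<Sum>j\<in>{1..n}. (real (n - j + 1) powr \<alpha> - real (n - j) powr \<alpha>) *\<^sub>R (B *v X (j - 1) \<omega>))
        + G (real n * k) \<omega>"
    and Gm: "Gm (real n * k) \<omega> = G (real n * k) \<omega>"
  shows "X n \<omega> - y (real n * k) \<omega> =
    (1 / Gamma \<alpha>) *\<^sub>R (\<integral>s. frac_kernel \<alpha> (real n * k) s *\<^sub>R
        (B *v (X (min N (nat \<lfloor>s / k\<rfloor>)) \<omega> - y (grid k s) \<omega>)) \<partial>lborel)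
    - ((1 / Gamma \<alpha>)\<^sup>2 *\<^sub>R (\<integral>s. frac_kernel \<alpha> (real n * k) s *\<^sub>R (B *v (F s \<omega> - F (grid k s) \<omega>)) \<partial>lborel)
     + (1 / Gamma \<alpha>) *\<^sub>R (B *v (\<integral>s. frac_kernel \<alpha> (real n * k) s *\<^sub>R (Gm s \<omega> - Gm (grid k s) \<omega>) \<partial>lborel)))"
proof -
  define t where "t = real n * k"
  define c where "c = 1 / Gamma \<alpha>"
  let ?K = "frac_kernel \<alpha> t"
  let ?X = "\<lambda>s. X (min N (nat \<lfloor>s / k\<rfloor>)) \<omega>"
  have t: "0 \<le> t" "t \<le> T" using nk by (auto simp: t_def)
  obtain R where R: "0 \<le> R" "\<And>s. s \<in> {0..T} \<Longrightarrow> norm (y s \<omega>) \<le> R"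
    "\<And>s. s \<in> {0..T} \<Longrightarrow> norm (F s \<omega>) \<le> R" "\<And>s. s \<in> {0..T} \<Longrightarrow> norm (Gm s \<omega>) \<le> R"
    using path_bounded[OF \<omega>] by blast
  define Q where "Q = (\<Sum>i\<le>N. norm (X i \<omega>))"
  have Q: "norm (?X s) \<le> Q" for s
    unfolding Q_def by (rule member_le_sum) auto
  have [measurable]: "?X \<in> borel_measurable borel"
    by (rule measurable_compose[where N="count_space UNIV"]) auto
  have rng: "s \<in> {0..T}" "grid k s \<in> {0..T}" if "s \<in> {0..t}" for s
    using that t grid_bounds(1,3)[OF k, of s] by auto
  have Bi: "integrable lborel (\<lambda>s. ?K s *\<^sub>R (B *v g s))"
    if [measurable]: "g \<in> borel_measurable borel" and g: "\<And>s. s \<in> {0..t} \<Longrightarrow> norm (g s) \<le> r" for g r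
  proof (rule integrable_frac_kernel_scaleR[OF t(1), where R="b * r"])
    fix s assume "s \<in> {0..t}"
    then show "norm (B *v g s) \<le> b * r"
      using norm_B_le[of "g s"] mult_left_mono[OF g b_nonneg, of s] by linarith
  qed measurable
  have i1: "integrable lborel (\<lambda>s. ?K s *\<^sub>R (B *v (?X s - y (grid k s) \<omega>)))"
  proof (rule Bi[of _ "Q + R"])
    fix s assume s: "s \<in> {0..t}"
    show "norm (?X s - y (grid k s) \<omega>) \<le> Q + R"
      using norm_triangle_ineq4[of "?X s" "y (grid k s) \<omega>"] Q[of s] R(2)[OF rng(2)[OF s]] by linarith
  qed measurable
  have i2: "integrable lborel (\<lambda>s. ?K s *\<^sub>R (B *v (F s \<omega> - F (grid k s) \<omega>)))"
  proof (rule Bi[of _ "R + R"])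
    fix s assume s: "s \<in> {0..t}"
    show "norm (F s \<omega> - F (grid k s) \<omega>) \<le> R + R"
      using norm_triangle_ineq4[of "F s \<omega>" "F (grid k s) \<omega>"] R(3)[OF rng(1)[OF s]] R(3)[OF rng(2)[OF s]] by linarith
  qed measurable
  have dG: "norm (Gm s \<omega> - Gm (grid k s) \<omega>) \<le> R + R" if s: "s \<in> {0..t}" for s
    using norm_triangle_ineq4[of "Gm s \<omega>" "Gm (grid k s) \<omega>"] R(4)[OF rng(1)[OF s]] R(4)[OF rng(2)[OF s]] by linarith
  have i3: "integrable lborel (\<lambda>s. ?K s *\<^sub>R (B *v (Gm s \<omega> - Gm (grid k s) \<omega>)))"
    by (rule Bi[of _ "R + R"], measurable, rule dG)
  have i3': "integrable lborel (\<lambda>s. ?K s *\<^sub>R (Gm s \<omega> - Gm (grid k s) \<omega>))"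
    by (rule integrable_frac_kernel_scaleR[OF t(1), where R="R + R"], measurable, rule dG)
  have iX: "integrable lborel (\<lambda>s. ?K s *\<^sub>R (B *v ?X s))"
    by (rule Bi[of _ Q], measurable, rule Q)
  have iy: "integrable lborel (\<lambda>s. ?K s *\<^sub>R (B *v y s \<omega>))"
    using integrable_F[OF t(1) \<omega>] .
  have lin: "B *v (c *\<^sub>R v) = c *\<^sub>R (B *v v)" for c v
    using linear_scale[OF matrix_vector_mul_linear[of B]] .
  have pull: "(\<integral>s. ?K s *\<^sub>R (B *v (Gm s \<omega> - Gm (grid k s) \<omega>)) \<partial>lborel)
      = B *v (\<integral>s. ?K s *\<^sub>R (Gm s \<omega> - Gm (grid k s) \<omega>) \<partial>lborel)"
    using integral_bounded_linear[OF matrix_vector_mul_bounded_linear[of B] i3'] by (simp add: lin)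
  have pw: "?K s *\<^sub>R (B *v ?X s) - ?K s *\<^sub>R (B *v y s \<omega>)
      = ?K s *\<^sub>R (B *v (?X s - y (grid k s) \<omega>)) - c *\<^sub>R (?K s *\<^sub>R (B *v (F s \<omega> - F (grid k s) \<omega>)))
       - ?K s *\<^sub>R (B *v (Gm s \<omega> - Gm (grid k s) \<omega>))" for s
  proof -
    have "?X s - y s \<omega> = (?X s - y (grid k s) \<omega>) - (c *\<^sub>R (F s \<omega> - F (grid k s) \<omega>) + (Gm s \<omega> - Gm (grid k s) \<omega>))"
      using y_diff[of s \<omega> "grid k s"] by (simp add: c_def algebra_simps)
    then have "B *v (?X s - y s \<omega>) = B *v (?X s - y (grid k s) \<omega>)
        - (c *\<^sub>R (B *v (F s \<omega> - F (grid k s) \<omega>)) + B *v (Gm s \<omega> - Gm (grid k s) \<omega>))"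
      by (simp only: matrix_vector_mult_diff_distrib matrix_vector_right_distrib lin)
    then have "?K s *\<^sub>R (B *v (?X s - y s \<omega>)) = ?K s *\<^sub>R (B *v (?X s - y (grid k s) \<omega>)
        - (c *\<^sub>R (B *v (F s \<omega> - F (grid k s) \<omega>)) + B *v (Gm s \<omega> - Gm (grid k s) \<omega>)))"
      by (rule arg_cong)
    then show ?thesis
      unfolding matrix_vector_mult_diff_distrib[of B "?X s" "y s \<omega>"] scaleR_right_diff_distrib scaleR_right_distrib
      by (simp add: mult.commute diff_diff_eq)
  qed
  have "X n \<omega> - y t \<omega> = c *\<^sub>R ((\<integral>s. ?K s *\<^sub>R (B *v ?X s) \<partial>lborel) - (\<integral>s. ?K s *\<^sub>R (B *v y s \<omega>) \<partial>lborel))"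
  proof -
    have "y t \<omega> = x0 \<omega> + c *\<^sub>R F t \<omega> + G t \<omega>"
      using Gm by (simp add: Gm_def t_def c_def algebra_simps)
    moreover have "X n \<omega> = x0 \<omega> + c *\<^sub>R (\<integral>s. ?K s *\<^sub>R (B *v ?X s) \<partial>lborel) + G t \<omega>"
      using X scheme_sum_eq[OF k n, of X \<omega>] by (simp add: t_def c_def)
    ultimately show ?thesis by (simp add: F_def scaleR_right_diff_distrib)
  qed
  also have "(\<integral>s. ?K s *\<^sub>R (B *v ?X s) \<partial>lborel) - (\<integral>s. ?K s *\<^sub>R (B *v y s \<omega>) \<partial>lborel)
      = (\<integral>s. ?K s *\<^sub>R (B *v ?X s) - ?K s *\<^sub>R (B *v y s \<omega>) \<partial>lborel)"
    by (rule Bochner_Integration.integral_diff[OF iX iy, symmetric])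
  also have "\<dots> = (\<integral>s. ?K s *\<^sub>R (B *v (?X s - y (grid k s) \<omega>)) \<partial>lborel)
      - c *\<^sub>R (\<integral>s. ?K s *\<^sub>R (B *v (F s \<omega> - F (grid k s) \<omega>)) \<partial>lborel)
      - (\<integral>s. ?K s *\<^sub>R (B *v (Gm s \<omega> - Gm (grid k s) \<omega>)) \<partial>lborel)"
    unfolding pw
    by (subst Bochner_Integration.integral_diff[OF Bochner_Integration.integrable_diff[OF i1 integrable_scaleR_right[OF i2]] i3],
        subst Bochner_Integration.integral_diff[OF i1 integrable_scaleR_right[OF i2]], subst integral_scaleR_right) auto
  finally show ?thesis
    unfolding pull by (simp add: t_def[symmetric] c_def[symmetric] power2_eq_square scaleR_right_diff_distrib scaleR_add_right diff_diff_eq)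
qed

lemma scheme_error_msq:
  assumes \<gamma>: "\<alpha> \<le> \<gamma>" "\<gamma> < 1" "2 * \<gamma> \<le> 3 * \<alpha>"
  obtains C where "0 \<le> C"
    "\<And>N k n (X :: nat \<Rightarrow> 'a \<Rightarrow> real^'d). 0 < k \<Longrightarrow> real N * k = T \<Longrightarrow>
      (\<And>n \<omega>. n \<le> N \<Longrightarrow> \<omega> \<in> space M \<Longrightarrow> X n \<omega> = x0 \<omega> + (k powr \<alpha> / Gamma (1 + \<alpha>)) *\<^sub>R
          (\<Sum>j\<in>{1..n}. (real (n - j + 1) powr \<alpha> - real (n - j) powr \<alpha>) *\<^sub>R (B *v X (j - 1) \<omega>))
        + G (real n * k) \<omega>) \<Longrightarrow> n \<le> N \<Longrightarrow>
      msq M (\<lambda>\<omega>. X n \<omega> - y (real n * k) \<omega>)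
        \<le> ennreal (C * ((k powr \<gamma>)\<^sup>2 + k powr (3 * \<alpha>) * (\<Sum>j<N. (cell_weight \<alpha> j)\<^sup>2)))"
proof -
  define c where "c = 1 / Gamma \<alpha>"
  obtain C2 where C2: "0 \<le> C2"
    "\<And>k t. 0 < k \<Longrightarrow> t \<in> {0..T} \<Longrightarrow>
       msq M (\<lambda>\<omega>. \<integral>s. frac_kernel \<alpha> t s *\<^sub>R (B *v (F s \<omega> - F (grid k s) \<omega>)) \<partial>lborel)
       \<le> ennreal (C2 * (k powr \<gamma>)\<^sup>2)"
    using msq_drift_term[OF \<gamma>] by blast
  define K where "K = 2 * c\<^sup>2 * (T powr \<alpha> / \<alpha> * b\<^sup>2)"
  have K: "0 \<le> K" using \<alpha> by (simp add: K_def)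
  obtain \<Lambda> \<delta> where \<Lambda>: "0 \<le> \<Lambda>" "0 \<le> \<delta>" "K * \<delta> \<le> 1/2"
    "\<And>t. t \<in> {0..T} \<Longrightarrow> (\<integral>\<^sup>+s. ennreal (frac_kernel \<alpha> t s * exp (\<Lambda> * s)) \<partial>lborel) \<le> ennreal (\<delta> * exp (\<Lambda> * t))"
    using gronwall_rate[OF K] by blast
  define C1 where "C1 = 4 * (c^4 * C2) + 4 * (c\<^sup>2 * (b\<^sup>2 * (2 * \<kappa> / \<alpha>\<^sup>2)))"
  have C1: "0 \<le> C1" "4 * (c^4 * C2) \<le> C1" "4 * (c\<^sup>2 * (b\<^sup>2 * (2 * \<kappa> / \<alpha>\<^sup>2))) \<le> C1"
    using C2(1) \<kappa> by (auto simp: C1_def)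
  show ?thesis
  proof (rule that[of "2 * C1 * exp (\<Lambda> * T)"])
    fix N n :: nat and k :: real and X :: "nat \<Rightarrow> 'a \<Rightarrow> real^'d"
    assume k: "0 < k" and NT: "real N * k = T" and nN: "n \<le> N"
      and X: "\<And>n \<omega>. n \<le> N \<Longrightarrow> \<omega> \<in> space M \<Longrightarrow> X n \<omega> = x0 \<omega> + (k powr \<alpha> / Gamma (1 + \<alpha>)) *\<^sub>R
          (\<Sum>j\<in>{1..n}. (real (n - j + 1) powr \<alpha> - real (n - j) powr \<alpha>) *\<^sub>R (B *v X (j - 1) \<omega>))
        + G (real n * k) \<omega>"
    have pt: "real n * k \<in> {0..T}" if "n \<le> N" for n
      using that k NT by (auto simp: NT[symmetric] mult_right_mono)
    have Xm: "X n \<in> borel_measurable M" if "n \<le> N" for n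
      using scheme_measurable[OF pt X that] by blast
    define E where "E s \<omega> = X (min N (nat \<lfloor>s / k\<rfloor>)) \<omega> - y (grid k s) \<omega>" for s \<omega>
    have Em[measurable (raw)]: "(\<lambda>z. E (f z) (g z)) \<in> borel_measurable L"
      if [measurable]: "f \<in> borel_measurable L" "g \<in> measurable L M" for f g and L :: "'z measure"
    proof -
      have [measurable]: "(\<lambda>z. X (min N i) (g z)) \<in> borel_measurable L" for i
        using measurable_compose[OF that(2) Xm[of "min N i"]] by simp
      have [measurable]: "(\<lambda>z. X (min N (nat \<lfloor>f z / k\<rfloor>)) (g z)) \<in> borel_measurable L"
        by (rule measurable_compose_countable[where f="\<lambda>i z. X (min N i) (g z)" and g="\<lambda>z. nat \<lfloor>f z / k\<rfloor>"]) measurable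
      show ?thesis unfolding E_def by measurable
    qed
    define A where "A = C1 * ((k powr \<gamma>)\<^sup>2 + k powr (3 * \<alpha>) * (\<Sum>j<N. (cell_weight \<alpha> j)\<^sup>2))"
    have A: "0 \<le> A" using C1 by (simp add: A_def sum_nonneg)
    have rec: "msq M (\<lambda>\<omega>. X n \<omega> - y (real n * k) \<omega>)
        \<le> ennreal A + ennreal K * (\<integral>\<^sup>+s. ennreal (frac_kernel \<alpha> (real n * k) s) * msq M (E s) \<partial>lborel)"
      if n: "n \<le> N" for n
    proof -
      define t where "t = real n * k"
      have t: "t \<in> {0..T}" using pt[OF n] by (simp add: t_def)
      let ?K = "frac_kernel \<alpha> t"
      let ?J = "\<integral>\<^sup>+s. ennreal (?K s) * msq M (E s) \<partial>lborel"
      define I1 where "I1 \<omega> = (\<integral>s. ?K s *\<^sub>R (B *v E s \<omega>) \<partial>lborel)" for \<omega>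
      define I2 where "I2 \<omega> = (\<integral>s. ?K s *\<^sub>R (B *v (F s \<omega> - F (grid k s) \<omega>)) \<partial>lborel)" for \<omega>
      define I3 where "I3 \<omega> = (\<integral>s. ?K s *\<^sub>R (Gm s \<omega> - Gm (grid k s) \<omega>) \<partial>lborel)" for \<omega>
      have [measurable]: "I1 \<in> borel_measurable M" "I2 \<in> borel_measurable M" "I3 \<in> borel_measurable M"
        unfolding I1_def I2_def I3_def by measurable
      have "AE \<omega> in M. X n \<omega> - y (real n * k) \<omega> = c *\<^sub>R I1 \<omega> - (c\<^sup>2 *\<^sub>R I2 \<omega> + c *\<^sub>R (B *v I3 \<omega>))"
        using Gm_AE[OF pt[OF n]]
      proof (rule AE_mp, intro AE_I2 impI)
        fix \<omega> assume \<omega>: "\<omega> \<in> space M" "Gm (real n * k) \<omega> = G (real n * k) \<omega>"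
        show "X n \<omega> - y (real n * k) \<omega> = c *\<^sub>R I1 \<omega> - (c\<^sup>2 *\<^sub>R I2 \<omega> + c *\<^sub>R (B *v I3 \<omega>))"
          unfolding I1_def I2_def I3_def E_def t_def c_def
          by (rule scheme_error_decomposition[where X=X, OF k n pt[OF n] \<omega>(1) X[OF n \<omega>(1)] \<omega>(2)])
      qed
      then have "msq M (\<lambda>\<omega>. X n \<omega> - y (real n * k) \<omega>)
          = msq M (\<lambda>\<omega>. c *\<^sub>R I1 \<omega> - (c\<^sup>2 *\<^sub>R I2 \<omega> + c *\<^sub>R (B *v I3 \<omega>)))"
        by (rule msq_cong_AE)
      also have "\<dots> \<le> 2 * msq M (\<lambda>\<omega>. c *\<^sub>R I1 \<omega>) + 2 * msq M (\<lambda>\<omega>. c\<^sup>2 *\<^sub>R I2 \<omega> + c *\<^sub>R (B *v I3 \<omega>))"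
        by (rule msq_diff_le) measurable
      also have "msq M (\<lambda>\<omega>. c\<^sup>2 *\<^sub>R I2 \<omega> + c *\<^sub>R (B *v I3 \<omega>))
          \<le> 2 * msq M (\<lambda>\<omega>. c\<^sup>2 *\<^sub>R I2 \<omega>) + 2 * msq M (\<lambda>\<omega>. c *\<^sub>R (B *v I3 \<omega>))"
        by (rule msq_add_le) measurable
      also have "msq M (\<lambda>\<omega>. c *\<^sub>R I1 \<omega>) = ennreal (c\<^sup>2) * msq M I1" by (rule msq_scaleR) measurable
      also have "msq M (\<lambda>\<omega>. c\<^sup>2 *\<^sub>R I2 \<omega>) = ennreal ((c\<^sup>2)\<^sup>2) * msq M I2" by (rule msq_scaleR) measurable
      also have "msq M (\<lambda>\<omega>. c *\<^sub>R (B *v I3 \<omega>)) = ennreal (c\<^sup>2) * msq M (\<lambda>\<omega>. B *v I3 \<omega>)"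
        by (rule msq_scaleR) measurable
      also have "msq M (\<lambda>\<omega>. B *v I3 \<omega>) \<le> ennreal (b\<^sup>2) * msq M I3" by (rule msq_B_le) measurable
      also have "msq M I1 \<le> ennreal (T powr \<alpha> / \<alpha> * b\<^sup>2) * ?J"
        unfolding I1_def by (rule msq_frac_integral_le[OF _ t]) measurable
      also have "msq M I2 \<le> ennreal (C2 * (k powr \<gamma>)\<^sup>2)"
        unfolding I2_def by (rule C2(2)[OF k t])
      also have "msq M I3 \<le> ennreal (2 * \<kappa> / \<alpha>\<^sup>2 * (k powr (3 * \<alpha>) * (\<Sum>j<N. (cell_weight \<alpha> j)\<^sup>2)))"
      proof -
        have "msq M I3 \<le> ennreal (2 * \<kappa> * k powr \<alpha> * (\<Sum>j<n. (k powr \<alpha> / \<alpha> * cell_weight \<alpha> j)\<^sup>2))"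
          unfolding I3_def t_def using pt[OF n] by (intro msq_noise_term[OF k]) auto
        also have "2 * \<kappa> * k powr \<alpha> * (\<Sum>j<n. (k powr \<alpha> / \<alpha> * cell_weight \<alpha> j)\<^sup>2)
            = 2 * \<kappa> / \<alpha>\<^sup>2 * (k powr (3 * \<alpha>) * (\<Sum>j<n. (cell_weight \<alpha> j)\<^sup>2))"
        proof -
          have "k powr (3 * \<alpha>) = k powr \<alpha> * (k powr \<alpha>)\<^sup>2"
            by (simp add: power2_eq_square powr_add[symmetric])
          then show ?thesis
            by (simp add: power_mult_distrib power_divide sum_distrib_left mult_ac)
        qed
        also have "ennreal \<dots> \<le> ennreal (2 * \<kappa> / \<alpha>\<^sup>2 * (k powr (3 * \<alpha>) * (\<Sum>j<N. (cell_weight \<alpha> j)\<^sup>2)))"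
          using n \<kappa> by (intro ennreal_leI mult_left_mono sum_mono2) auto
        finally show ?thesis .
      qed
      finally have "msq M (\<lambda>\<omega>. X n \<omega> - y (real n * k) \<omega>)
        \<le> 2 * (ennreal (c\<^sup>2) * (ennreal (T powr \<alpha> / \<alpha> * b\<^sup>2) * ?J))
          + 2 * (2 * (ennreal ((c\<^sup>2)\<^sup>2) * ennreal (C2 * (k powr \<gamma>)\<^sup>2))
             + 2 * (ennreal (c\<^sup>2) * (ennreal (b\<^sup>2) * ennreal (2 * \<kappa> / \<alpha>\<^sup>2 * (k powr (3 * \<alpha>) * (\<Sum>j<N. (cell_weight \<alpha> j)\<^sup>2))))))"
        by (simp add: mult_left_mono add_mono)
      also have "2 * (ennreal (c\<^sup>2) * (ennreal (T powr \<alpha> / \<alpha> * b\<^sup>2) * ?J)) = ennreal K * ?J"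
      proof -
        have "ennreal K = 2 * (ennreal (c\<^sup>2) * ennreal (T powr \<alpha> / \<alpha> * b\<^sup>2))"
          using \<alpha> by (simp add: K_def two_mult_ennreal ennreal_mult[symmetric] mult.assoc)
        then show ?thesis by (simp add: mult.assoc)
      qed
      also have "2 * (2 * (ennreal ((c\<^sup>2)\<^sup>2) * ennreal (C2 * (k powr \<gamma>)\<^sup>2))
             + 2 * (ennreal (c\<^sup>2) * (ennreal (b\<^sup>2) * ennreal (2 * \<kappa> / \<alpha>\<^sup>2 * (k powr (3 * \<alpha>) * (\<Sum>j<N. (cell_weight \<alpha> j)\<^sup>2))))))
          \<le> ennreal A"
      proof -
        define S where "S = k powr (3 * \<alpha>) * (\<Sum>j<N. (cell_weight \<alpha> j)\<^sup>2)"
        have S: "0 \<le> S" by (simp add: S_def sum_nonneg)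
        define u where "u = 2 * \<kappa> / \<alpha>\<^sup>2"
        have u: "0 \<le> u" using \<kappa> by (simp add: u_def)
        have "2 * (2 * (ennreal ((c\<^sup>2)\<^sup>2) * ennreal (C2 * (k powr \<gamma>)\<^sup>2))
             + 2 * (ennreal (c\<^sup>2) * (ennreal (b\<^sup>2) * ennreal (u * S))))
            = ennreal (4 * (c^4 * C2) * (k powr \<gamma>)\<^sup>2 + 4 * (c\<^sup>2 * (b\<^sup>2 * u)) * S)"
          using C2(1) S u
          by (simp add: two_mult_ennreal ennreal_mult[symmetric] ennreal_plus[symmetric] del: ennreal_plus)
        also have "\<dots> \<le> ennreal A"
        proof (rule ennreal_leI)
          have "4 * (c^4 * C2) * (k powr \<gamma>)\<^sup>2 \<le> C1 * (k powr \<gamma>)\<^sup>2"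
            using C1(2) by (intro mult_right_mono) auto
          moreover have "4 * (c\<^sup>2 * (b\<^sup>2 * u)) * S \<le> C1 * S"
            using C1(3) S by (intro mult_right_mono) (auto simp: u_def)
          ultimately show "4 * (c^4 * C2) * (k powr \<gamma>)\<^sup>2 + 4 * (c\<^sup>2 * (b\<^sup>2 * u)) * S \<le> A"
            unfolding A_def S_def[symmetric] distrib_left by linarith
        qed
        finally show ?thesis by (simp only: S_def u_def)
      qed
      finally show ?thesis by (simp add: add.commute t_def)
    qed
    have "msq M (\<lambda>\<omega>. X n \<omega> - y (real n * k) \<omega>) \<le> ennreal (2 * A * exp (\<Lambda> * (real n * k)))" if "n \<le> N" for n
      using that
    proof (induction n rule: less_induct)
      case (less n)
      define t where "t = real n * k"
      have t: "t \<in> {0..T}" using pt[OF less.prems] by (simp add: t_def)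
      have "(\<integral>\<^sup>+s. ennreal (frac_kernel \<alpha> t s) * msq M (E s) \<partial>lborel)
          \<le> (\<integral>\<^sup>+s. ennreal (2 * A) * ennreal (frac_kernel \<alpha> t s * exp (\<Lambda> * s)) \<partial>lborel)"
      proof (intro nn_integral_mono)
        fix s
        show "ennreal (frac_kernel \<alpha> t s) * msq M (E s) \<le> ennreal (2 * A) * ennreal (frac_kernel \<alpha> t s * exp (\<Lambda> * s))"
        proof (cases "frac_kernel \<alpha> t s = 0")
          case False
          then have s: "0 \<le> s" "s < real n * k" using frac_kernel_nonzeroD t_def by blast+
          define i where "i = nat \<lfloor>s / k\<rfloor>"
          have i: "i < n" "grid k s = real i * k" using grid_index[OF k s] by (auto simp: i_def)
          have "msq M (E s) = msq M (\<lambda>\<omega>. X i \<omega> - y (real i * k) \<omega>)"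
            using i less.prems by (simp add: E_def[abs_def] i_def[symmetric])
          also have "\<dots> \<le> ennreal (2 * A * exp (\<Lambda> * (real i * k)))"
            using less.IH[OF i(1)] i less.prems by simp
          also have "\<dots> \<le> ennreal (2 * A * exp (\<Lambda> * s))"
          proof -
            have "real i * k \<le> s" using grid_bounds(1)[OF k, of s] i(2) by simp
            then have "\<Lambda> * (real i * k) \<le> \<Lambda> * s" using \<Lambda>(1) by (rule mult_left_mono)
            then show ?thesis using A by (intro ennreal_leI mult_left_mono) auto
          qed
          finally have "ennreal (frac_kernel \<alpha> t s) * msq M (E s) \<le> ennreal (frac_kernel \<alpha> t s) * ennreal (2 * A * exp (\<Lambda> * s))"
            by (rule mult_left_mono) simp
          then show ?thesis using A by (simp add: ennreal_mult[symmetric] mult_ac)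
        qed simp
      qed
      also have "\<dots> = ennreal (2 * A) * (\<integral>\<^sup>+s. ennreal (frac_kernel \<alpha> t s * exp (\<Lambda> * s)) \<partial>lborel)"
        by (rule nn_integral_cmult) simp
      also have "\<dots> \<le> ennreal (2 * A) * ennreal (\<delta> * exp (\<Lambda> * t))"
        using \<Lambda>(4)[OF t] by (intro mult_left_mono) auto
      finally have "msq M (\<lambda>\<omega>. X n \<omega> - y (real n * k) \<omega>)
          \<le> ennreal A + ennreal K * (ennreal (2 * A) * ennreal (\<delta> * exp (\<Lambda> * t)))"
        using rec[OF less.prems] unfolding t_def by (meson add_left_mono dual_order.trans mult_left_mono zero_le)
      also have "\<dots> = ennreal (A + (K * \<delta>) * (2 * A * exp (\<Lambda> * t)))"
        using A K \<Lambda>(2) by (simp add: ennreal_plus[symmetric] ennreal_mult[symmetric] mult_ac del: ennreal_plus)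
      also have "\<dots> \<le> ennreal (A * exp (\<Lambda> * t) + 1/2 * (2 * A * exp (\<Lambda> * t)))"
      proof (intro ennreal_leI add_mono)
        have "1 \<le> exp (\<Lambda> * t)" using \<Lambda>(1) t by simp
        then show "A \<le> A * exp (\<Lambda> * t)" using A by (simp add: mult_le_cancel_left1)
        show "K * \<delta> * (2 * A * exp (\<Lambda> * t)) \<le> 1/2 * (2 * A * exp (\<Lambda> * t))"
          using \<Lambda>(3) A by (intro mult_right_mono) auto
      qed
      also have "A * exp (\<Lambda> * t) + 1/2 * (2 * A * exp (\<Lambda> * t)) = 2 * A * exp (\<Lambda> * t)" by simp
      finally show ?case by (simp add: t_def)
    qed
    from this[OF nN] have "msq M (\<lambda>\<omega>. X n \<omega> - y (real n * k) \<omega>) \<le> ennreal (2 * A * exp (\<Lambda> * (real n * k)))" .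
    also have "\<dots> \<le> ennreal (2 * A * exp (\<Lambda> * T))"
    proof -
      have "\<Lambda> * (real n * k) \<le> \<Lambda> * T" using pt[OF nN] \<Lambda>(1) by (intro mult_left_mono) auto
      then show ?thesis using A by (intro ennreal_leI mult_left_mono) auto
    qed
    also have "2 * A * exp (\<Lambda> * T) = 2 * C1 * exp (\<Lambda> * T) * ((k powr \<gamma>)\<^sup>2 + k powr (3 * \<alpha>) * (\<Sum>j<N. (cell_weight \<alpha> j)\<^sup>2))"
      by (simp add: A_def)
    finally show "msq M (\<lambda>\<omega>. X n \<omega> - y (real n * k) \<omega>)
        \<le> ennreal (2 * C1 * exp (\<Lambda> * T) * ((k powr \<gamma>)\<^sup>2 + k powr (3 * \<alpha>) * (\<Sum>j<N. (cell_weight \<alpha> j)\<^sup>2)))" .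
  qed (use C1 in auto)
qed

end

subsection \<open>Convergence rates\<close>

lemma cell_weight_square_le:
  assumes "0 < \<alpha>" "\<alpha> \<le> 1"
  shows "(cell_weight \<alpha> j)\<^sup>2 \<le> real (Suc j) powr (2 * \<alpha> - 2)"
proof -
  have "cell_weight \<alpha> j \<le> real (Suc j) powr (\<alpha> - 1) * (real (Suc j) - real j)"
    unfolding cell_weight_def Suc_eq_plus1 using assms by (intro powr_diff_le) auto
  then have "cell_weight \<alpha> j \<le> real (Suc j) powr (\<alpha> - 1)" by simp
  then have "(cell_weight \<alpha> j)\<^sup>2 \<le> (real (Suc j) powr (\<alpha> - 1))\<^sup>2"
    using assms by (intro power_mono cell_weight_nonneg) auto
  also have "\<dots> = real (Suc j) powr (2 * \<alpha> - 2)"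
    by (simp add: power2_eq_square powr_add[symmetric])
  finally show ?thesis .
qed

lemma powr_increment_ge:
  assumes "0 < p" "p \<le> 1"
  shows "p * real (Suc j) powr (p - 1) \<le> real (Suc j) powr p - real j powr p"
proof -
  let ?m = "real (Suc j)"
  let ?\<phi> = "\<lambda>u. u powr p - p * ?m powr (p - 1) * u"
  have "?\<phi> (real j) \<le> ?\<phi> ?m"
  proof (rule DERIV_nonneg_imp_increasing_open[where f="?\<phi>"])
    fix u assume u: "real j < u" "u < ?m"
    have u0: "0 < u" using u(1) by (rule le_less_trans[rotated]) simp
    have "(?\<phi> has_real_derivative (p * u powr (p - 1) - p * ?m powr (p - 1))) (at u)"
      using u0 by (auto intro!: derivative_eq_intros)
    moreover have "?m powr (p - 1) \<le> u powr (p - 1)"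
      using u u0 assms by (intro powr_mono2') auto
    ultimately show "\<exists>d. (?\<phi> has_real_derivative d) (at u) \<and> 0 \<le> d"
      using assms by (intro exI[of _ "p * u powr (p - 1) - p * ?m powr (p - 1)"]) auto
  next
    show "continuous_on {real j..?m} ?\<phi>"
      using assms by (intro continuous_intros continuous_on_powr') auto
  qed simp
  then show ?thesis by (simp add: algebra_simps)
qed

lemma sum_cell_weight_square_bounded:
  assumes "0 < \<alpha>" "\<alpha> < 1/2"
  obtains S where "0 \<le> S" "\<And>N. (\<Sum>j<N. (cell_weight \<alpha> j)\<^sup>2) \<le> S"
proof -
  have sm: "summable (\<lambda>j. real (Suc j) powr (2 * \<alpha> - 2))"
    using summable_real_powr_iff[of "2 * \<alpha> - 2"] assms
    by (subst summable_Suc_iff[of "\<lambda>j. real j powr (2 * \<alpha> - 2)"]) simp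
  show ?thesis
  proof (rule that[of "\<Sum>j. real (Suc j) powr (2 * \<alpha> - 2)"])
    show "0 \<le> (\<Sum>j. real (Suc j) powr (2 * \<alpha> - 2))" by (rule suminf_nonneg[OF sm]) simp
    fix N
    have "(\<Sum>j<N. (cell_weight \<alpha> j)\<^sup>2) \<le> (\<Sum>j<N. real (Suc j) powr (2 * \<alpha> - 2))"
      using assms by (intro sum_mono cell_weight_square_le) auto
    also have "\<dots> \<le> (\<Sum>j. real (Suc j) powr (2 * \<alpha> - 2))"
      by (rule sum_le_suminf[OF sm]) auto
    finally show "(\<Sum>j<N. (cell_weight \<alpha> j)\<^sup>2) \<le> (\<Sum>j. real (Suc j) powr (2 * \<alpha> - 2))" .
  qed
qed

lemma sum_cell_weight_square_critical:
  assumes "0 < N"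
  shows "(\<Sum>j<N. (cell_weight (1/2) j)\<^sup>2) \<le> 1 + ln (real N)"
proof -
  have "(\<Sum>j<N. (cell_weight (1/2) j)\<^sup>2) \<le> (\<Sum>j<N. inverse (real (Suc j)))"
  proof (rule sum_mono)
    fix j
    show "(cell_weight (1/2) j)\<^sup>2 \<le> inverse (real (Suc j))"
      using cell_weight_square_le[of "1/2" j] by (simp add: powr_minus)
  qed
  also have "\<dots> = harm N"
    by (simp add: harm_altdef)
  also have "\<dots> \<le> 1 + ln (real N)"
    using euler_mascheroni_sequence_decreasing[of 1 N] assms by (simp add: harm_expand)
  finally show ?thesis .
qed

lemma sum_cell_weight_square_powr:
  assumes "1/2 < \<alpha>" "\<alpha> < 1"
  shows "(\<Sum>j<N. (cell_weight \<alpha> j)\<^sup>2) \<le> real N powr (2 * \<alpha> - 1) / (2 * \<alpha> - 1)"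
proof -
  define p where "p = 2 * \<alpha> - 1"
  have p: "0 < p" "p \<le> 1" using assms by (auto simp: p_def)
  have "(\<Sum>j<N. (cell_weight \<alpha> j)\<^sup>2) \<le> (\<Sum>j<N. (real (Suc j) powr p - real j powr p) / p)"
  proof (rule sum_mono)
    fix j
    have "(cell_weight \<alpha> j)\<^sup>2 \<le> real (Suc j) powr (p - 1)"
      using cell_weight_square_le[of \<alpha> j] assms by (simp add: p_def)
    also have "\<dots> \<le> (real (Suc j) powr p - real j powr p) / p"
      using powr_increment_ge[OF p, of j] p by (simp add: pos_le_divide_eq mult.commute)
    finally show "(cell_weight \<alpha> j)\<^sup>2 \<le> (real (Suc j) powr p - real j powr p) / p" .
  qed
  also have "\<dots> = (\<Sum>j<N. real (Suc j) powr p - real j powr p) / p"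
    by (rule sum_divide_distrib[symmetric])
  also have "(\<Sum>j<N. real (Suc j) powr p - real j powr p) = real N powr p"
    using sum_lessThan_telescope[of "\<lambda>j. real j powr p" N] by simp
  finally show ?thesis by (simp add: p_def)
qed

definition strong_rate :: "real \<Rightarrow> real \<Rightarrow> real" where
  "strong_rate H k = (if 3/4 < H then k powr (3 - 3 * H)
     else if H = 3/4 then sqrt \<bar>ln k\<bar> * k powr (3/4) else k powr (3/2 - H))"

lemma strong_rate_nonneg: "0 \<le> strong_rate H k"
  by (simp add: strong_rate_def)

lemma strong_rate_bound:
  assumes T: "0 < T" and H: "1/2 < H" "H < 1" and \<alpha>: "\<alpha> = 2 - 2 * H"
    and \<gamma>: "\<gamma> = min (3 - 3 * H) (3/2 - H)"
  obtains C where "0 \<le> C"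
    "\<And>N. 0 < N \<Longrightarrow> T / real N < 1 \<Longrightarrow>
      ((T / real N) powr \<gamma>)\<^sup>2 + (T / real N) powr (3 * \<alpha>) * (\<Sum>j<N. (cell_weight \<alpha> j)\<^sup>2)
      \<le> C * (strong_rate H (T / real N))\<^sup>2"
proof -
  have a: "0 < \<alpha>" "\<alpha> < 1" using H \<alpha> by auto
  consider (sup) "3/4 < H" | (crit) "H = 3/4" | (sub) "H < 3/4" by linarith
  then show ?thesis
  proof cases
    case sup
    then have g: "\<gamma> = 3 - 3 * H" by (simp add: \<gamma>)
    obtain S where S: "0 \<le> S" "\<And>N. (\<Sum>j<N. (cell_weight \<alpha> j)\<^sup>2) \<le> S"
      using sum_cell_weight_square_bounded[of \<alpha>] a sup \<alpha> by auto
    show ?thesis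
    proof (rule that[of "1 + S"])
      fix N :: nat
      define k where "k = T / real N"
      have "k powr (3 * \<alpha>) = (k powr \<gamma>)\<^sup>2"
        by (simp add: power2_eq_square powr_add[symmetric] g \<alpha>)
      moreover have "(k powr \<gamma>)\<^sup>2 * (\<Sum>j<N. (cell_weight \<alpha> j)\<^sup>2) \<le> (k powr \<gamma>)\<^sup>2 * S"
        using S(2) by (intro mult_left_mono) auto
      ultimately show "((T / real N) powr \<gamma>)\<^sup>2 + (T / real N) powr (3 * \<alpha>) * (\<Sum>j<N. (cell_weight \<alpha> j)\<^sup>2)
          \<le> (1 + S) * (strong_rate H (T / real N))\<^sup>2"
        using sup unfolding k_def[symmetric] by (simp add: strong_rate_def g algebra_simps)
    qed (use S in auto)
  next
    case crit
    then have g: "\<gamma> = 3/4" "\<alpha> = 1/2" by (auto simp: \<gamma> \<alpha>)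
    \<comment> \<open>The step size stays away from 1, since \<open>T / real N < 1\<close> forces \<open>N \<ge> \<lfloor>T\<rfloor> + 1\<close>.\<close>
    define lam where "lam = ln (of_int (\<lfloor>T\<rfloor> + 1) / T)"
    have l: "0 < lam"
    proof -
      have "T < of_int (\<lfloor>T\<rfloor> + 1)" by linarith
      then have "1 < of_int (\<lfloor>T\<rfloor> + 1) / T" using T by (simp add: pos_less_divide_eq del: of_int_add)
      then show ?thesis unfolding lam_def by (rule ln_gt_zero)
    qed
    define q where "q = (2 + \<bar>ln T\<bar>) / lam + 1"
    show ?thesis
    proof (rule that[of q])
      show "0 \<le> q" using l by (simp add: q_def)
      fix N :: nat assume N: "0 < N" "T / real N < 1"
      define k where "k = T / real N"
      have k: "0 < k" "k < 1" using N T by (auto simp: k_def)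
      have "T < real N" using N by (simp add: field_simps)
      then have "\<lfloor>T\<rfloor> + 1 \<le> int N" by linarith
      then have "of_int (\<lfloor>T\<rfloor> + 1) \<le> real N" by linarith
      moreover have "0 < (of_int (\<lfloor>T\<rfloor> + 1) :: real)" using T by linarith
      ultimately have "lam \<le> ln (real N / T)"
        unfolding lam_def using T N by (subst ln_le_cancel_iff) (auto simp: divide_right_mono)
      also have lnk: "ln (real N / T) = - ln k" using T N by (simp add: k_def ln_div)
      finally have lk: "lam \<le> \<bar>ln k\<bar>" by simp
      have "ln (real N) = ln T - ln k" using T N by (simp add: k_def ln_div)
      then have "2 + ln (real N) \<le> (2 + \<bar>ln T\<bar>) * 1 + \<bar>ln k\<bar>" by simp
      also have "\<dots> \<le> (2 + \<bar>ln T\<bar>) * (\<bar>ln k\<bar> / lam) + \<bar>ln k\<bar>"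
        using lk l by (intro add_mono mult_left_mono) (auto simp: pos_le_divide_eq)
      also have "\<dots> = q * \<bar>ln k\<bar>" by (simp add: q_def algebra_simps add_divide_distrib)
      finally have ln: "2 + ln (real N) \<le> q * \<bar>ln k\<bar>" .
      have e: "k powr (3 * \<alpha>) = (k powr \<gamma>)\<^sup>2"
        by (simp add: power2_eq_square powr_add[symmetric] g)
      have sc: "(\<Sum>j<N. (cell_weight \<alpha> j)\<^sup>2) \<le> 1 + ln (real N)"
        unfolding g(2) by (rule sum_cell_weight_square_critical[OF N(1)])
      have "(k powr \<gamma>)\<^sup>2 + k powr (3 * \<alpha>) * (\<Sum>j<N. (cell_weight \<alpha> j)\<^sup>2)
          \<le> (k powr \<gamma>)\<^sup>2 + (k powr \<gamma>)\<^sup>2 * (1 + ln (real N))"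
        unfolding e using sc by (intro add_left_mono mult_left_mono) auto
      also have "\<dots> = (k powr \<gamma>)\<^sup>2 * (2 + ln (real N))" by (simp add: algebra_simps)
      also have "\<dots> \<le> (k powr \<gamma>)\<^sup>2 * (q * \<bar>ln k\<bar>)" using ln by (intro mult_left_mono) auto
      also have "\<dots> = q * (strong_rate H k)\<^sup>2"
        using crit by (simp add: strong_rate_def g power_mult_distrib)
      finally show "((T / real N) powr \<gamma>)\<^sup>2 + (T / real N) powr (3 * \<alpha>) * (\<Sum>j<N. (cell_weight \<alpha> j)\<^sup>2)
          \<le> q * (strong_rate H (T / real N))\<^sup>2"
        by (simp add: k_def)
    qed
  next
    case sub
    then have g: "\<gamma> = 3/2 - H" by (simp add: \<gamma>)
    have a2: "1/2 < \<alpha>" using sub \<alpha> by simp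
    define p where "p = 2 * \<alpha> - 1"
    have p: "0 < p" using a2 by (simp add: p_def)
    define Q where "Q = T powr p / p"
    show ?thesis
    proof (rule that[of "1 + Q"])
      show "0 \<le> 1 + Q" using p by (simp add: Q_def)
      fix N :: nat assume N: "0 < N"
      define k where "k = T / real N"
      have k: "0 < k" using N T by (auto simp: k_def)
      have "real N = T / k" using N T by (simp add: k_def)
      then have "real N powr p = T powr p / k powr p" using T k by (simp add: powr_divide)
      then have "k powr (3 * \<alpha>) * (real N powr p / p) = (k powr (3 * \<alpha>) / k powr p) * Q"
        by (simp add: Q_def)
      also have "k powr (3 * \<alpha>) / k powr p = (k powr \<gamma>)\<^sup>2"
        using k by (simp add: powr_diff[symmetric] power2_eq_square powr_add[symmetric] g p_def \<alpha>)
      finally have "k powr (3 * \<alpha>) * (real N powr p / p) = (k powr \<gamma>)\<^sup>2 * Q" .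
      moreover have "k powr (3 * \<alpha>) * (\<Sum>j<N. (cell_weight \<alpha> j)\<^sup>2) \<le> k powr (3 * \<alpha>) * (real N powr p / p)"
        using sum_cell_weight_square_powr[OF a2 a(2)] by (intro mult_left_mono) (auto simp: p_def)
      ultimately show "((T / real N) powr \<gamma>)\<^sup>2 + (T / real N) powr (3 * \<alpha>) * (\<Sum>j<N. (cell_weight \<alpha> j)\<^sup>2)
          \<le> (1 + Q) * (strong_rate H (T / real N))\<^sup>2"
        using sub unfolding k_def[symmetric] by (simp add: strong_rate_def g algebra_simps)
    qed
  qed
qed

theorem mainTheorem4:
  fixes M :: "'a measure"
    and T H \<sigma> \<alpha> :: real
    and x0 :: "'a \<Rightarrow> real^'d::finite"
    and BH G x :: "real \<Rightarrow> 'a \<Rightarrow> real^'d"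
    and B :: "real^'d^'d"
  assumes P: "prob_space M"
    and T: "T > 0"
    and H: "1/2 < H" "H < 1"
    and alpha: "\<alpha> = 2 - 2*H"
    and sigma: "\<sigma> > 0"
    and x0_meas: "x0 \<in> borel_measurable M"
    and x0_L2: "integrable M (\<lambda>\<omega>. (norm (x0 \<omega>))\<^sup>2)"
    and BH: "vec_fbm M H BH"
    and G: "\<forall>t\<in>{0..T}. is_frac_noise M \<sigma> \<alpha> BH G t"
    and x_meas: "\<forall>t\<in>{0..T}. x t \<in> borel_measurable M"
    and x_cont: "\<forall>\<omega>\<in>space M. continuous_on {0..T} (\<lambda>t. x t \<omega>)"
    and x_eq: "\<forall>t\<in>{0..T}. AE \<omega> in M.
        x t \<omega> = x0 \<omega> + (1 / Gamma \<alpha>) *\<^sub>R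
           (LINT s:{0..t}|lborel. (t - s) powr (\<alpha> - 1) *\<^sub>R (B *v x s \<omega>)) + G t \<omega>"
  shows "\<exists>C. \<forall>(N::nat) (X :: nat \<Rightarrow> 'a \<Rightarrow> real^'d).
     0 < N \<longrightarrow> T / real N < 1 \<longrightarrow>
     (\<forall>n\<le>N. \<forall>\<omega>\<in>space M. X n \<omega> = x0 \<omega> +
        ((T / real N) powr \<alpha> / Gamma (1 + \<alpha>)) *\<^sub>R
          (\<Sum>j\<in>{1..n}. (real (n - j + 1) powr \<alpha> - real (n - j) powr \<alpha>) *\<^sub>R (B *v X (j - 1) \<omega>))
        + G (real n * (T / real N)) \<omega>) \<longrightarrow>
     (\<forall>n\<le>N.
        integrable M (\<lambda>\<omega>. (norm (X n \<omega> - x (real n * (T / real N)) \<omega>))\<^sup>2) \<and>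
        L2norm M (\<lambda>\<omega>. X n \<omega> - x (real n * (T / real N)) \<omega>)
        \<le> (if 3/4 < H then C * (T / real N) powr (3 - 3*H)
            else if H = 3/4 then C * sqrt \<bar>ln (T / real N)\<bar> * (T / real N) powr (3/4)
            else C * (T / real N) powr (3/2 - H)))"
proof -
  interpret prob_space M by (rule P)
  have a: "0 < \<alpha>" "\<alpha> < 1" using H alpha by auto
  have W: "fbm M H (\<lambda>t \<omega>. BH t \<omega> $ c)" for c using BH by (simp add: vec_fbm_def)
  define \<kappa> where "\<kappa> = real CARD('d) * noise_const \<sigma> \<alpha> H"
  interpret V: frac_volterra M T \<alpha> \<kappa> x0 G x B
  proof
    show "0 \<le> \<kappa>" using noise_const_nonneg[OF a H(1)] by (simp add: \<kappa>_def)
    show "(\<integral>\<omega>. (G s \<omega> - G a \<omega>) \<bullet> (G r \<omega> - G b \<omega>) \<partial>M)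
        = \<kappa> * (\<bar>s - b\<bar> powr \<alpha> + \<bar>a - r\<bar> powr \<alpha> - \<bar>s - r\<bar> powr \<alpha> - \<bar>a - b\<bar> powr \<alpha>)"
      if "s \<in> {0..T}" "a \<in> {0..T}" "r \<in> {0..T}" "b \<in> {0..T}" for s a r b
      unfolding \<kappa>_def using G that by (intro frac_noise_increment_cov[OF H alpha W]) auto
    show "G t \<in> borel_measurable M" if "t \<in> {0..T}" for t
      using G that frac_noise_measurable by blast
    show "integrable M (\<lambda>\<omega>. (norm (G t \<omega>))\<^sup>2)" if "t \<in> {0..T}" for t
      using G that frac_noise_L2 by blast
  qed (use T a x0_meas x0_L2 x_meas x_cont x_eq in auto)
  define \<gamma> where "\<gamma> = min (3 - 3 * H) (3/2 - H)"
  have \<gamma>: "\<alpha> \<le> \<gamma>" "\<gamma> < 1" "2 * \<gamma> \<le> 3 * \<alpha>" using H by (auto simp: \<gamma>_def alpha min_def)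
  obtain C1 where C1: "0 \<le> C1"
    "\<And>N k n (X :: nat \<Rightarrow> 'a \<Rightarrow> real^'d). 0 < k \<Longrightarrow> real N * k = T \<Longrightarrow>
      (\<And>n \<omega>. n \<le> N \<Longrightarrow> \<omega> \<in> space M \<Longrightarrow> X n \<omega> = x0 \<omega> + (k powr \<alpha> / Gamma (1 + \<alpha>)) *\<^sub>R
          (\<Sum>j\<in>{1..n}. (real (n - j + 1) powr \<alpha> - real (n - j) powr \<alpha>) *\<^sub>R (B *v X (j - 1) \<omega>))
        + G (real n * k) \<omega>) \<Longrightarrow> n \<le> N \<Longrightarrow>
      msq M (\<lambda>\<omega>. X n \<omega> - V.y (real n * k) \<omega>)
        \<le> ennreal (C1 * ((k powr \<gamma>)\<^sup>2 + k powr (3 * \<alpha>) * (\<Sum>j<N. (cell_weight \<alpha> j)\<^sup>2)))"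
    using V.scheme_error_msq[OF \<gamma>] by blast
  obtain C2 where C2: "0 \<le> C2"
    "\<And>N. 0 < N \<Longrightarrow> T / real N < 1 \<Longrightarrow>
      ((T / real N) powr \<gamma>)\<^sup>2 + (T / real N) powr (3 * \<alpha>) * (\<Sum>j<N. (cell_weight \<alpha> j)\<^sup>2)
      \<le> C2 * (strong_rate H (T / real N))\<^sup>2"
    using strong_rate_bound[OF T H alpha \<gamma>_def] by blast
  show ?thesis
  proof (intro exI[of _ "sqrt (C1 * C2)"] allI impI)
    fix N n :: nat and X :: "nat \<Rightarrow> 'a \<Rightarrow> real^'d"
    assume N: "0 < N" "T / real N < 1" and n: "n \<le> N"
      and X: "\<forall>n\<le>N. \<forall>\<omega>\<in>space M. X n \<omega> = x0 \<omega> +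
        ((T / real N) powr \<alpha> / Gamma (1 + \<alpha>)) *\<^sub>R
          (\<Sum>j\<in>{1..n}. (real (n - j + 1) powr \<alpha> - real (n - j) powr \<alpha>) *\<^sub>R (B *v X (j - 1) \<omega>))
        + G (real n * (T / real N)) \<omega>"
    define k where "k = T / real N"
    have k: "0 < k" "real N * k = T" using N T by (auto simp: k_def)
    have pt: "real n * k \<in> {0..T}" if "n \<le> N" for n
      using that k by (auto simp: k(2)[symmetric] mult_right_mono)
    have X': "X n \<omega> = x0 \<omega> + (k powr \<alpha> / Gamma (1 + \<alpha>)) *\<^sub>R
          (\<Sum>j\<in>{1..n}. (real (n - j + 1) powr \<alpha> - real (n - j) powr \<alpha>) *\<^sub>R (B *v X (j - 1) \<omega>))
        + G (real n * k) \<omega>" if "n \<le> N" "\<omega> \<in> space M" for n \<omega>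
      using X that unfolding k_def by blast
    have [measurable]: "X n \<in> borel_measurable M"
      by (rule V.scheme_measurable[OF pt X' n])
    have [measurable]: "x (real n * k) \<in> borel_measurable M"
      using x_meas pt[OF n] by blast
    let ?e = "\<lambda>\<omega>. X n \<omega> - x (real n * k) \<omega>"
    have "msq M ?e = msq M (\<lambda>\<omega>. X n \<omega> - V.y (real n * k) \<omega>)"
      by (simp add: V.y_eq[OF pt[OF n]])
    also have "\<dots> \<le> ennreal (C1 * ((k powr \<gamma>)\<^sup>2 + k powr (3 * \<alpha>) * (\<Sum>j<N. (cell_weight \<alpha> j)\<^sup>2)))"
      by (rule C1(2)[of k N X n, OF k X' n])
    also have "\<dots> \<le> ennreal (C1 * (C2 * (strong_rate H k)\<^sup>2))"
      using C2(2)[OF N] C1(1) unfolding k_def by (intro ennreal_leI mult_left_mono)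
    finally have le: "msq M ?e \<le> ennreal (C1 * (C2 * (strong_rate H k)\<^sup>2))" .
    then have int: "integrable M (\<lambda>\<omega>. (norm (?e \<omega>))\<^sup>2)"
      by (intro msq_finite_imp_integrable) (auto intro: le_less_trans)
    have "(\<integral>\<omega>. (norm (?e \<omega>))\<^sup>2 \<partial>M) \<le> C1 * (C2 * (strong_rate H k)\<^sup>2)"
      using le C1(1) C2(1) unfolding msq_eq_integral[OF int] by simp
    then have "L2norm M ?e \<le> sqrt (C1 * (C2 * (strong_rate H k)\<^sup>2))"
      unfolding L2norm_def by (rule real_sqrt_le_mono)
    also have "\<dots> = sqrt (C1 * C2) * strong_rate H k"
      using strong_rate_nonneg[of H k] by (simp add: real_sqrt_mult)
    finally have L: "L2norm M ?e \<le> sqrt (C1 * C2) * strong_rate H k" .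
    show "integrable M (\<lambda>\<omega>. (norm (X n \<omega> - x (real n * (T / real N)) \<omega>))\<^sup>2) \<and>
        L2norm M (\<lambda>\<omega>. X n \<omega> - x (real n * (T / real N)) \<omega>)
        \<le> (if 3/4 < H then sqrt (C1 * C2) * (T / real N) powr (3 - 3*H)
            else if H = 3/4 then sqrt (C1 * C2) * sqrt \<bar>ln (T / real N)\<bar> * (T / real N) powr (3/4)
            else sqrt (C1 * C2) * (T / real N) powr (3/2 - H))"
      using int L unfolding k_def strong_rate_def by (auto split: if_splits simp: mult.assoc)
  qed
qed

end
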